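(* Let $\mathbf{L}$ be an invertible $(D\times D)$ MDO, $\|\cdot\|_{\mathcal{Z}}$ a monotone norm on $\mathbb{R}^D$ with dual norm $\|\cdot\|_{\mathcal{Z}'}$, $\|\cdot\|_{\mathcal{Y}}$ a norm on $\mathbb{R}^N$ with dual norm $\|\cdot\|_{\mathcal{Y}'}$, where $N=\dim\mathcal{N}_{\mathbf{L}}$, and $(\mathbf{p},\boldsymbol{\phi})$ an $\mathbf{L}$-admissible system. Then the function space $$\mathcal{C}_{\mathbf{L}}(\mathbb{R},\mathbb{R}^D)=\Big\{\mathbf{g}=\mathbf{L}^{\star}\{\mathbf{v}\}+\sum_{n=1}^Na_n\boldsymbol{\phi}_n:\ \mathbf{v}\in\mathcal{C}_0(\mathbb{R},\mathbb{R}^D),\ \mathbf{a}=(a_n)_{n=1}^N\in\mathbb{R}^N\Big\}$$ has the following properties. 1. It has the direct-sum representation $\mathcal{C}_{\mathbf{L}}(\mathbb{R},\mathbb{R}^D)=\mathbf{L}^{\star}\big(\mathcal{C}_0(\mathbb{R},\mathbb{R}^D)\big)\oplus\mathrm{span}\{\boldsymbol{\phi}_n\}_{n=1}^N$. 2. It is a Banach space for the norm $\|\mathbf{g}\|_{\mathcal{C}_{\mathbf{L}}}=\max(\|\mathbf{v}\|_{\mathcal{Z},\infty},\|\mathbf{a}\|_{\mathcal{Y}})$, and it is the predual of $\mathcal{M}_{\mathbf{L}}(\mathbb{R},\mathbb{R}^D)$, in the sense that $\mathcal{C}_{\mathbf{L}}(\mathbb{R},\mathbb{R}^D)'=\mathcal{M}_{\mathbf{L}}(\mathbb{R},\mathbb{R}^D)$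 when $\mathcal{M}_{\mathbf{L}}(\mathbb{R},\mathbb{R}^D)$ is equipped with the norm $$\|\mathbf{L}\{\cdot\}\|_{\mathcal{Z}',\mathcal{M}}+\big\|(\langle\cdot,\boldsymbol{\phi}_n\rangle)_{n=1}^N\big\|_{\mathcal{Y}'}.$$ 3. It is also a Banach space for the equivalent norm $\|\mathbf{g}\|_{\mathcal{C}_{\mathbf{L}}}=\max(\|\mathbf{v}\|_{\infty,\mathcal{Z}},\|\mathbf{a}\|_{\mathcal{Y}})$, and it is the predual of $\mathcal{M}_{\mathbf{L}}(\mathbb{R},\mathbb{R}^D)$, in the sense that $\mathcal{C}_{\mathbf{L}}(\mathbb{R},\mathbb{R}^D)'=\mathcal{M}_{\mathbf{L}}(\mathbb{R},\mathbb{R}^D)$ when $\mathcal{M}_{\mathbf{L}}(\mathbb{R},\mathbb{R}^D)$ is equipped with the norm $$\|\mathbf{L}\{\cdot\}\|_{\mathcal{M},\mathcal{Z}'}+\big\|(\langle\cdot,\boldsymbol{\phi}_n\rangle)_{n=1}^N\big\|_{\mathcal{Y}'}.$$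
   Context: Operators. An ordinary differential operator (ODO) is $\sum_{n}a_n\mathrm{D}^n$ (finite sum, real constants $a_n$) acting on $\mathcal{D}'(\mathbb{R})$. A $(D\times D)$ MDO is a matrix $\mathbf{L}=(\mathrm{L}_{r,c})$ of ODOs acting by $[\mathbf{L}\{\mathbf{f}\}]_r=\sum_d\mathrm{L}_{r,d}\{f_d\}$. Its determinant $\det(\mathbf{L})$ is the ODO obtained from the Leibniz formula with products replaced by compositions; $\mathbf{L}$ is invertible if $\det(\mathbf{L})\neq0$. The adjoint has entries $[\mathbf{L}^\star]_{r,c}=\mathrm{L}_{c,r}^\star$, $(\mathrm{D}^n)^\star=(-1)^n\mathrm{D}^n$. The null space is $\mathcal{N}_{\mathbf{L}}=\{\mathbf{q}\in\mathcal{D}'(\mathbb{R},\mathbb{R}^D):\mathbf{L}\{\mathbf{q}\}=\mathbf{0}\}$, of dimension $N=\deg(\det(\mathbf{L}))$ as a polynomial in $\mathrm{D}$. Measures. $\mathcal{M}(\mathbb{R})$ is the space of finite signed Radon measures with total-variation norm $\|\cdot\|_{\mathcal{M}}$, and $\mathcal{M}(\mathbb{R},\mathbb{R}^D)=\mathcal{M}(\mathbb{R})^D$. Outer norm: $\|\boldsymbol{\mu}\|_{\mathcal{M},\mathcal{Z}'}=\|(\|[\boldsymbol{\mu}]_d\|_{\mathcal{M}})_{d=1}^D\|_{\mathcal{Z}'}$. Inner norm: $\|\boldsymbol{\mu}\|_{\mathcal{Z}',\mathcal{M}}=\sup_\pi\sum_{E\in\pi}\|\boldsymbol{\mu}(E)\|_{\mathcal{Z}'}$,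 supremum over finite (measurable) partitions $\pi$ of $\mathbb{R}$. A norm on $\mathbb{R}^D$ is monotone if $|w_d|\le|v_d|$ for all $d$ implies $\|\mathbf{w}\|\le\|\mathbf{v}\|$. $\mathcal{C}_0(\mathbb{R},\mathbb{R}^D)$ is the space of continuous functions vanishing at infinity, with the norms $\|\mathbf{g}\|_{\mathcal{Z},\infty}=\sup_x\|\mathbf{g}(x)\|_{\mathcal{Z}}$ and $\|\mathbf{g}\|_{\infty,\mathcal{Z}}=\|(\sup_x|[\mathbf{g}(x)]_d|)_{d=1}^D\|_{\mathcal{Z}}$. Native space. $\mathcal{M}_{\mathbf{L}}(\mathbb{R},\mathbb{R}^D)=\{\mathbf{f}\in\mathcal{D}'(\mathbb{R},\mathbb{R}^D):\mathbf{L}\{\mathbf{f}\}\in\mathcal{M}(\mathbb{R},\mathbb{R}^D)\}$. An $\mathbf{L}$-admissible system $(\mathbf{p},\boldsymbol{\phi})$ consists of a basis $(\mathbf{p}_n)_{n=1}^N$ of $\mathcal{N}_{\mathbf{L}}$ and functions $\boldsymbol{\phi}_n\in\mathcal{D}(\mathbb{R},\mathbb{R}^D)$ (smooth, compactly supported) with $\langle\mathbf{p}_n,\boldsymbol{\phi}_m\rangle=\delta_{m,n}$ and all components supported in $[0,\phi^+]$ for a common $\phi^+\ge0$. In the norms on $\mathcal{C}_{\mathbf{L}}$, $(\mathbf{v},\mathbf{a})$ denotes the pair in the (unique) representation $\mathbf{g}=\mathbf{L}^\star\{\mathbf{v}\}+\sum_na_n\boldsymbol{\phi}_n$. The prime denotes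 the topological dual.
   Formalization: Read in D' the sum need not be direct (e.g. L = D + 1, where some v in C_0 has L*{v} = phi_1), so elements of C_L are taken as functionals on M_L, with <L*{v}, f> = <L{f}, v>; on test functions they are the distributions L*{v} + sum a_n phi_n. *)

theory Defs
  imports "HOL-Analysis.Analysis" "HOL-Library.Function_Algebras"
    "HOL-Computational_Algebra.Polynomial"
begin

section \<open>Normed subspaces and their duals\<close>

instantiation "fun" :: (type, real_vector) real_vector
begin
definition scaleR_fun :: "real \<Rightarrow> ('a \<Rightarrow> 'b) \<Rightarrow> 'a \<Rightarrow> 'b" where
  "scaleR_fun c f = (\<lambda>x. c *\<^sub>R f x)"
instance
  by standard (auto simp: scaleR_fun_def fun_eq_iff scaleR_add_right scaleR_add_left)
end

definition linear_map_on :: "'a::real_vector set \<Rightarrow> ('a \<Rightarrow> 'b::real_vector) \<Rightarrow> bool" where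
  "linear_map_on V u \<longleftrightarrow>
     (\<forall>x\<in>V. \<forall>y\<in>V. u (x + y) = u x + u y) \<and> (\<forall>c. \<forall>x\<in>V. u (c *\<^sub>R x) = c *\<^sub>R u x)"

definition norm_on :: "'a::real_vector set \<Rightarrow> ('a \<Rightarrow> real) \<Rightarrow> bool" where
  "norm_on V nrm \<longleftrightarrow>
     (\<forall>x\<in>V. 0 \<le> nrm x) \<and> (\<forall>x\<in>V. nrm x = 0 \<longleftrightarrow> x = 0) \<and>
     (\<forall>c. \<forall>x\<in>V. nrm (c *\<^sub>R x) = \<bar>c\<bar> * nrm x) \<and>
     (\<forall>x\<in>V. \<forall>y\<in>V. nrm (x + y) \<le> nrm x + nrm y)"

definition banach_on :: "'a::real_vector set \<Rightarrow> ('a \<Rightarrow> real) \<Rightarrow> bool" where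
  "banach_on V nrm \<longleftrightarrow> subspace V \<and> norm_on V nrm \<and>
     (\<forall>s :: nat \<Rightarrow> 'a. (\<forall>k. s k \<in> V) \<longrightarrow>
        (\<forall>e>0. \<exists>K. \<forall>k\<ge>K. \<forall>l\<ge>K. nrm (s k - s l) < e) \<longrightarrow>
        (\<exists>x\<in>V. (\<lambda>k. nrm (s k - x)) \<longlonglongrightarrow> 0))"

definition equivalent_norms_on :: "'a set \<Rightarrow> ('a \<Rightarrow> real) \<Rightarrow> ('a \<Rightarrow> real) \<Rightarrow> bool" where
  "equivalent_norms_on V n1 n2 \<longleftrightarrow>
     (\<exists>c>0. \<exists>C>0. \<forall>x\<in>V. c * n1 x \<le> n2 x \<and> n2 x \<le> C * n1 x)"

text \<open>Functionals on \<open>V\<close> are total functions; they are normalised to vanish outside \<open>V\<close>,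
  so that equality of functions is equality on \<open>V\<close>.\<close>

definition topological_dual :: "'a::real_vector set \<Rightarrow> ('a \<Rightarrow> real) \<Rightarrow> ('a \<Rightarrow> real) set" where
  "topological_dual V nrm =
     {u. (\<forall>x. x \<notin> V \<longrightarrow> u x = 0) \<and> linear_map_on V u \<and> (\<exists>C. \<forall>x\<in>V. \<bar>u x\<bar> \<le> C * nrm x)}"

definition dual_norm_on :: "'a set \<Rightarrow> ('a \<Rightarrow> real) \<Rightarrow> ('a \<Rightarrow> real) \<Rightarrow> real" where
  "dual_norm_on V nrm u = (SUP x\<in>{x\<in>V. nrm x \<le> 1}. \<bar>u x\<bar>)"

definition is_direct_sum :: "'a::real_vector set \<Rightarrow> 'a set \<Rightarrow> 'a set \<Rightarrow> bool" where
  "is_direct_sum W U V \<longleftrightarrow>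
     subspace U \<and> subspace V \<and> U \<inter> V = {0} \<and> W = {u + v | u v. u \<in> U \<and> v \<in> V}"

text \<open>\<open>C\<close> is a space of functionals on \<open>M\<close>; the elements of \<open>M\<close> act on \<open>C\<close> by evaluation.\<close>

definition is_predual ::
  "('a::real_vector \<Rightarrow> real) set \<Rightarrow> (('a \<Rightarrow> real) \<Rightarrow> real) \<Rightarrow> 'a set \<Rightarrow> ('a \<Rightarrow> real) \<Rightarrow> bool" where
  "is_predual C nC M nM \<longleftrightarrow>
     (let J = (\<lambda>f g. if g \<in> C then g f else 0) in
       subspace M \<and> linear_map_on M J \<and> bij_betw J M (topological_dual C nC) \<and>
       (\<forall>f\<in>M. dual_norm_on C nC (J f) = nM f))"

subsection \<open>Coordinate norms\<close>

definition monotone_norm :: "(real ^ 'd \<Rightarrow> real) \<Rightarrow> bool" where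
  "monotone_norm Z \<longleftrightarrow> (\<forall>w v. (\<forall>d. \<bar>w $ d\<bar> \<le> \<bar>v $ d\<bar>) \<longrightarrow> Z w \<le> Z v)"

definition dual_norm :: "(real ^ 'd \<Rightarrow> real) \<Rightarrow> real ^ 'd \<Rightarrow> real" where
  "dual_norm Z w = (SUP v\<in>{v. Z v \<le> 1}. w \<bullet> v)"

text \<open>The space of \<open>N\<close>-tuples, with \<open>N = 0\<close> allowed; this is the carrier of the library's
  \<open>Euclidean_space N\<close>.\<close>

definition coord_space :: "nat \<Rightarrow> (nat \<Rightarrow> real) set" where
  "coord_space N = {a. \<forall>n\<ge>N. a n = 0}"

definition coord_dual_norm :: "nat \<Rightarrow> ((nat \<Rightarrow> real) \<Rightarrow> real) \<Rightarrow> (nat \<Rightarrow> real) \<Rightarrow> real" where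
  "coord_dual_norm N Y b = (SUP a\<in>{a \<in> coord_space N. Y a \<le> 1}. \<Sum>n<N. b n * a n)"


section \<open>Test functions\<close>

definition smooth :: "(real \<Rightarrow> real) \<Rightarrow> bool" where
  "smooth f \<longleftrightarrow> (\<forall>n x. (deriv ^^ n) f field_differentiable at x)"

definition supp :: "(real \<Rightarrow> real) \<Rightarrow> real set" where
  "supp f = closure {x. f x \<noteq> 0}"

lemma higher_deriv_add:
  assumes "smooth f" "smooth g"
  shows "(deriv ^^ n) (\<lambda>x. f x + g x) = (\<lambda>x. (deriv ^^ n) f x + (deriv ^^ n) g x)"
  using assms by (induction n) (auto simp: smooth_def)

lemma higher_deriv_scale:
  assumes "smooth f"
  shows "(deriv ^^ n) (\<lambda>x. c * f x) = (\<lambda>x. c * (deriv ^^ n) f x)"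
  using assms by (induction n) (auto simp: smooth_def)

lemma smooth_zero: "smooth (\<lambda>x. 0)"
proof -
  have "(deriv ^^ n) (\<lambda>x::real. 0::real) = (\<lambda>x. 0)" for n
    by (induction n) auto
  then show ?thesis by (simp add: smooth_def)
qed

lemma smooth_add: "smooth f \<Longrightarrow> smooth g \<Longrightarrow> smooth (\<lambda>x. f x + g x)"
  unfolding smooth_def[of "\<lambda>x. f x + g x"]
  by (auto simp: higher_deriv_add smooth_def intro!: derivative_intros)

lemma smooth_scale: "smooth f \<Longrightarrow> smooth (\<lambda>x. c * f x)"
  unfolding smooth_def[of "\<lambda>x. c * f x"]
  by (auto simp: higher_deriv_scale smooth_def intro!: derivative_intros)

lemma smooth_deriv: "smooth f \<Longrightarrow> smooth (deriv f)"
  unfolding smooth_def by (metis comp_apply funpow_Suc_right)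

lemma compact_supp_subset:
  assumes "compact (supp f)" "\<And>x. g x \<noteq> 0 \<Longrightarrow> x \<in> supp f"
  shows "compact (supp g)" "supp g \<subseteq> supp f"
proof -
  show *: "supp g \<subseteq> supp f"
    unfolding supp_def[of g] by (rule closure_minimal) (use assms in \<open>auto simp: supp_def\<close>)
  show "compact (supp g)"
    using * assms(1) by (metis closed_closure compact_Int_closed inf.absorb_iff2 supp_def)
qed

lemma supp_add: "supp (\<lambda>x. f x + g x) \<subseteq> supp f \<union> supp g"
proof -
  have "{x. f x + g x \<noteq> 0} \<subseteq> {x. f x \<noteq> 0} \<union> {x. g x \<noteq> 0}" by auto
  then show ?thesis unfolding supp_def by (metis closure_Un closure_mono)
qed

lemma supp_scale: "supp (\<lambda>x. c * f x) \<subseteq> supp f"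
  unfolding supp_def by (rule closure_mono) auto

lemma supp_deriv: "supp (deriv f) \<subseteq> supp f"
proof -
  have "deriv f x = 0" if "x \<notin> supp f" for x
  proof -
    have "open (- supp f)" "x \<in> - supp f" using that by (auto simp: supp_def)
    moreover have "f y = 0" if "y \<in> - supp f" for y
      using that closure_subset[of "{x. f x \<noteq> 0}"] by (auto simp: supp_def)
    ultimately have "\<forall>\<^sub>F y in nhds x. f y = (\<lambda>_. 0) y"
      by (auto simp: eventually_nhds)
    then have "deriv f x = deriv (\<lambda>_. 0) x" by (rule deriv_cong_ev) simp
    then show ?thesis by simp
  qed
  then show ?thesis
    unfolding supp_def[of "deriv f"] by (intro closure_minimal) (auto simp: supp_def)
qed

lemma compact_supp_mono: "compact K \<Longrightarrow> supp f \<subseteq> K \<Longrightarrow> compact (supp f)"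
  by (metis closed_closure compact_Int_closed inf.absorb_iff2 supp_def)

typedef test_fun = "{f. smooth f \<and> compact (supp f)}"
  morphisms test_apply Abs_test_fun
  by (rule exI[of _ "\<lambda>_. 0"]) (auto simp: smooth_zero supp_def)

setup_lifting type_definition_test_fun

instantiation test_fun :: real_vector
begin
lift_definition zero_test_fun :: test_fun is "\<lambda>_. 0"
  by (auto simp: smooth_zero supp_def)
lift_definition plus_test_fun :: "test_fun \<Rightarrow> test_fun \<Rightarrow> test_fun" is "\<lambda>f g x. f x + g x"
  by (auto intro: smooth_add compact_supp_mono[OF _ supp_add])
lift_definition scaleR_test_fun :: "real \<Rightarrow> test_fun \<Rightarrow> test_fun" is "\<lambda>c f x. c * f x"
  by (auto intro: smooth_scale compact_supp_mono[OF _ supp_scale])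
definition uminus_test_fun :: "test_fun \<Rightarrow> test_fun" where "- f = (-1) *\<^sub>R f" for f :: test_fun
definition minus_test_fun :: "test_fun \<Rightarrow> test_fun \<Rightarrow> test_fun" where
  "f - g = f + (-1) *\<^sub>R g" for f g :: test_fun
instance
  by standard (unfold uminus_test_fun_def minus_test_fun_def, (transfer; auto simp: algebra_simps)+)
end

lift_definition test_deriv :: "test_fun \<Rightarrow> test_fun" is deriv
  by (auto intro: smooth_deriv compact_supp_mono[OF _ supp_deriv])


section \<open>Distributions\<close>

text \<open>Linear functionals on test functions that obey, on every compact set, an estimate by
  finitely many derivatives; equivalently, those continuous for the usual LF topology.\<close>

definition dist_bounded :: "(test_fun \<Rightarrow> real) \<Rightarrow> bool" where
  "dist_bounded T \<longleftrightarrow> (\<forall>K. compact K \<longrightarrow> (\<exists>C m. \<forall>\<psi>. supp (test_apply \<psi>) \<subseteq> K \<longrightarrow>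
     \<bar>T \<psi>\<bar> \<le> C * (\<Sum>k\<le>m. SUP x. \<bar>(deriv ^^ k) (test_apply \<psi>) x\<bar>)))"

lemma bdd_above_deriv_test:
  "bdd_above (range (\<lambda>x. \<bar>(deriv ^^ k) (test_apply \<psi>) x\<bar>))"
proof -
  let ?f = "test_apply \<psi>" and ?g = "(deriv ^^ k) (test_apply \<psi>)"
  have f: "smooth ?f" "compact (supp ?f)" using test_apply[of \<psi>] by auto
  have "supp ?g \<subseteq> supp ?f"
    by (induction k) (use supp_deriv in auto)
  then have c: "compact (supp ?g)" using f(2) compact_supp_mono by blast
  have "continuous_on (supp ?g) ?g"
    using f(1) unfolding smooth_def
    by (intro continuous_at_imp_continuous_on ballI field_differentiable_imp_continuous_at) blast
  then have "bounded (?g ` supp ?g)"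
    using c compact_continuous_image compact_imp_bounded by blast
  then obtain B where B: "\<And>x. x \<in> supp ?g \<Longrightarrow> \<bar>?g x\<bar> \<le> B"
    by (auto simp: bounded_iff)
  have "\<bar>?g x\<bar> \<le> max B 0" for x
  proof (cases "x \<in> supp ?g")
    case False
    then have "?g x = 0" using closure_subset[of "{x. ?g x \<noteq> 0}"] by (auto simp: supp_def)
    then show ?thesis by simp
  qed (use B in fastforce)
  then show ?thesis by (auto simp: bdd_above_def)
qed

definition test_seminorm :: "nat \<Rightarrow> test_fun \<Rightarrow> real" where
  "test_seminorm m \<psi> = (\<Sum>k\<le>m. SUP x. \<bar>(deriv ^^ k) (test_apply \<psi>) x\<bar>)"

lemma SUP_deriv_nonneg: "0 \<le> (SUP x. \<bar>(deriv ^^ k) (test_apply \<psi>) x\<bar>)"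
  by (rule cSUP_upper2[OF bdd_above_deriv_test, of 0]) auto

lemma test_seminorm_nonneg: "0 \<le> test_seminorm m \<psi>"
  unfolding test_seminorm_def by (intro sum_nonneg SUP_deriv_nonneg)

lemma test_seminorm_mono: "m \<le> l \<Longrightarrow> test_seminorm m \<psi> \<le> test_seminorm l \<psi>"
  unfolding test_seminorm_def by (intro sum_mono2) (auto intro: SUP_deriv_nonneg)

lemma abs_le_test_seminorm: "\<bar>test_apply \<psi> x\<bar> \<le> test_seminorm 0 \<psi>"
  unfolding test_seminorm_def
  using cSUP_upper[OF UNIV_I bdd_above_deriv_test, of 0 \<psi> x] by simp

lemma dist_bounded_alt:
  "dist_bounded T \<longleftrightarrow> (\<forall>K. compact K \<longrightarrow> (\<exists>C m. \<forall>\<psi>. supp (test_apply \<psi>) \<subseteq> K \<longrightarrow>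
     \<bar>T \<psi>\<bar> \<le> C * test_seminorm m \<psi>))"
  unfolding dist_bounded_def test_seminorm_def ..

lemma dist_bounded_add:
  assumes "dist_bounded S" "dist_bounded T"
  shows "dist_bounded (\<lambda>\<psi>. S \<psi> + T \<psi>)"
  unfolding dist_bounded_alt
proof (intro allI impI)
  fix K :: "real set" assume K: "compact K"
  obtain C m where 1: "\<And>\<psi>. supp (test_apply \<psi>) \<subseteq> K \<Longrightarrow> \<bar>S \<psi>\<bar> \<le> C * test_seminorm m \<psi>"
    using assms(1) K unfolding dist_bounded_alt by blast
  obtain B l where 2: "\<And>\<psi>. supp (test_apply \<psi>) \<subseteq> K \<Longrightarrow> \<bar>T \<psi>\<bar> \<le> B * test_seminorm l \<psi>"
    using assms(2) K unfolding dist_bounded_alt by blast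
  have "\<bar>S \<psi> + T \<psi>\<bar> \<le> (\<bar>C\<bar> + \<bar>B\<bar>) * test_seminorm (max m l) \<psi>"
    if s: "supp (test_apply \<psi>) \<subseteq> K" for \<psi>
  proof -
    have "C * test_seminorm m \<psi> \<le> \<bar>C\<bar> * test_seminorm (max m l) \<psi>"
      by (intro mult_mono test_seminorm_mono) (auto simp: test_seminorm_nonneg)
    moreover have "B * test_seminorm l \<psi> \<le> \<bar>B\<bar> * test_seminorm (max m l) \<psi>"
      by (intro mult_mono test_seminorm_mono) (auto simp: test_seminorm_nonneg)
    ultimately show ?thesis using 1[OF s] 2[OF s] abs_triangle_ineq[of "S \<psi>" "T \<psi>"]
      unfolding distrib_right by linarith
  qed
  then show "\<exists>C m. \<forall>\<psi>. supp (test_apply \<psi>) \<subseteq> K \<longrightarrow>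
      \<bar>S \<psi> + T \<psi>\<bar> \<le> C * test_seminorm m \<psi>" by blast
qed

lemma dist_bounded_scale:
  assumes "dist_bounded T"
  shows "dist_bounded (\<lambda>\<psi>. c * T \<psi>)"
  unfolding dist_bounded_alt
proof (intro allI impI)
  fix K :: "real set" assume K: "compact K"
  obtain C m where 1: "\<And>\<psi>. supp (test_apply \<psi>) \<subseteq> K \<Longrightarrow> \<bar>T \<psi>\<bar> \<le> C * test_seminorm m \<psi>"
    using assms(1) K unfolding dist_bounded_alt by blast
  have "\<forall>\<psi>. supp (test_apply \<psi>) \<subseteq> K \<longrightarrow> \<bar>c * T \<psi>\<bar> \<le> (\<bar>c\<bar> * C) * test_seminorm m \<psi>"
    using 1 by (auto simp: abs_mult mult.assoc intro!: mult_left_mono)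
  then show "\<exists>C m. \<forall>\<psi>. supp (test_apply \<psi>) \<subseteq> K \<longrightarrow> \<bar>c * T \<psi>\<bar> \<le> C * test_seminorm m \<psi>"
    by blast
qed

lemma test_seminorm_deriv: "test_seminorm m (test_deriv \<psi>) \<le> test_seminorm (Suc m) \<psi>"
proof -
  have "(deriv ^^ k) (test_apply (test_deriv \<psi>)) = (deriv ^^ Suc k) (test_apply \<psi>)" for k
    by (simp add: test_deriv.rep_eq funpow_swap1)
  then have "test_seminorm m (test_deriv \<psi>) =
      (\<Sum>k\<le>m. SUP x. \<bar>(deriv ^^ Suc k) (test_apply \<psi>) x\<bar>)"
    by (simp add: test_seminorm_def)
  also have "\<dots> \<le> test_seminorm (Suc m) \<psi>"
    unfolding test_seminorm_def sum.atMost_Suc_shift[of _ m] using SUP_deriv_nonneg[of 0 \<psi>] by simp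
  finally show ?thesis .
qed

lemma dist_bounded_deriv:
  assumes "dist_bounded T"
  shows "dist_bounded (\<lambda>\<psi>. T (test_deriv \<psi>))"
  unfolding dist_bounded_alt
proof (intro allI impI)
  fix K :: "real set" assume K: "compact K"
  obtain C m where 1: "\<And>\<psi>. supp (test_apply \<psi>) \<subseteq> K \<Longrightarrow> \<bar>T \<psi>\<bar> \<le> C * test_seminorm m \<psi>"
    using assms(1) K unfolding dist_bounded_alt by blast
  have "\<bar>T (test_deriv \<psi>)\<bar> \<le> \<bar>C\<bar> * test_seminorm (Suc m) \<psi>"
    if "supp (test_apply \<psi>) \<subseteq> K" for \<psi>
  proof -
    have "supp (test_apply (test_deriv \<psi>)) \<subseteq> K"
      using that supp_deriv by (auto simp: test_deriv.rep_eq)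
    then have "\<bar>T (test_deriv \<psi>)\<bar> \<le> C * test_seminorm m (test_deriv \<psi>)" by (rule 1)
    also have "\<dots> \<le> \<bar>C\<bar> * test_seminorm (Suc m) \<psi>"
      by (intro mult_mono test_seminorm_deriv) (auto simp: test_seminorm_nonneg)
    finally show ?thesis .
  qed
  then show "\<exists>C m. \<forall>\<psi>. supp (test_apply \<psi>) \<subseteq> K \<longrightarrow>
      \<bar>T (test_deriv \<psi>)\<bar> \<le> C * test_seminorm m \<psi>" by blast
qed

lemma linear_test_deriv: "linear test_deriv"
proof
  show "test_deriv (f + g) = test_deriv f + test_deriv g" for f g
    by transfer (use higher_deriv_add[of _ _ 1] in \<open>auto simp: fun_eq_iff\<close>)
  show "test_deriv (c *\<^sub>R f) = c *\<^sub>R test_deriv f" for c f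
    by transfer (use higher_deriv_scale[of _ 1] in \<open>auto simp: fun_eq_iff\<close>)
qed

typedef distribution = "{T :: test_fun \<Rightarrow> real. linear T \<and> dist_bounded T}"
  morphisms dist_apply Abs_distribution
  by (rule exI[of _ "\<lambda>_. 0"])
     (auto simp: dist_bounded_alt linear_zero intro!: exI[of _ 0])

setup_lifting type_definition_distribution

instantiation distribution :: real_vector
begin
lift_definition zero_distribution :: distribution is "\<lambda>_. 0"
  by (auto simp: dist_bounded_alt linear_zero intro!: exI[of _ 0])
lift_definition plus_distribution :: "distribution \<Rightarrow> distribution \<Rightarrow> distribution"
  is "\<lambda>S T \<psi>. S \<psi> + T \<psi>"
  by (auto intro: linear_compose_add dist_bounded_add)
lift_definition scaleR_distribution :: "real \<Rightarrow> distribution \<Rightarrow> distribution"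
  is "\<lambda>c T \<psi>. c * T \<psi>"
  using linear_compose_scale_right by (fastforce intro: dist_bounded_scale)
definition uminus_distribution :: "distribution \<Rightarrow> distribution" where
  "- T = (-1) *\<^sub>R T" for T :: distribution
definition minus_distribution :: "distribution \<Rightarrow> distribution \<Rightarrow> distribution" where
  "S - T = S + (-1) *\<^sub>R T" for S T :: distribution
instance
  by standard
    (unfold uminus_distribution_def minus_distribution_def, (transfer; auto simp: algebra_simps)+)
end

lift_definition dist_deriv :: "distribution \<Rightarrow> distribution" is "\<lambda>T \<psi>. - T (test_deriv \<psi>)"
  using linear_compose[OF linear_test_deriv] linear_compose_neg
    dist_bounded_scale[OF dist_bounded_deriv, of _ "-1"]
  by (fastforce simp: o_def)

definition pairing :: "distribution ^ 'd \<Rightarrow> test_fun ^ 'd \<Rightarrow> real" where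
  "pairing f \<psi> = (\<Sum>d\<in>UNIV. dist_apply (f $ d) (\<psi> $ d))"

definition dist_of_fun :: "(real \<Rightarrow> real) \<Rightarrow> distribution" where
  "dist_of_fun v = Abs_distribution (\<lambda>\<psi>. LINT x|lborel. v x * test_apply \<psi> x)"

definition dist_of_vfun :: "(real \<Rightarrow> real ^ 'd) \<Rightarrow> distribution ^ 'd" where
  "dist_of_vfun v = (\<chi> d. dist_of_fun (\<lambda>x. v x $ d))"

definition dist_of_test :: "test_fun ^ 'd \<Rightarrow> distribution ^ 'd" where
  "dist_of_test \<psi> = (\<chi> d. dist_of_fun (test_apply (\<psi> $ d)))"

lemma continuous_test_apply: "continuous_on A (test_apply \<psi>)"
proof -
  have "test_apply \<psi> field_differentiable at x" for x
    using test_apply[of \<psi>] by (auto simp: smooth_def dest: spec[of _ 0])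
  then show ?thesis
    by (auto intro!: continuous_at_imp_continuous_on field_differentiable_imp_continuous_at)
qed

lemma dist_apply_dist_of_fun:
  assumes v: "continuous_on UNIV v"
  shows "dist_apply (dist_of_fun v) \<psi> = (LINT x|lborel. v x * test_apply \<psi> x)"
proof -
  have zero: "test_apply \<psi> x = 0" if "supp (test_apply \<psi>) \<subseteq> K" "x \<notin> K" for \<psi> x K
    using that closure_subset[of "{x. test_apply \<psi> x \<noteq> 0}"] by (auto simp: supp_def)
  have int_on: "integrable lborel (\<lambda>x. indicator K x *\<^sub>R (v x * test_apply \<psi> x))"
    if "compact K" for \<psi> K
    using that by (intro borel_integrable_compact continuous_intros
        continuous_on_subset[OF v] continuous_test_apply) auto
  have int: "integrable lborel (\<lambda>x. v x * test_apply \<psi> x)" for \<psi>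
  proof -
    have "indicator (supp (test_apply \<psi>)) x *\<^sub>R (v x * test_apply \<psi> x) = v x * test_apply \<psi> x" for x
      using zero[of \<psi> "supp (test_apply \<psi>)" x] by (auto simp: indicator_def)
    then have "(\<lambda>x. indicator (supp (test_apply \<psi>)) x *\<^sub>R (v x * test_apply \<psi> x)) =
        (\<lambda>x. v x * test_apply \<psi> x)" by (rule ext)
    then show ?thesis
      using int_on[of "supp (test_apply \<psi>)" \<psi>] test_apply[of \<psi>] by (metis mem_Collect_eq)
  qed
  have "linear (\<lambda>\<psi>. LINT x|lborel. v x * test_apply \<psi> x)"
  proof
    show "(LINT x|lborel. v x * test_apply (f + g) x) =
        (LINT x|lborel. v x * test_apply f x) + (LINT x|lborel. v x * test_apply g x)" for f g
      using int by (simp add: plus_test_fun.rep_eq distrib_left)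
    show "(LINT x|lborel. v x * test_apply (c *\<^sub>R f) x) =
        c *\<^sub>R (LINT x|lborel. v x * test_apply f x)" for c f
      by (simp add: scaleR_test_fun.rep_eq mult.left_commute)
  qed
  moreover have "dist_bounded (\<lambda>\<psi>. LINT x|lborel. v x * test_apply \<psi> x)"
    unfolding dist_bounded_alt
  proof (intro allI impI)
    fix K :: "real set" assume K: "compact K"
    have vK: "integrable lborel (\<lambda>x. indicator K x *\<^sub>R \<bar>v x\<bar>)"
      using K by (intro borel_integrable_compact continuous_intros continuous_on_subset[OF v]) auto
    let ?C = "LINT x|lborel. indicator K x *\<^sub>R \<bar>v x\<bar>"
    have "\<bar>LINT x|lborel. v x * test_apply \<psi> x\<bar> \<le> ?C * test_seminorm 0 \<psi>"
      if s: "supp (test_apply \<psi>) \<subseteq> K" for \<psi>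
    proof -
      have "\<bar>LINT x|lborel. v x * test_apply \<psi> x\<bar> \<le> (LINT x|lborel. \<bar>v x * test_apply \<psi> x\<bar>)"
        by (rule integral_abs_bound)
      also have "\<dots> \<le> (LINT x|lborel. (indicator K x *\<^sub>R \<bar>v x\<bar>) * test_seminorm 0 \<psi>)"
      proof (intro integral_mono integrable_abs int integrable_mult_left vK)
        fix x
        show "\<bar>v x * test_apply \<psi> x\<bar> \<le> (indicator K x *\<^sub>R \<bar>v x\<bar>) * test_seminorm 0 \<psi>"
          using zero[OF s, of x] abs_le_test_seminorm[of \<psi> x]
          by (cases "x \<in> K") (auto simp: abs_mult intro!: mult_left_mono)
      qed
      also have "\<dots> = ?C * test_seminorm 0 \<psi>" by simp
      finally show ?thesis .
    qed
    then show "\<exists>C m. \<forall>\<psi>. supp (test_apply \<psi>) \<subseteq> K \<longrightarrow>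
        \<bar>LINT x|lborel. v x * test_apply \<psi> x\<bar> \<le> C * test_seminorm m \<psi>" by blast
  qed
  ultimately show ?thesis
    unfolding dist_of_fun_def by (subst Abs_distribution_inverse) auto
qed


section \<open>Differential operators\<close>

text \<open>An ordinary differential operator is encoded by its polynomial in the derivative;
  composition of operators is multiplication of polynomials.\<close>

definition odo_apply :: "real poly \<Rightarrow> distribution \<Rightarrow> distribution" where
  "odo_apply p T = (\<Sum>n\<le>degree p. coeff p n *\<^sub>R (dist_deriv ^^ n) T)"

lemma linear_dist_deriv: "linear dist_deriv"
  by standard (transfer; auto)+

lemma odo_apply_pCons: "odo_apply (pCons a p) T = a *\<^sub>R T + odo_apply p (dist_deriv T)"
proof (cases "p = 0")
  case False
  then show ?thesis
    by (simp add: odo_apply_def sum.atMost_Suc_shift funpow_swap1 del: sum.atMost_Suc)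
qed (simp add: odo_apply_def)

lemma odo_apply_add: "odo_apply (p + q) T = odo_apply p T + odo_apply q T"
proof (induction p arbitrary: q T)
  case (pCons a p)
  then show ?case
    by (cases q) (simp add: odo_apply_pCons scaleR_add_left)
qed (simp add: odo_apply_def)

lemma odo_apply_smult: "odo_apply (smult c p) T = c *\<^sub>R odo_apply p T"
  by (cases "c = 0") (simp_all add: odo_apply_def scaleR_sum_right)

lemma odo_apply_deriv: "odo_apply p (dist_deriv T) = dist_deriv (odo_apply p T)"
proof (induction p arbitrary: T)
  case (pCons a p)
  then show ?case
    by (simp add: odo_apply_pCons linear_add[OF linear_dist_deriv] linear_scale[OF linear_dist_deriv])
qed (simp add: odo_apply_def linear_0[OF linear_dist_deriv])

lemma odo_apply_mult: "odo_apply (p * q) T = odo_apply p (odo_apply q T)"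
proof (induction p arbitrary: T)
  case (pCons a p)
  then show ?case
    by (simp add: odo_apply_pCons odo_apply_add odo_apply_smult odo_apply_deriv)
qed (simp add: odo_apply_def)

type_synonym 'd mdo = "real poly ^ 'd ^ 'd"

definition mdo_apply :: "'d::finite mdo \<Rightarrow> distribution ^ 'd \<Rightarrow> distribution ^ 'd" where
  "mdo_apply L f = (\<chi> r. \<Sum>d\<in>UNIV. odo_apply (L $ r $ d) (f $ d))"

definition odo_adj :: "real poly \<Rightarrow> real poly" where
  "odo_adj p = (\<Sum>n\<le>degree p. monom ((-1) ^ n * coeff p n) n)"

definition mdo_adj :: "'d::finite mdo \<Rightarrow> 'd::finite mdo" where
  "mdo_adj L = (\<chi> r c. odo_adj (L $ c $ r))"

lemma coeff_odo_adj: "coeff (odo_adj p) n = (-1) ^ n * coeff p n"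
  by (auto simp: odo_adj_def coeff_sum if_distrib coeff_eq_0 cong: if_cong)

lemma mdo_adj_adj: "mdo_adj (mdo_adj L) = L"
  by (simp add: mdo_adj_def vec_eq_iff poly_eq_iff coeff_odo_adj flip: mult.assoc power_mult_distrib)

definition null_space :: "'d::finite mdo \<Rightarrow> (distribution ^ 'd) set" where
  "null_space L = {q. mdo_apply L q = 0}"

definition admissible_system ::
  "'d::finite mdo \<Rightarrow> nat \<Rightarrow> (nat \<Rightarrow> distribution ^ 'd) \<Rightarrow> (nat \<Rightarrow> test_fun ^ 'd) \<Rightarrow> bool" where
  "admissible_system L N p \<phi> \<longleftrightarrow>
     inj_on p {..<N} \<and> independent (p ` {..<N}) \<and> span (p ` {..<N}) = null_space L \<and>
     (\<forall>n<N. \<forall>m<N. pairing (p n) (\<phi> m) = (if m = n then 1 else 0)) \<and>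
     (\<exists>R\<ge>0. \<forall>n<N. \<forall>d. supp (test_apply (\<phi> n $ d)) \<subseteq> {0..R})"


section \<open>Finite signed measures\<close>

text \<open>Every finite signed Borel measure on the line is Radon.\<close>

typedef signed_measure = "{\<mu> :: real set \<Rightarrow> real.
    (\<forall>E. E \<notin> sets borel \<longrightarrow> \<mu> E = 0) \<and> \<mu> {} = 0 \<and>
    (\<forall>E :: nat \<Rightarrow> real set. range E \<subseteq> sets borel \<longrightarrow> disjoint_family E \<longrightarrow>
       (\<lambda>i. \<mu> (E i)) sums \<mu> (\<Union>i. E i))}"
  morphisms smeasure Abs_signed_measure
  by (rule exI[of _ "\<lambda>_. 0"]) auto

definition finite_partitions :: "real set set set" where
  "finite_partitions = {\<pi>. finite \<pi> \<and> partition_on UNIV \<pi> \<and> \<pi> \<subseteq> sets borel}"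

definition tv_norm :: "signed_measure \<Rightarrow> real" where
  "tv_norm \<mu> = (SUP \<pi>\<in>finite_partitions. \<Sum>E\<in>\<pi>. \<bar>smeasure \<mu> E\<bar>)"

definition outer_norm :: "(real ^ 'd \<Rightarrow> real) \<Rightarrow> signed_measure ^ 'd \<Rightarrow> real" where
  "outer_norm Z \<mu> = Z (\<chi> d. tv_norm (\<mu> $ d))"

definition inner_norm :: "(real ^ 'd \<Rightarrow> real) \<Rightarrow> signed_measure ^ 'd \<Rightarrow> real" where
  "inner_norm Z \<mu> = (SUP \<pi>\<in>finite_partitions. \<Sum>E\<in>\<pi>. Z (\<chi> d. smeasure (\<mu> $ d) E))"

text \<open>Integration through the Jordan decomposition: \<open>upper_variation \<mu>\<close> and
  \<open>upper_variation (- \<mu>)\<close> are the positive and the negative part of \<open>\<mu>\<close>.\<close>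

definition upper_variation :: "(real set \<Rightarrow> real) \<Rightarrow> real measure" where
  "upper_variation \<mu> =
     measure_of UNIV (sets borel) (\<lambda>A. ennreal (SUP B\<in>{B \<in> sets borel. B \<subseteq> A}. \<mu> B))"

definition signed_integral :: "signed_measure \<Rightarrow> (real \<Rightarrow> real) \<Rightarrow> real" where
  "signed_integral \<mu> f =
     (LINT x|upper_variation (smeasure \<mu>). f x) -
     (LINT x|upper_variation (\<lambda>E. - smeasure \<mu> E). f x)"

lemma upper_variation_props:
  shows "sets (upper_variation \<mu>) = sets borel" "space (upper_variation \<mu>) = UNIV"
    "finite_measure (upper_variation \<mu>)"
proof -
  have sa: "sigma_algebra (UNIV :: real set) (sets borel)"
    using sets.sigma_algebra_axioms[of "borel :: real measure"] by simp
  show s: "sets (upper_variation \<mu>) = sets borel" "space (upper_variation \<mu>) = UNIV"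
    unfolding upper_variation_def
    by (simp_all add: sigma_algebra.sets_measure_of_eq[OF sa] space_measure_of_conv)
  have "emeasure (upper_variation \<mu>) UNIV \<noteq> \<infinity>"
    unfolding upper_variation_def emeasure_measure_of_conv by (auto split: if_splits)
  then show "finite_measure (upper_variation \<mu>)"
    by (intro finite_measureI) (simp add: s)
qed

lift_definition dist_of_measure :: "signed_measure \<Rightarrow> distribution"
  is "\<lambda>\<mu> \<psi>. signed_integral \<mu> (test_apply \<psi>)"
proof -
  fix \<mu> :: signed_measure
  have *: "linear (\<lambda>\<psi>. LINT x|M. test_apply \<psi> x) \<and>
      dist_bounded (\<lambda>\<psi>. LINT x|M. test_apply \<psi> x)"
    if M: "sets M = sets borel" "space M = UNIV" "finite_measure M" for M :: "real measure"
  proof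
    interpret finite_measure M by fact
    have int: "integrable M (test_apply \<psi>)" for \<psi>
    proof (rule integrable_const_bound[of _ "test_seminorm 0 \<psi>"])
      show "test_apply \<psi> \<in> borel_measurable M"
        unfolding measurable_cong_sets[OF M(1) refl]
        by (intro borel_measurable_continuous_onI continuous_test_apply)
    qed (simp add: abs_le_test_seminorm)
    show "linear (\<lambda>\<psi>. LINT x|M. test_apply \<psi> x)"
      by standard (use int in \<open>simp_all add: plus_test_fun.rep_eq scaleR_test_fun.rep_eq\<close>)
    have "\<bar>LINT x|M. test_apply \<psi> x\<bar> \<le> measure M UNIV * test_seminorm 0 \<psi>" for \<psi>
    proof -
      have "\<bar>LINT x|M. test_apply \<psi> x\<bar> \<le> (LINT x|M. \<bar>test_apply \<psi> x\<bar>)"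
        by (rule integral_abs_bound)
      also have "\<dots> \<le> (LINT x|M. test_seminorm 0 \<psi>)"
        by (intro integral_mono integrable_abs int) (auto simp: abs_le_test_seminorm)
      finally show ?thesis by (simp add: M(2))
    qed
    then show "dist_bounded (\<lambda>\<psi>. LINT x|M. test_apply \<psi> x)"
      unfolding dist_bounded_alt by blast
  qed
  let ?P = "\<lambda>\<psi>. LINT x|upper_variation (smeasure \<mu>). test_apply \<psi> x"
  let ?Q = "\<lambda>\<psi>. LINT x|upper_variation (\<lambda>E. - smeasure \<mu> E). test_apply \<psi> x"
  have P: "linear ?P" "dist_bounded ?P" and Q: "linear ?Q" "dist_bounded ?Q"
    using *[OF upper_variation_props] by auto
  have "linear (\<lambda>\<psi>. ?P \<psi> - ?Q \<psi>)" using P(1) Q(1) by (rule linear_compose_sub)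
  moreover have "dist_bounded (\<lambda>\<psi>. ?P \<psi> - ?Q \<psi>)"
    using dist_bounded_add[OF P(2) dist_bounded_scale[OF Q(2), of "-1"]] by simp
  ultimately show "linear (\<lambda>\<psi>. signed_integral \<mu> (test_apply \<psi>)) \<and>
      dist_bounded (\<lambda>\<psi>. signed_integral \<mu> (test_apply \<psi>))"
    unfolding signed_integral_def by simp
qed

definition dist_of_vmeasure :: "signed_measure ^ 'd \<Rightarrow> distribution ^ 'd" where
  "dist_of_vmeasure \<mu> = (\<chi> d. dist_of_measure (\<mu> $ d))"

text \<open>A finite measure is identified with the distribution it induces; for \<open>f\<close> in the native
  space, \<open>inv dist_of_vmeasure (mdo_apply L f)\<close> is \<open>mdo_apply L f\<close> read as a measure.\<close>

definition native_space :: "'d::finite mdo \<Rightarrow> (distribution ^ 'd) set" where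
  "native_space L = {f. mdo_apply L f \<in> range dist_of_vmeasure}"

definition native_norm ::
  "(signed_measure ^ 'd \<Rightarrow> real) \<Rightarrow> ((nat \<Rightarrow> real) \<Rightarrow> real) \<Rightarrow> 'd::finite mdo \<Rightarrow> (nat \<Rightarrow> test_fun ^ 'd) \<Rightarrow>
   distribution ^ 'd \<Rightarrow> real" where
  "native_norm nM nY L \<phi> f =
     nM (inv dist_of_vmeasure (mdo_apply L f)) + nY (\<lambda>n. pairing f (\<phi> n))"


section \<open>The predual\<close>

definition C0 :: "(real \<Rightarrow> real ^ 'd) set" where
  "C0 = {v. continuous_on UNIV v \<and> (v \<longlongrightarrow> 0) at_infinity}"

definition sup_of_norm :: "(real ^ 'd \<Rightarrow> real) \<Rightarrow> (real \<Rightarrow> real ^ 'd) \<Rightarrow> real" where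
  "sup_of_norm Z v = (SUP x. Z (v x))"

definition norm_of_sup :: "(real ^ 'd \<Rightarrow> real) \<Rightarrow> (real \<Rightarrow> real ^ 'd) \<Rightarrow> real" where
  "norm_of_sup Z v = Z (\<chi> d. SUP x. \<bar>v x $ d\<bar>)"

definition measure_pairing :: "signed_measure ^ 'd \<Rightarrow> (real \<Rightarrow> real ^ 'd) \<Rightarrow> real" where
  "measure_pairing \<mu> v = (\<Sum>d\<in>UNIV. signed_integral (\<mu> $ d) (\<lambda>x. v x $ d))"

text \<open>For an operator \<open>K\<close> and a \<open>C0\<close> function \<open>v\<close>, the generalised function \<open>K{v}\<close> is defined
  weakly, by moving \<open>K\<close> to the test object: \<open>\<langle>K{v}, f\<rangle> = \<langle>v, K\<^sup>\<star>{f}\<rangle>\<close>. The test objects are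
  all \<open>f\<close> for which the right-hand side makes sense, i.e. for which \<open>K\<^sup>\<star>{f}\<close> is a finite measure,
  and not only the test functions. For \<open>K = L\<^sup>\<star>\<close> they form the native space of \<open>L\<close>.

  This larger class matters. For \<open>L = D + 1\<close> and \<open>\<phi>\<close> with \<open>\<integral> e\<^sup>-\<^sup>y \<phi>(y) dy = 1\<close>, the \<open>C0\<close> function
  \<open>v(x) = \<integral>\<^sub>y\<^sub>>\<^sub>x e\<^sup>x\<^sup>-\<^sup>y \<phi>(y) dy\<close> satisfies \<open>L\<^sup>\<star>{v} = \<phi>\<close> when tested on test functions only, so that
  sums \<open>L\<^sup>\<star>{v} + a \<phi>\<close> taken among distributions do not determine \<open>v\<close> and \<open>a\<close>. The null space
  element \<open>e\<^sup>-\<^sup>x\<close> of \<open>L\<close> tells the two sides apart.\<close>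

definition weak_action :: "'d::finite mdo \<Rightarrow> (real \<Rightarrow> real ^ 'd) \<Rightarrow> distribution ^ 'd \<Rightarrow> real" where
  "weak_action K v = (\<lambda>f.
     if f \<in> native_space (mdo_adj K)
     then measure_pairing (inv dist_of_vmeasure (mdo_apply (mdo_adj K) f)) v else 0)"

definition test_action :: "'d::finite mdo \<Rightarrow> test_fun ^ 'd \<Rightarrow> distribution ^ 'd \<Rightarrow> real" where
  "test_action L \<psi> = (\<lambda>f. if f \<in> native_space L then pairing f \<psi> else 0)"

definition C_elem ::
  "'d::finite mdo \<Rightarrow> nat \<Rightarrow> (nat \<Rightarrow> test_fun ^ 'd) \<Rightarrow> (real \<Rightarrow> real ^ 'd) \<times> (nat \<Rightarrow> real) \<Rightarrow>
   distribution ^ 'd \<Rightarrow> real" where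
  "C_elem L N \<phi> = (\<lambda>(v, a). weak_action (mdo_adj L) v + (\<Sum>n<N. a n *\<^sub>R test_action L (\<phi> n)))"

definition C_space ::
  "'d::finite mdo \<Rightarrow> nat \<Rightarrow> (nat \<Rightarrow> test_fun ^ 'd) \<Rightarrow> (distribution ^ 'd \<Rightarrow> real) set" where
  "C_space L N \<phi> = C_elem L N \<phi> ` (C0 \<times> coord_space N)"

definition C_norm ::
  "((real \<Rightarrow> real ^ 'd) \<Rightarrow> real) \<Rightarrow> ((nat \<Rightarrow> real) \<Rightarrow> real) \<Rightarrow> 'd::finite mdo \<Rightarrow> nat \<Rightarrow> (nat \<Rightarrow> test_fun ^ 'd) \<Rightarrow>
   (distribution ^ 'd \<Rightarrow> real) \<Rightarrow> real" where
  "C_norm nC Y L N \<phi> g =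
     (let (v, a) = inv_into (C0 \<times> coord_space N) (C_elem L N \<phi>) g in max (nC v) (Y a))"

end

theory Submission
  imports Defs "HOL-Computational_Algebra.Fundamental_Theorem_Algebra"
begin

text \<open>
  An element \<open>f\<close> of the native space is determined by the measure \<open>\<mu> = L{f}\<close> and the numbers
  \<open>b\<^sub>n = \<langle>f, \<phi>\<^sub>n\<rangle>\<close>: if both vanish, then \<open>f\<close> is a combination of the \<open>p\<^sub>n\<close> whose coefficients are the
  \<open>b\<^sub>n\<close> (\<open>native_eq_0\<close>). Conversely every pair \<open>(\<mu>, b)\<close> occurs (\<open>native_element\<close>), because the
  system \<open>L{f} = \<mu>\<close> is solvable and a solution can be corrected in the null space. In these
  coordinates \<open>L\<^sup>\<star>{v} + (\<Sum>n. a\<^sub>n \<phi>\<^sub>n)\<close> acts as \<open>(\<mu>, b) \<mapsto> \<integral> v d\<mu> + (\<Sum>n. a\<^sub>n b\<^sub>n)\<close>. Dirac measures and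
  unit tuples then recover \<open>v\<close> and \<open>a\<close>, so that the predual is a copy of
  \<open>C0 \<times> \<real>\<^sup>N\<close> with the maximum of the two norms. The direct sum and completeness follow from this, and
  the dual is the product of the duals of the factors, with the sum of the dual norms.

  Three facts carry this argument.

  Solvability (\<open>mdo_apply_onto_measures\<close>). Multiplication by an adjugate matrix reduces the system
  to scalar equations \<open>det L{h} = \<mu>\<close>. A finite measure is the second derivative of a continuous
  function, its potential (\<open>second_deriv_potential\<close>), and differential operators commute, so it
  suffices to solve the equation for a continuous right-hand side. There the operator is factored
  into real linear and quadratic factors, for which variation of constants gives explicit solutions
  (\<open>solve_odo_continuous\<close>).

  The Riesz representation theorem for \<open>C0\<close> (\<open>riesz_representation\<close>). On the line it can be proved
  with distribution functions: the positive and the negative variation of a functional are given by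
  two increasing functions, these define Stieltjes measures, and the functional agrees with
  integration against their difference on trapezoids, hence everywhere.

  The two norm dualities. The inner norm of a measure is a supremum over step functions with values
  in the unit ball of \<open>Z\<close>, and \<open>step_function_approx_C0\<close> replaces step functions by \<open>C0\<close> functions
  with values in the same convex set. The outer norm is treated by the same lemma, one component at
  a time; the monotonicity of \<open>Z\<close> allows the optimal vector in the definition of the dual norm to
  be taken with nonnegative entries.\<close>

section \<open>Signed measures and their integrals\<close>

setup_lifting type_definition_signed_measure

instantiation signed_measure :: real_vector
begin
lift_definition zero_signed_measure :: signed_measure is "\<lambda>_. 0" by auto
lift_definition plus_signed_measure :: "signed_measure \<Rightarrow> signed_measure \<Rightarrow> signed_measure"
  is "\<lambda>\<mu> \<nu> E. \<mu> E + \<nu> E" by (auto intro: sums_add)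
lift_definition scaleR_signed_measure :: "real \<Rightarrow> signed_measure \<Rightarrow> signed_measure"
  is "\<lambda>c \<mu> E. c * \<mu> E" by (auto intro: sums_mult)
lift_definition uminus_signed_measure :: "signed_measure \<Rightarrow> signed_measure"
  is "\<lambda>\<mu> E. - \<mu> E" by (auto intro: sums_minus)
lift_definition minus_signed_measure :: "signed_measure \<Rightarrow> signed_measure \<Rightarrow> signed_measure"
  is "\<lambda>\<mu> \<nu> E. \<mu> E - \<nu> E" by (auto intro: sums_diff)
instance
  by standard (transfer; auto simp: algebra_simps)+
end

lemma smeasure_eqI: "(\<And>E. E \<in> sets borel \<Longrightarrow> smeasure \<mu> E = smeasure \<nu> E) \<Longrightarrow> \<mu> = \<nu>"
  by transfer (metis ext)

lemma smeasure_empty [simp]: "smeasure \<mu> {} = 0"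
  by transfer simp

lemma smeasure_sums:
  "range E \<subseteq> sets borel \<Longrightarrow> disjoint_family E \<Longrightarrow> (\<lambda>i. smeasure \<mu> (E i)) sums smeasure \<mu> (\<Union>i. E i)"
  by transfer simp

lemma smeasure_Un:
  assumes "A \<in> sets borel" "B \<in> sets borel" "A \<inter> B = {}"
  shows "smeasure \<mu> (A \<union> B) = smeasure \<mu> A + smeasure \<mu> B"
proof -
  have "(\<lambda>i. smeasure \<mu> (binaryset A B i)) sums smeasure \<mu> (\<Union>i. binaryset A B i)"
    using assms by (intro smeasure_sums) (auto simp: range_binaryset_eq disjoint_family_on_def binaryset_def)
  moreover have "(\<lambda>i. smeasure \<mu> (binaryset A B i)) sums (smeasure \<mu> A + smeasure \<mu> B)"
    by (rule binaryset_sums) simp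
  ultimately show ?thesis
    by (metis UN_binaryset_eq sums_unique2)
qed

lemma smeasure_Diff:
  assumes "A \<in> sets borel" "B \<in> sets borel" "B \<subseteq> A"
  shows "smeasure \<mu> (A - B) = smeasure \<mu> A - smeasure \<mu> B"
proof -
  have "smeasure \<mu> ((A - B) \<union> B) = smeasure \<mu> (A - B) + smeasure \<mu> B"
    using assms by (intro smeasure_Un) auto
  then show ?thesis using assms(3) by (simp add: Un_absorb2)
qed

text \<open>If the values of \<open>\<mu>\<close> on the subsets of some set were unbounded, one could split off again
  and again a piece of absolute value at least one while keeping an unbounded rest; these pieces
  are disjoint, which contradicts the convergence of the series in countable additivity.\<close>

lemma smeasure_bounded: "\<exists>C. \<forall>E. \<bar>smeasure \<mu> E\<bar> \<le> C"
proof (rule ccontr)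
  let ?m = "smeasure \<mu>"
  define unb where "unb A \<longleftrightarrow> A \<in> sets borel \<and> (\<forall>C. \<exists>E\<in>sets borel. E \<subseteq> A \<and> C < \<bar>?m E\<bar>)" for A
  assume "\<not> (\<exists>C. \<forall>E. \<bar>?m E\<bar> \<le> C)"
  then have ex: "\<exists>E. C < \<bar>?m E\<bar>" for C by (meson not_le)
  have bor: "E \<in> sets borel" if "?m E \<noteq> 0" for E
    using that by transfer auto
  have unbU: "unb UNIV"
    unfolding unb_def
  proof (intro conjI allI)
    fix C
    obtain E where "max C 0 < \<bar>?m E\<bar>" using ex by blast
    then show "\<exists>E\<in>sets borel. E \<subseteq> UNIV \<and> C < \<bar>?m E\<bar>"
      by (intro bexI[of _ E]) (auto intro: bor)
  qed simp
  have step: "\<exists>A'. unb A' \<and> A' \<subseteq> A \<and> 1 \<le> \<bar>?m (A - A')\<bar>" if A: "unb A" for A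
  proof -
    obtain B where B: "B \<in> sets borel" "B \<subseteq> A" "\<bar>?m A\<bar> + 1 < \<bar>?m B\<bar>"
      using A unfolding unb_def by blast
    have Ab: "A \<in> sets borel" using A by (simp add: unb_def)
    \<comment> \<open>By the choice of \<open>B\<close> both \<open>B\<close> and \<open>A - B\<close> have absolute value at least one, so it does not
      matter which of the two is unbounded and kept.\<close>
    have d: "?m (A - B) = ?m A - ?m B" by (rule smeasure_Diff) (use B Ab in auto)
    have "A - (A - B) = B" using B by auto
    have "unb B \<or> unb (A - B)"
    proof (rule ccontr)
      assume "\<not> (unb B \<or> unb (A - B))"
      then obtain C1 C2 where C: "\<And>E. E \<in> sets borel \<Longrightarrow> E \<subseteq> B \<Longrightarrow> \<bar>?m E\<bar> \<le> C1"
        "\<And>E. E \<in> sets borel \<Longrightarrow> E \<subseteq> A - B \<Longrightarrow> \<bar>?m E\<bar> \<le> C2"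
        using B Ab unfolding unb_def by (metis not_le sets.Diff)
      obtain E where E: "E \<in> sets borel" "E \<subseteq> A" "C1 + C2 < \<bar>?m E\<bar>"
        using A unfolding unb_def by blast
      have "?m ((E \<inter> B) \<union> (E - B)) = ?m (E \<inter> B) + ?m (E - B)"
        using E B by (intro smeasure_Un) auto
      moreover have "(E \<inter> B) \<union> (E - B) = E" by auto
      ultimately have "?m E = ?m (E \<inter> B) + ?m (E - B)" by simp
      moreover have "\<bar>?m (E \<inter> B)\<bar> \<le> C1" using E B by (intro C) auto
      moreover have "\<bar>?m (E - B)\<bar> \<le> C2" using E B by (intro C) auto
      ultimately show False using E(3) by linarith
    qed
    then show ?thesis
    proof
      assume "unb B"
      then show ?thesis using B(2,3) d by (intro exI[of _ B]) auto
    next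
      assume "unb (A - B)"
      then show ?thesis using B(3) d \<open>A - (A - B) = B\<close> by (intro exI[of _ "A - B"]) auto
    qed
  qed
  obtain S where S: "\<And>n. unb (S n)" "\<And>n. S (Suc n) \<subseteq> S n \<and> 1 \<le> \<bar>?m (S n - S (Suc n))\<bar>"
    using dependent_nat_choice[of "\<lambda>_ A. unb A" "\<lambda>_ A A'. A' \<subseteq> A \<and> 1 \<le> \<bar>?m (A - A')\<bar>"]
      unbU step by metis
  have dec: "decseq S" using S(2) by (intro decseq_SucI) auto
  have "disjoint_family (\<lambda>n. S n - S (Suc n))"
    unfolding disjoint_family_on_def
  proof (intro ballI impI)
    fix m n :: nat assume "m \<noteq> n"
    then consider "Suc m \<le> n" | "Suc n \<le> m" by linarith
    then show "(S m - S (Suc m)) \<inter> (S n - S (Suc n)) = {}"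
      by cases (use decseqD[OF dec] in blast)+
  qed
  moreover have "range (\<lambda>n. S n - S (Suc n)) \<subseteq> sets borel"
    using S(1) by (auto simp: unb_def)
  ultimately have "summable (\<lambda>n. ?m (S n - S (Suc n)))"
    using smeasure_sums by (blast intro: sums_summable)
  then have "(\<lambda>n. ?m (S n - S (Suc n))) \<longlonglongrightarrow> 0" by (rule summable_LIMSEQ_zero)
  then have "\<forall>\<^sub>F n in sequentially. \<bar>?m (S n - S (Suc n))\<bar> < 1"
    by (auto dest!: tendstoD[where e=1])
  then show False using S(2) by (auto simp: eventually_sequentially not_less[symmetric])
qed

abbreviation pos_part :: "signed_measure \<Rightarrow> real measure" where
  "pos_part \<mu> \<equiv> upper_variation (smeasure \<mu>)"

abbreviation neg_part :: "signed_measure \<Rightarrow> real measure" where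
  "neg_part \<mu> \<equiv> upper_variation (\<lambda>E. - smeasure \<mu> E)"

lemma neg_part_eq: "neg_part \<mu> = pos_part (- \<mu>)"
  by (simp add: uminus_signed_measure.rep_eq)

text \<open>The supremum is superadditive on disjoint sets, since subsets of the pieces can be united, and it is
countably subadditive, since a subset \<open>B\<close> of \<open>\<Union>i. E i\<close> splits into the sets \<open>B \<inter> E i\<close>. So the set
function from which the measure is built is countably additive and is its value.\<close>

lemma measure_pos_part:
  assumes A: "A \<in> sets borel"
  shows "measure (pos_part \<mu>) A = (SUP B\<in>{B \<in> sets borel. B \<subseteq> A}. smeasure \<mu> B)"
proof -
  define s where "s A = (SUP B\<in>{B \<in> sets borel. B \<subseteq> A}. smeasure \<mu> B)" for A
  obtain C where C: "\<And>E. \<bar>smeasure \<mu> E\<bar> \<le> C" using smeasure_bounded by blast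
  have bdd: "bdd_above (smeasure \<mu> ` X)" for X
    using C by (meson abs_le_D1 bdd_aboveI2)
  have upper: "smeasure \<mu> B \<le> s A" if "B \<in> sets borel" "B \<subseteq> A" for A B
    unfolding s_def by (rule cSUP_upper[OF _ bdd]) (use that in auto)
  have least: "s A \<le> c" if "\<And>B. B \<in> sets borel \<Longrightarrow> B \<subseteq> A \<Longrightarrow> smeasure \<mu> B \<le> c" for A c
    unfolding s_def by (rule cSUP_least) (use that in auto)
  have s0: "0 \<le> s A" for A
    using upper[of "{}" A] by simp
  have sempty: "s {} = 0"
    using s0[of "{}"] least[of "{}" 0] by force
  have mono: "s A \<le> s B" if "A \<subseteq> B" for A B
    by (rule least) (use that in \<open>auto intro!: upper\<close>)
  have super: "s A + s B \<le> s (A \<union> B)" if "A \<inter> B = {}" for A B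
  proof -
    have "s A \<le> s (A \<union> B) - s B"
    proof (rule least)
      fix A' assume A': "A' \<in> sets borel" "A' \<subseteq> A"
      have "s B \<le> s (A \<union> B) - smeasure \<mu> A'"
      proof (rule least)
        fix B' assume B': "B' \<in> sets borel" "B' \<subseteq> B"
        have "smeasure \<mu> (A' \<union> B') \<le> s (A \<union> B)" using A' B' by (intro upper) auto
        moreover have "smeasure \<mu> (A' \<union> B') = smeasure \<mu> A' + smeasure \<mu> B'"
          using A' B' that by (intro smeasure_Un) auto
        ultimately show "smeasure \<mu> B' \<le> s (A \<union> B) - smeasure \<mu> A'" by simp
      qed
      then show "smeasure \<mu> A' \<le> s (A \<union> B) - s B" by simp
    qed
    then show ?thesis by simp
  qed
  have "emeasure (pos_part \<mu>) A = ennreal (s A)"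
    unfolding upper_variation_def s_def[symmetric]
  proof (rule emeasure_measure_of_sigma[OF _ _ _ A])
    show "sigma_algebra (UNIV :: real set) (sets borel)"
      using sets.sigma_algebra_axioms[of "borel :: real measure"] by simp
    show "positive (sets borel) (\<lambda>A. ennreal (s A))"
      by (simp add: positive_def sempty)
    show "countably_additive (sets borel) (\<lambda>A. ennreal (s A))"
      unfolding countably_additive_def
    proof (intro allI impI)
      fix E :: "nat \<Rightarrow> real set"
      assume E: "range E \<subseteq> sets borel" "disjoint_family E"
      have fin: "(\<Sum>i<n. s (E i)) \<le> s (\<Union>i<n. E i)" for n
      proof (induction n)
        case (Suc n)
        have "E i \<inter> E n = {}" if "i < n" for i
          using disjoint_family_onD[OF E(2), of i n] that by simp
        then have "(\<Union>i<n. E i) \<inter> E n = {}" by auto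
        from super[OF this] Suc show ?case
          by (simp add: lessThan_Suc Un_commute)
      qed (simp add: sempty)
      have le: "(\<Sum>i<n. s (E i)) \<le> s (\<Union>i. E i)" for n
        using fin[of n] mono[of "\<Union>i<n. E i" "\<Union>i. E i"] by force
      have summ: "summable (\<lambda>i. s (E i))"
        by (rule summableI_nonneg_bounded[OF s0 le])
      have "s (\<Union>i. E i) \<le> (\<Sum>i. s (E i))"
      proof (rule least)
        fix B assume B: "B \<in> sets borel" "B \<subseteq> (\<Union>i. E i)"
        have "(\<lambda>i. smeasure \<mu> (B \<inter> E i)) sums smeasure \<mu> (\<Union>i. B \<inter> E i)"
          using E B by (intro smeasure_sums) (auto simp: disjoint_family_on_def)
        moreover have "(\<Union>i. B \<inter> E i) = B" using B by auto
        ultimately have *: "(\<lambda>i. smeasure \<mu> (B \<inter> E i)) sums smeasure \<mu> B" by simp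
        show "smeasure \<mu> B \<le> (\<Sum>i. s (E i))"
          by (rule sums_le[OF _ * summable_sums[OF summ]]) (use B E in \<open>auto intro!: upper\<close>)
      qed
      moreover have "(\<Sum>i. s (E i)) \<le> s (\<Union>i. E i)"
        by (rule suminf_le_const[OF summ le])
      ultimately have "(\<lambda>i. s (E i)) sums s (\<Union>i. E i)"
        using summ by (metis order_antisym summable_sums)
      then show "(\<Sum>i. ennreal (s (E i))) = ennreal (s (\<Union>i. E i))"
        by (rule suminf_ennreal_eq[OF s0])
    qed
  qed
  then have "measure (pos_part \<mu>) A = s A" using s0 by (simp add: measure_def)
  then show ?thesis by (simp add: s_def)
qed

text \<open>The map \<open>B \<mapsto> A - B\<close> exchanges the subsets of \<open>A\<close>, and \<open>\<mu> B - \<mu> A = (- \<mu>) (A - B)\<close>. Hence it carries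
the supremum that defines the positive part to the one that defines the negative part.\<close>

lemma smeasure_eq_pos_minus_neg:
  assumes A: "A \<in> sets borel"
  shows "smeasure \<mu> A = measure (pos_part \<mu>) A - measure (neg_part \<mu>) A"
proof -
  let ?S = "{B \<in> sets borel. B \<subseteq> A}"
  obtain C where C: "\<And>E. \<bar>smeasure \<mu> E\<bar> \<le> C" using smeasure_bounded by blast
  have C': "\<bar>smeasure (- \<mu>) E\<bar> \<le> C" for E using C by (simp add: uminus_signed_measure.rep_eq)
  have bdd: "bdd_above (smeasure \<mu> ` X)" "bdd_above (smeasure (- \<mu>) ` X)" for X
    using C C' by (meson abs_le_D1 bdd_aboveI2)+
  have S: "?S \<noteq> {}" by auto
  have diff: "A - B \<in> ?S" "smeasure \<mu> A = smeasure \<mu> B - smeasure (- \<mu>) (A - B)" if "B \<in> ?S" for B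
    using that A by (auto simp: uminus_signed_measure.rep_eq smeasure_Diff)
  have "(SUP B\<in>?S. smeasure \<mu> B) \<le> smeasure \<mu> A + (SUP B\<in>?S. smeasure (- \<mu>) B)"
    using diff by (intro cSUP_least S) (smt (verit) cSUP_upper bdd(2))
  moreover have "(SUP B\<in>?S. smeasure (- \<mu>) B) \<le> (SUP B\<in>?S. smeasure \<mu> B) - smeasure \<mu> A"
  proof (intro cSUP_least S)
    fix B assume B: "B \<in> ?S"
    have "smeasure \<mu> (A - B) \<le> (SUP B\<in>?S. smeasure \<mu> B)"
      by (rule cSUP_upper[OF diff(1)[OF B] bdd(1)])
    moreover have "smeasure \<mu> (A - B) = smeasure \<mu> A - smeasure \<mu> B"
      using A B by (intro smeasure_Diff) auto
    ultimately show "smeasure (- \<mu>) B \<le> (SUP B\<in>?S. smeasure \<mu> B) - smeasure \<mu> A"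
      by (simp add: uminus_signed_measure.rep_eq)
  qed
  ultimately show ?thesis
    using A by (simp add: measure_pos_part neg_part_eq)
qed

definition total_mass :: "signed_measure \<Rightarrow> real" where
  "total_mass \<mu> = measure (pos_part \<mu>) UNIV + measure (neg_part \<mu>) UNIV"

lemma total_mass_nonneg: "0 \<le> total_mass \<mu>"
  by (simp add: total_mass_def)

lemma finite_partition_of_fibres:
  assumes "finite (range h)" "\<And>s. h -` {s} \<in> sets borel"
  shows "(\<lambda>s. h -` {s}) ` range h \<in> finite_partitions"
  using assms unfolding finite_partitions_def partition_on_def
  by (auto simp: disjoint_def)

lemma fine_finite_partition:
  fixes f :: "real \<Rightarrow> 'a::euclidean_space"
  assumes f: "f \<in> borel_measurable borel" and b: "bounded (range f)" and e: "0 < e"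
  obtains \<pi> where "\<pi> \<in> finite_partitions" "\<And>E x y. E \<in> \<pi> \<Longrightarrow> x \<in> E \<Longrightarrow> y \<in> E \<Longrightarrow> norm (f x - f y) \<le> e"
proof -
  have "compact (closure (range f))" using b by (simp only: compact_closure)
  then have "\<forall>\<epsilon>>0. \<exists>k. finite k \<and> closure (range f) \<subseteq> (\<Union>x\<in>k. ball x \<epsilon>)"
    unfolding compact_eq_totally_bounded by (rule conjunct2)
  from this[rule_format, of "e / 2"]
  obtain C where C: "finite C" "closure (range f) \<subseteq> (\<Union>c\<in>C. ball c (e / 2))"
    using e by auto
  define h where "h x = {c \<in> C. f x \<in> ball c (e / 2)}" for x
  have "finite (range h)"
    by (rule finite_subset[of _ "Pow C"]) (auto simp: h_def C)
  moreover have "h -` {S} \<in> sets borel" for S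
  proof (cases "S \<subseteq> C")
    case True
    have "h -` {S} = {x \<in> space borel. \<forall>c\<in>C. (c \<in> S \<longleftrightarrow> f x \<in> ball c (e / 2))}"
    proof -
      have "{c \<in> C. Q c} = S \<longleftrightarrow> (\<forall>c\<in>C. c \<in> S \<longleftrightarrow> Q c)" for Q using True by blast
      from this[of "\<lambda>c. f _ \<in> ball c (e / 2)"] show ?thesis
        unfolding h_def vimage_def by simp
    qed
    also have "\<dots> \<in> sets borel"
    proof (intro sets.sets_Collect_finite_All C(1))
      fix c
      have *: "{x \<in> space borel. f x \<in> ball c (e / 2)} \<in> sets borel"
        using measurable_sets[OF f, of "ball c (e / 2)"] by (simp add: vimage_def)
      then show "{x \<in> space borel. c \<in> S \<longleftrightarrow> f x \<in> ball c (e / 2)} \<in> sets borel"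
        using * sets.sets_Collect_neg[OF *] by (cases "c \<in> S") simp_all
    qed
    finally show ?thesis .
  next
    case False
    then have "h -` {S} = {}" by (auto simp: h_def)
    then show ?thesis by (metis sets.empty_sets)
  qed
  ultimately have P: "(\<lambda>S. h -` {S}) ` range h \<in> finite_partitions"
    by (rule finite_partition_of_fibres)
  show thesis
  proof (rule that[OF P])
    fix E x y assume E: "E \<in> (\<lambda>S. h -` {S}) ` range h" "x \<in> E" "y \<in> E"
    then have "h x = h y" by auto
    moreover have "f x \<in> (\<Union>c\<in>C. ball c (e / 2))" using C(2) closure_subset[of "range f"] by blast
    then have "h x \<noteq> {}" by (auto simp: h_def)
    ultimately obtain c where "f x \<in> ball c (e / 2)" "f y \<in> ball c (e / 2)"
      by (auto simp: h_def)
    then show "norm (f x - f y) \<le> e"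
      using dist_triangle_half_r[of c "f x" e "f y"] by (auto simp: dist_norm)
  qed
qed

lemma finite_partitionsD:
  assumes "\<pi> \<in> finite_partitions"
  shows "finite \<pi>" "\<And>E. E \<in> \<pi> \<Longrightarrow> E \<in> sets borel" "\<Union>\<pi> = UNIV" "disjoint \<pi>" "\<And>E. E \<in> \<pi> \<Longrightarrow> E \<noteq> {}"
  using assms by (auto simp: finite_partitions_def partition_on_def)

lemma sum_indicator_partition:
  assumes "\<pi> \<in> finite_partitions" "E \<in> \<pi>" "x \<in> E"
  shows "(\<Sum>F\<in>\<pi>. indicator F x *\<^sub>R c F) = (c E :: 'a::real_vector)"
proof -
  have "(\<Sum>F\<in>\<pi>. indicator F x *\<^sub>R c F) = (\<Sum>F\<in>\<pi>. if F = E then c F else 0)"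
    using assms finite_partitionsD(4)[OF assms(1)]
    by (intro sum.cong) (auto simp: disjoint_def indicator_def)
  then show ?thesis using assms finite_partitionsD(1)[OF assms(1)] by simp
qed

text \<open>A bounded Borel function is uniformly close to a function that is constant on the sets of a finite
partition. The resulting finite sums involve only the values of the measure on sets; this is how
identities between values of measures become identities between their integrals.\<close>

lemma integral_near_partition_sum:
  fixes f :: "real \<Rightarrow> real"
  assumes M: "finite_measure M" "sets M = sets borel"
    and f: "f \<in> borel_measurable borel" "bounded (range f)"
    and \<pi>: "\<pi> \<in> finite_partitions" and near: "\<forall>E\<in>\<pi>. \<forall>x\<in>E. \<bar>f x - c E\<bar> \<le> e"
  shows "\<bar>(LINT x|M. f x) - (\<Sum>E\<in>\<pi>. c E * measure M E)\<bar> \<le> e * measure M UNIV"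
proof -
  interpret finite_measure M by fact
  have sp: "space M = UNIV" using M(2) sets_eq_imp_space_eq by fastforce
  obtain B where B: "\<And>x. \<bar>f x\<bar> \<le> B" using f(2) by (auto simp: bounded_iff)
  have fi: "integrable M f"
    by (rule integrable_const_bound[of _ B]) (use B f(1) M(2) in \<open>auto cong: measurable_cong_sets\<close>)
  let ?g = "\<lambda>x. \<Sum>E\<in>\<pi>. indicator E x * c E"
  have gi: "integrable M (\<lambda>x. indicator E x * c E)" if "E \<in> \<pi>" for E
    using finite_partitionsD(2)[OF \<pi> that] M(2)
    by (intro integrable_mult_left) (simp add: less_top[symmetric])
  have gint: "integral\<^sup>L M ?g = (\<Sum>E\<in>\<pi>. c E * measure M E)"
    using gi finite_partitionsD(2)[OF \<pi>] by (simp add: sp mult.commute)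
  have fg: "\<bar>f x - ?g x\<bar> \<le> e" for x
  proof -
    obtain E where "E \<in> \<pi>" "x \<in> E" using finite_partitionsD(3)[OF \<pi>] by blast
    then show ?thesis using sum_indicator_partition[OF \<pi>, of E x c] near by auto
  qed
  have "integrable M ?g" using gi by (rule Bochner_Integration.integrable_sum)
  then have i: "integrable M (\<lambda>x. f x - ?g x)" using fi by (rule Bochner_Integration.integrable_diff[rotated])
  have "\<bar>LINT x|M. f x - ?g x\<bar> \<le> (LINT x|M. e)"
    by (rule order_trans[OF integral_abs_bound])
       (intro integral_mono integrable_abs i, auto simp: fg)
  then show ?thesis
    using fi \<open>integrable M ?g\<close> gint by (simp add: sp mult.commute)
qed

lemma signed_integral_near_partition_sum:
  assumes f: "f \<in> borel_measurable borel" "bounded (range f)"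
    and \<pi>: "\<pi> \<in> finite_partitions" and near: "\<forall>E\<in>\<pi>. \<forall>x\<in>E. \<bar>f x - c E\<bar> \<le> e"
  shows "\<bar>signed_integral \<mu> f - (\<Sum>E\<in>\<pi>. c E * smeasure \<mu> E)\<bar> \<le> e * total_mass \<mu>"
proof -
  have "(\<Sum>E\<in>\<pi>. c E * smeasure \<mu> E) =
      (\<Sum>E\<in>\<pi>. c E * measure (pos_part \<mu>) E) - (\<Sum>E\<in>\<pi>. c E * measure (neg_part \<mu>) E)"
    using finite_partitionsD(2)[OF \<pi>]
    by (simp add: smeasure_eq_pos_minus_neg right_diff_distrib sum_subtractf)
  then show ?thesis
    using integral_near_partition_sum[OF upper_variation_props(3)[of "smeasure \<mu>"]
        upper_variation_props(1) f \<pi> near]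
      integral_near_partition_sum[OF upper_variation_props(3)[of "\<lambda>E. - smeasure \<mu> E"]
        upper_variation_props(1) f \<pi> near]
    unfolding signed_integral_def total_mass_def distrib_left by linarith
qed

lemma fine_value_partition:
  fixes f :: "real \<Rightarrow> 'a::euclidean_space"
  assumes "f \<in> borel_measurable borel" "bounded (range f)" "0 < e"
  obtains \<pi> c where "\<pi> \<in> finite_partitions" "\<forall>E\<in>\<pi>. \<forall>x\<in>E. norm (f x - c E) \<le> e"
    "\<And>E. E \<in> \<pi> \<Longrightarrow> c E \<in> range f"
proof -
  obtain \<pi> where \<pi>: "\<pi> \<in> finite_partitions"
      "\<And>E x y. E \<in> \<pi> \<Longrightarrow> x \<in> E \<Longrightarrow> y \<in> E \<Longrightarrow> norm (f x - f y) \<le> e"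
    using fine_finite_partition[OF assms] by blast
  have "norm (f x - f (SOME y. y \<in> E)) \<le> e" if "E \<in> \<pi>" "x \<in> E" for E x
    using \<pi>(2)[OF that, of "SOME y. y \<in> E"] that(2) someI[of "\<lambda>y. y \<in> E" x] by blast
  then show thesis using that[of \<pi> "\<lambda>E. f (SOME y. y \<in> E)"] \<pi>(1) by auto
qed

lemma eq_if_arbitrarily_close:
  fixes a b K :: real
  assumes "\<And>e. 0 < e \<Longrightarrow> \<bar>a - b\<bar> \<le> e * K"
  shows "a = b"
proof (rule ccontr)
  assume "a \<noteq> b"
  define C where "C = \<bar>K\<bar> + 1"
  have C: "0 < C" "K \<le> C" by (auto simp: C_def)
  have "\<bar>a - b\<bar> \<le> (\<bar>a - b\<bar> / (2 * C)) * K" using \<open>a \<noteq> b\<close> C by (intro assms) auto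
  also have "\<dots> \<le> (\<bar>a - b\<bar> / (2 * C)) * C" using C by (intro mult_left_mono) auto
  also have "\<dots> = \<bar>a - b\<bar> / 2" using C by simp
  finally show False using \<open>a \<noteq> b\<close> by simp
qed

lemma signed_integral_add:
  assumes f: "f \<in> borel_measurable borel" "bounded (range f)"
  shows "signed_integral (\<mu> + \<nu>) f = signed_integral \<mu> f + signed_integral \<nu> f"
proof (rule eq_if_arbitrarily_close)
  fix e :: real assume "0 < e"
  then obtain \<pi> c where \<pi>: "\<pi> \<in> finite_partitions" "\<forall>E\<in>\<pi>. \<forall>x\<in>E. \<bar>f x - c E\<bar> \<le> e"
    using fine_value_partition[OF f] by (metis real_norm_def)
  note * = signed_integral_near_partition_sum[OF f \<pi>]
  show "\<bar>signed_integral (\<mu> + \<nu>) f - (signed_integral \<mu> f + signed_integral \<nu> f)\<bar>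
      \<le> e * (total_mass (\<mu> + \<nu>) + total_mass \<mu> + total_mass \<nu>)"
    using *[of "\<mu> + \<nu>"] *[of \<mu>] *[of \<nu>]
    by (simp add: plus_signed_measure.rep_eq distrib_left sum.distrib)
qed

lemma signed_integral_scaleR:
  assumes f: "f \<in> borel_measurable borel" "bounded (range f)"
  shows "signed_integral (r *\<^sub>R \<mu>) f = r * signed_integral \<mu> f"
proof (rule eq_if_arbitrarily_close)
  fix e :: real assume "0 < e"
  then obtain \<pi> c where \<pi>: "\<pi> \<in> finite_partitions" "\<forall>E\<in>\<pi>. \<forall>x\<in>E. \<bar>f x - c E\<bar> \<le> e"
    using fine_value_partition[OF f] by (metis real_norm_def)
  note * = signed_integral_near_partition_sum[OF f \<pi>]
  have "\<bar>r\<bar> * \<bar>signed_integral \<mu> f - (\<Sum>E\<in>\<pi>. c E * smeasure \<mu> E)\<bar> \<le> \<bar>r\<bar> * (e * total_mass \<mu>)"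
    by (intro mult_left_mono *) auto
  then have "\<bar>r * signed_integral \<mu> f - (\<Sum>E\<in>\<pi>. c E * (r * smeasure \<mu> E))\<bar> \<le> \<bar>r\<bar> * (e * total_mass \<mu>)"
    by (simp add: abs_mult[symmetric] right_diff_distrib sum_distrib_left mult.left_commute)
  then show "\<bar>signed_integral (r *\<^sub>R \<mu>) f - r * signed_integral \<mu> f\<bar>
      \<le> e * (total_mass (r *\<^sub>R \<mu>) + \<bar>r\<bar> * total_mass \<mu>)"
    using *[of "r *\<^sub>R \<mu>"]
    by (simp add: scaleR_signed_measure.rep_eq distrib_left mult.left_commute)
qed

lemma integrable_bounded_borel:
  fixes f :: "real \<Rightarrow> real"
  assumes M: "finite_measure M" "sets M = sets borel"
    and f: "f \<in> borel_measurable borel" "bounded (range f)"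
  shows "integrable M f"
proof -
  interpret finite_measure M by fact
  obtain B where "\<And>x. \<bar>f x\<bar> \<le> B" using f(2) by (auto simp: bounded_iff)
  then show ?thesis
    by (intro integrable_const_bound[of _ B]) (use f(1) M(2) in \<open>auto cong: measurable_cong_sets\<close>)
qed

lemma signed_integral_integrand_add:
  assumes "f \<in> borel_measurable borel" "bounded (range f)" "g \<in> borel_measurable borel" "bounded (range g)"
  shows "signed_integral \<mu> (\<lambda>x. f x + g x) = signed_integral \<mu> f + signed_integral \<mu> g"
  using assms upper_variation_props(1,3)
  by (simp add: signed_integral_def integrable_bounded_borel)

lemma signed_integral_integrand_scale: "signed_integral \<mu> (\<lambda>x. r * f x) = r * signed_integral \<mu> f"
  by (simp add: signed_integral_def right_diff_distrib)

lemma signed_integral_abs_le: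
  assumes f: "f \<in> borel_measurable borel" and B: "\<And>x. \<bar>f x\<bar> \<le> B"
  shows "\<bar>signed_integral \<mu> f\<bar> \<le> B * total_mass \<mu>"
proof -
  have "{UNIV} \<in> finite_partitions"
    by (auto simp: finite_partitions_def partition_on_def)
  moreover have "bounded (range f)" using B by (auto simp: bounded_iff)
  ultimately show ?thesis
    using signed_integral_near_partition_sum[OF f, of "{UNIV}" "\<lambda>_. 0" B] B by simp
qed

text \<open>The signed measure \<open>M - N\<close> of two finite measures integrates as expected, although
  \<open>M\<close> and \<open>N\<close> need not be its minimal decomposition.\<close>

definition diff_measure :: "real measure \<Rightarrow> real measure \<Rightarrow> signed_measure" where
  "diff_measure M N = Abs_signed_measure (\<lambda>E. measure M E - measure N E)"

lemma
  assumes M: "finite_measure M" "sets M = sets borel" and N: "finite_measure N" "sets N = sets borel"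
  shows smeasure_diff_measure: "smeasure (diff_measure M N) E = measure M E - measure N E"
    and signed_integral_diff_measure: "f \<in> borel_measurable borel \<Longrightarrow> bounded (range f) \<Longrightarrow>
      signed_integral (diff_measure M N) f = (LINT x|M. f x) - (LINT x|N. f x)"
proof -
  interpret M: finite_measure M by fact
  interpret N: finite_measure N by fact
  have *: "smeasure (diff_measure M N) E = measure M E - measure N E" for E
    unfolding diff_measure_def
    by (subst Abs_signed_measure_inverse)
       (use M N in \<open>auto simp: measure_notin_sets intro!: sums_diff M.finite_measure_UNION N.finite_measure_UNION\<close>)
  then show "smeasure (diff_measure M N) E = measure M E - measure N E" .
  assume f: "f \<in> borel_measurable borel" "bounded (range f)"
  show "signed_integral (diff_measure M N) f = (LINT x|M. f x) - (LINT x|N. f x)"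
  proof (rule eq_if_arbitrarily_close)
    fix e :: real assume "0 < e"
    then obtain \<pi> c where \<pi>: "\<pi> \<in> finite_partitions" "\<forall>E\<in>\<pi>. \<forall>x\<in>E. \<bar>f x - c E\<bar> \<le> e"
      using fine_value_partition[OF f] by (metis real_norm_def)
    note s = signed_integral_near_partition_sum[OF f \<pi>]
    note i = integral_near_partition_sum[OF _ _ f \<pi>]
    show "\<bar>signed_integral (diff_measure M N) f - ((LINT x|M. f x) - (LINT x|N. f x))\<bar>
        \<le> e * (total_mass (diff_measure M N) + measure M UNIV + measure N UNIV)"
      using s[of "diff_measure M N"] i[OF M] i[OF N]
      by (simp add: * distrib_left right_diff_distrib sum_subtractf)
  qed
qed

section \<open>Smooth bump functions\<close>

text \<open>A coinduction principle: it avoids formulas for the higher derivatives of the functions below.\<close>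

lemma smooth_if_deriv_closed:
  assumes "\<And>f. f \<in> S \<Longrightarrow> (\<forall>x. f field_differentiable at x) \<and> deriv f \<in> S" and "f \<in> S"
  shows "smooth f"
proof -
  have "(deriv ^^ n) f \<in> S" for n
    using assms by (induction n) auto
  then show ?thesis using assms(1) by (auto simp: smooth_def)
qed

lemma smooth_differentiable: "smooth f \<Longrightarrow> f field_differentiable at x"
  by (auto simp: smooth_def dest: spec[of _ 0])

lemma smooth_DERIV: "smooth f \<Longrightarrow> (f has_real_derivative deriv f x) (at x)"
  by (simp add: DERIV_deriv_iff_field_differentiable smooth_differentiable)

text \<open>By the Leibniz rule, finite sums of products of smooth functions form a class that is closed under
differentiation, which single products do not.\<close>

inductive_set product_sums :: "(real \<Rightarrow> real) set" where
  prod: "smooth f \<Longrightarrow> smooth g \<Longrightarrow> (\<lambda>x. f x * g x) \<in> product_sums"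
| sum: "h \<in> product_sums \<Longrightarrow> k \<in> product_sums \<Longrightarrow> (\<lambda>x. h x + k x) \<in> product_sums"

lemma smooth_mult:
  assumes "smooth f" "smooth g"
  shows "smooth (\<lambda>x. f x * g x)"
proof (rule smooth_if_deriv_closed[of product_sums])
  fix h :: "real \<Rightarrow> real" assume "h \<in> product_sums"
  then show "(\<forall>x. h field_differentiable at x) \<and> deriv h \<in> product_sums"
  proof induction
    case (prod f g)
    have d: "((\<lambda>x. f x * g x) has_real_derivative (deriv f x * g x + deriv g x * f x)) (at x)" for x
      by (intro DERIV_mult smooth_DERIV prod)
    then have "deriv (\<lambda>x. f x * g x) = (\<lambda>x. deriv f x * g x + deriv g x * f x)"
      by (auto intro!: ext DERIV_imp_deriv)
    then show ?case
      using d prod by (auto simp: field_differentiable_def intro!: product_sums.intros smooth_deriv)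
  next
    case (sum h k)
    then have "deriv (\<lambda>x. h x + k x) = (\<lambda>x. deriv h x + deriv k x)"
      by (auto intro!: ext deriv_add)
    then show ?case
      using sum by (auto intro!: product_sums.intros field_differentiable_add)
  qed
qed (use assms in \<open>rule product_sums.prod\<close>)

lemma smooth_affine:
  assumes "smooth f"
  shows "smooth (\<lambda>x. f (a * x + b))"
proof (rule smooth_if_deriv_closed[of "{(\<lambda>x. c * g (a * x + b)) | c g. smooth g}"])
  fix h assume "h \<in> {(\<lambda>x. c * g (a * x + b)) | c g. smooth g}"
  then obtain c g where h: "h = (\<lambda>x. c * g (a * x + b))" and g: "smooth g" by blast
  have d: "(h has_real_derivative (c * a) * deriv g (a * x + b)) (at x)" for x
  proof -
    have "((\<lambda>x. a * x + b) has_real_derivative a) (at x)" by (auto intro!: derivative_eq_intros)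
    from DERIV_chain'[OF this smooth_DERIV[OF g]]
    show ?thesis unfolding h by (auto intro!: derivative_eq_intros)
  qed
  then have "deriv h = (\<lambda>x. (c * a) * deriv g (a * x + b))"
    by (auto intro!: ext DERIV_imp_deriv)
  then show "(\<forall>x. h field_differentiable at x) \<and> deriv h \<in> {(\<lambda>x. c * g (a * x + b)) | c g. smooth g}"
    using d smooth_deriv[OF g] by (auto simp: field_differentiable_def)
next
  have "(\<lambda>x. f (a * x + b)) = (\<lambda>x. 1 * f (a * x + b))" by simp
  then show "(\<lambda>x. f (a * x + b)) \<in> {(\<lambda>x. c * g (a * x + b)) | c g. smooth g}"
    using assms by blast
qed

text \<open>The function \<open>exp (- 1 / x)\<close>, extended by \<open>0\<close> to \<open>x \<le> 0\<close>, times a polynomial in \<open>1 / x\<close>; the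
polynomial factor makes the class closed under differentiation.\<close>

definition flat :: "real poly \<Rightarrow> real \<Rightarrow> real" where
  "flat q x = (if 0 < x then poly q (1 / x) * exp (- (1 / x)) else 0)"

lemma poly_times_exp_minus_tendsto_0:
  fixes q :: "real poly"
  shows "((\<lambda>t. poly q t * exp (- t)) \<longlongrightarrow> 0) at_top"
proof -
  have "((\<lambda>t. \<Sum>i\<le>degree q. coeff q i * (t ^ i / exp t)) \<longlongrightarrow> (\<Sum>i\<le>degree q. coeff q i * 0)) at_top"
    by (intro tendsto_intros tendsto_power_div_exp_0)
  moreover have "(\<lambda>t. poly q t * exp (- t)) = (\<lambda>t. \<Sum>i\<le>degree q. coeff q i * (t ^ i / exp t))"
    by (simp add: fun_eq_iff poly_altdef exp_minus sum_distrib_right divide_inverse mult.assoc)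
  ultimately show ?thesis by simp
qed

lemma DERIV_flat: "(flat q has_real_derivative flat ([:0, 0, 1:] * (q - pderiv q)) x) (at x)"
proof -
  consider "0 < x" | "x < 0" | "x = 0" by linarith
  then show ?thesis
  proof cases
    case 1
    have "((\<lambda>x. poly q (1 / x) * exp (- (1 / x))) has_real_derivative
        poly ([:0, 0, 1:] * (q - pderiv q)) (1 / x) * exp (- (1 / x))) (at x)"
    proof -
      have i: "((\<lambda>x. 1 / x) has_real_derivative (- (1 / x ^ 2))) (at x)"
        using 1 by (auto intro!: derivative_eq_intros simp: power2_eq_square)
      have p: "((\<lambda>x. poly q (1 / x)) has_real_derivative (- (1 / x ^ 2)) * poly (pderiv q) (1 / x)) (at x)"
        using DERIV_chain'[OF i poly_DERIV] by simp
      have e: "((\<lambda>x. exp (- (1 / x))) has_real_derivative exp (- (1 / x)) * (1 / x ^ 2)) (at x)"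
        using DERIV_chain'[OF DERIV_minus[OF i] DERIV_exp] by simp
      show ?thesis
        by (rule DERIV_cong[OF DERIV_mult[OF p e]])
           (simp add: power2_eq_square algebra_simps)
    qed
    then show ?thesis
      using 1 by (rule_tac has_field_derivative_transform_within_open[where S="{0<..}", THEN DERIV_cong])
        (auto simp: flat_def)
  next
    case 2
    have "((\<lambda>_. 0) has_real_derivative 0) (at x)" by simp
    then show ?thesis
      using 2 by (rule_tac has_field_derivative_transform_within_open[where S="{..<0}", THEN DERIV_cong])
        (auto simp: flat_def)
  next
    case 3
    have "((\<lambda>h. (flat q (0 + h) - flat q 0) / h) \<longlongrightarrow> 0) (at 0)"
    proof (rule filterlim_split_at)
      have "\<forall>\<^sub>F h in at_left 0. 0 = (flat q (0 + h) - flat q 0) / h"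
        by (auto simp: eventually_at_left_field flat_def intro!: exI[of _ "-1"])
      then show "((\<lambda>h. (flat q (0 + h) - flat q 0) / h) \<longlongrightarrow> 0) (at_left 0)"
        by (rule tendsto_cong[THEN iffD1]) simp
      have "((\<lambda>h. poly ([:0, 1:] * q) (inverse h) * exp (- inverse h)) \<longlongrightarrow> 0) (at_right 0)"
        by (rule filterlim_compose[OF poly_times_exp_minus_tendsto_0 filterlim_inverse_at_top_right])
      moreover have "\<forall>\<^sub>F h in at_right 0. poly ([:0, 1:] * q) (inverse h) * exp (- inverse h) =
          (flat q (0 + h) - flat q 0) / h"
        by (auto simp: eventually_at_right_field flat_def field_simps intro!: exI[of _ 1])
      ultimately show "((\<lambda>h. (flat q (0 + h) - flat q 0) / h) \<longlongrightarrow> 0) (at_right 0)"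
        by (rule Lim_transform_eventually)
    qed
    then show ?thesis using 3 by (simp add: DERIV_def flat_def)
  qed
qed

lemma smooth_flat: "smooth (flat q)"
proof (rule smooth_if_deriv_closed[of "range flat"])
  fix f assume "f \<in> range flat"
  then obtain q where "f = flat q" by blast
  moreover have "deriv (flat q) = flat ([:0, 0, 1:] * (q - pderiv q))"
    by (rule ext, rule DERIV_imp_deriv, rule DERIV_flat)
  ultimately show "(\<forall>x. f field_differentiable at x) \<and> deriv f \<in> range flat"
    using DERIV_flat[of q] by (auto simp only: field_differentiable_def)
qed simp

text \<open>Since \<open>flat 1 (n * x) = exp (- 1 / x) powr (1 / n)\<close> for \<open>x > 0\<close>, the functions below
  increase to the indicator of the open interval.\<close>

lift_definition interval_bump :: "real \<Rightarrow> real \<Rightarrow> nat \<Rightarrow> test_fun"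
  is "\<lambda>a b n x. flat 1 (real n * x + (- real n * a)) * flat 1 (- real n * x + real n * b)"
proof -
  fix a b :: real and n :: nat
  let ?f = "\<lambda>x. flat 1 (real n * x + (- real n * a)) * flat 1 (- real n * x + real n * b)"
  have "supp ?f \<subseteq> {a..b}"
    unfolding supp_def
  proof (rule closure_minimal)
    show "{x. ?f x \<noteq> 0} \<subseteq> {a..b}"
    proof
      fix x assume x: "x \<in> {x. ?f x \<noteq> 0}"
      have "0 < real n * x + (- real n * a)" "0 < - real n * x + real n * b"
        using x by (auto simp: flat_def split: if_splits)
      then have "0 < real n * (x - a)" "0 < real n * (b - x)" by (auto simp: algebra_simps)
      then show "x \<in> {a..b}" by (auto simp: zero_less_mult_iff)
    qed
  qed simp
  then have "compact (supp ?f)" by (rule compact_supp_mono[rotated]) simp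
  then show "smooth ?f \<and> compact (supp ?f)"
    by (intro conjI smooth_mult smooth_affine smooth_flat)
qed

lemma interval_bump_bounds: "0 \<le> test_apply (interval_bump a b n) x" "test_apply (interval_bump a b n) x \<le> 1"
  by (auto simp: interval_bump.rep_eq flat_def mult_le_one)

lemma interval_bump_tendsto:
  "(\<lambda>n. test_apply (interval_bump a b n) x) \<longlonglongrightarrow> indicator {a<..<b} x"
proof (cases "x \<in> {a<..<b}")
  case True
  have "(\<lambda>n. exp (- ((1 / (x - a)) * (1 / real n))) * exp (- ((1 / (b - x)) * (1 / real n)))) \<longlonglongrightarrow>
      exp (- ((1 / (x - a)) * 0)) * exp (- ((1 / (b - x)) * 0))"
    by (intro tendsto_intros lim_1_over_n)
  moreover have "\<forall>\<^sub>F n in sequentially. exp (- ((1 / (x - a)) * (1 / real n))) * exp (- ((1 / (b - x)) * (1 / real n)))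
      = test_apply (interval_bump a b n) x"
  proof (rule eventually_sequentiallyI[of 1])
    fix n :: nat assume n: "1 \<le> n"
    have e: "real n * x + (- real n * a) = real n * (x - a)" "- real n * x + real n * b = real n * (b - x)"
      by (auto simp: algebra_simps)
    have p: "0 < real n * (x - a)" "0 < real n * (b - x)" using n True by auto
    show "exp (- ((1 / (x - a)) * (1 / real n))) * exp (- ((1 / (b - x)) * (1 / real n)))
      = test_apply (interval_bump a b n) x"
      unfolding interval_bump.rep_eq e flat_def using p by (simp add: mult.commute)
  qed
  ultimately show ?thesis using True by (auto elim: Lim_transform_eventually)
next
  case False
  have "test_apply (interval_bump a b n) x = 0" for n
  proof -
    have e: "real n * x + (- real n * a) = real n * (x - a)" "- real n * x + real n * b = real n * (b - x)"
      by (auto simp: algebra_simps)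
    show ?thesis using False unfolding interval_bump.rep_eq e flat_def by (auto simp: zero_less_mult_iff)
  qed
  then show ?thesis using False by simp
qed

section \<open>Calculus of distributions\<close>

lemma DERIV_test_apply: "(test_apply \<psi> has_real_derivative test_apply (test_deriv \<psi>) x) (at x)"
  using test_apply[of \<psi>] by (auto simp: test_deriv.rep_eq intro: smooth_DERIV)

lemma test_apply_support: obtains a b where "a < b" "\<And>x. x \<notin> {a<..<b} \<Longrightarrow> test_apply \<psi> x = 0"
proof -
  have "bounded (supp (test_apply \<psi>))" using test_apply[of \<psi>] by (auto intro: compact_imp_bounded)
  then obtain B where B: "\<And>x. x \<in> supp (test_apply \<psi>) \<Longrightarrow> \<bar>x\<bar> \<le> B" by (auto simp: bounded_iff)
  have "test_apply \<psi> x = 0" if "x \<notin> {- (\<bar>B\<bar> + 1)<..<\<bar>B\<bar> + 1}" for x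
  proof (rule ccontr)
    assume "test_apply \<psi> x \<noteq> 0"
    then have "x \<in> supp (test_apply \<psi>)"
      using closure_subset[of "{x. test_apply \<psi> x \<noteq> 0}"] by (auto simp: supp_def)
    from B[OF this] that show False by auto
  qed
  then show thesis by (intro that[of "- (\<bar>B\<bar> + 1)" "\<bar>B\<bar> + 1"]) auto
qed

lemma integrable_if_continuous_compact:
  fixes f :: "real \<Rightarrow> real"
  assumes f: "continuous_on UNIV f" and z: "\<And>x. x \<notin> {a<..<b} \<Longrightarrow> f x = 0"
  shows "integrable lborel f"
proof -
  have "integrable lborel (\<lambda>x. indicator {a..b} x *\<^sub>R f x)"
    by (intro borel_integrable_compact continuous_on_subset[OF f]) auto
  moreover have "indicator {a..b} x *\<^sub>R f x = f x" for x
    using z[of x] by (cases "x \<in> {a<..<b}") auto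
  ultimately show ?thesis by (metis (no_types, lifting) ext)
qed

lemma integrable_continuous_test:
  assumes "continuous_on UNIV v"
  shows "integrable lborel (\<lambda>x. v x * test_apply \<psi> x)"
proof -
  obtain a b where "\<And>x. x \<notin> {a<..<b} \<Longrightarrow> test_apply \<psi> x = 0" using test_apply_support by blast
  then show ?thesis
    by (intro integrable_if_continuous_compact[of _ a b])
       (auto intro!: continuous_intros assms continuous_test_apply)
qed

text \<open>Integration by parts: the boundary terms vanish outside the support of the test function.\<close>

lemma dist_deriv_dist_of_fun:
  assumes u: "\<And>x. (u has_real_derivative u' x) (at x)" and u': "continuous_on UNIV u'"
  shows "dist_deriv (dist_of_fun u) = dist_of_fun u'"
proof (rule dist_apply_inject[THEN iffD1], rule ext)
  fix \<psi>
  have cu: "continuous_on UNIV u"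
    using u by (auto intro!: DERIV_continuous_on)
  obtain a b where ab: "a < b" "\<And>x. x \<notin> {a<..<b} \<Longrightarrow> test_apply \<psi> x = 0" using test_apply_support by blast
  obtain a' b' where ab': "a' < b'" "\<And>x. x \<notin> {a'<..<b'} \<Longrightarrow> test_apply (test_deriv \<psi>) x = 0"
    using test_apply_support by blast
  define c d where "c = min a a'" and "d = max b b'"
  let ?h = "\<lambda>x. u' x * test_apply \<psi> x + u x * test_apply (test_deriv \<psi>) x"
  have "(LBINT x. ?h x * indicator {c..d} x) = u d * test_apply \<psi> d - u c * test_apply \<psi> c"
  proof (rule integral_FTC_Icc_real)
    show "c \<le> d" using ab ab' by (auto simp: c_def d_def)
    show "((\<lambda>x. u x * test_apply \<psi> x) has_real_derivative ?h x) (at x)" for x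
      by (auto intro!: derivative_eq_intros u DERIV_test_apply)
    have "continuous_on UNIV ?h"
      by (intro continuous_intros u' cu continuous_test_apply)
    then show "isCont ?h x" for x by (simp add: continuous_on_eq_continuous_at)
  qed
  moreover have "?h x * indicator {c..d} x = ?h x" for x
    using ab(2)[of x] ab'(2)[of x]
    by (cases "x \<in> {a<..<b}"; cases "x \<in> {a'<..<b'}") (auto simp: c_def d_def indicator_def)
  moreover have "test_apply \<psi> d = 0" "test_apply \<psi> c = 0"
    by (auto simp: c_def d_def intro!: ab)
  ultimately have "(LBINT x. ?h x) = 0" by simp
  then have "(LBINT x. u' x * test_apply \<psi> x) + (LBINT x. u x * test_apply (test_deriv \<psi>) x) = 0"
    by (simp add: integrable_continuous_test u' cu)
  then show "dist_apply (dist_deriv (dist_of_fun u)) \<psi> = dist_apply (dist_of_fun u') \<psi>"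
    by (simp add: dist_deriv.rep_eq dist_apply_dist_of_fun u' cu)
qed

lemma dist_of_fun_add:
  assumes "continuous_on UNIV u" "continuous_on UNIV v"
  shows "dist_of_fun (\<lambda>x. u x + v x) = dist_of_fun u + dist_of_fun v"
  by (rule dist_apply_inject[THEN iffD1], rule ext)
     (use assms in \<open>simp add: plus_distribution.rep_eq dist_apply_dist_of_fun continuous_intros
       distrib_right integrable_continuous_test\<close>)

lemma dist_of_fun_scale:
  assumes "continuous_on UNIV u"
  shows "dist_of_fun (\<lambda>x. c * u x) = c *\<^sub>R dist_of_fun u"
  by (rule dist_apply_inject[THEN iffD1], rule ext)
     (use assms in \<open>simp add: scaleR_distribution.rep_eq dist_apply_dist_of_fun continuous_intros mult.assoc\<close>)

lemma odo_apply_linear_arg: "odo_apply p (S + T) = odo_apply p S + odo_apply p T"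
  "odo_apply p (c *\<^sub>R T) = c *\<^sub>R odo_apply p T"
proof -
  show "odo_apply p (S + T) = odo_apply p S + odo_apply p T"
    by (induction p arbitrary: S T)
       (simp_all add: odo_apply_pCons linear_add[OF linear_dist_deriv] scaleR_add_right, simp add: odo_apply_def)
  show "odo_apply p (c *\<^sub>R T) = c *\<^sub>R odo_apply p T"
    by (induction p arbitrary: T)
       (simp_all add: odo_apply_pCons linear_scale[OF linear_dist_deriv] scaleR_add_right, simp add: odo_apply_def)
qed

lemma odo_apply_0 [simp]: "odo_apply 0 T = 0" "odo_apply p 0 = 0"
  using odo_apply_linear_arg(2)[of p 0 0] by (simp_all add: odo_apply_def)

section \<open>Solving scalar equations with constant coefficients\<close>

lemma antiderivative_exists:
  fixes g :: "real \<Rightarrow> real"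
  assumes "continuous_on UNIV g"
  shows "\<exists>F. \<forall>x. (F has_real_derivative g x) (at x)"
  using einterval_antiderivative[of "-\<infinity>" "\<infinity>" g] assms
  by (auto simp: has_real_derivative_iff_has_vector_derivative continuous_on_eq_continuous_at)

text \<open>With the integrating factor \<open>exp (- a x)\<close> the solution is \<open>u(x) = exp (a x) F(x)\<close>, where \<open>F\<close> is a
primitive of \<open>exp (- a x) G(x)\<close>.\<close>

lemma solve_linear_factor:
  assumes G: "continuous_on UNIV G"
  shows "\<exists>u. continuous_on UNIV u \<and> odo_apply [:- a, 1:] (dist_of_fun u) = dist_of_fun G"
proof -
  have "continuous_on UNIV (\<lambda>x. exp (- a * x) * G x)" by (intro continuous_intros G)
  then obtain F where F: "\<And>x. (F has_real_derivative exp (- a * x) * G x) (at x)"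
    using antiderivative_exists by blast
  define u where "u x = exp (a * x) * F x" for x
  have ex: "exp (a * x) * exp (- a * x) = 1" for x by (simp add: exp_minus_inverse)
  have u: "(u has_real_derivative a * u x + G x) (at x)" for x
    unfolding u_def
    by (rule derivative_eq_intros F refl)+ (use ex[of x] in \<open>simp add: algebra_simps\<close>)
  have cu: "continuous_on UNIV u" using u by (auto intro!: DERIV_continuous_on)
  have "dist_deriv (dist_of_fun u) = dist_of_fun (\<lambda>x. a * u x + G x)"
    by (intro dist_deriv_dist_of_fun u continuous_intros cu G)
  also have "\<dots> = a *\<^sub>R dist_of_fun u + dist_of_fun G"
    by (simp add: dist_of_fun_add dist_of_fun_scale cu G continuous_intros)
  finally show ?thesis using cu by (intro exI[of _ u]) (simp add: odo_apply_pCons)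
qed

text \<open>Variation of constants for \<open>(D - a)\<^sup>2 + w\<^sup>2\<close>, written as the first-order system
  \<open>u' = a u + r\<close>, \<open>r' = a r - w\<^sup>2 u + G\<close>.\<close>

lemma solve_quadratic_factor:
  assumes G: "continuous_on UNIV G" and w: "w \<noteq> 0"
  shows "\<exists>u. continuous_on UNIV u \<and>
    odo_apply [:a\<^sup>2 + w\<^sup>2, - 2 * a, 1:] (dist_of_fun u) = dist_of_fun G"
proof -
  have "continuous_on UNIV (\<lambda>x. exp (- a * x) * cos (w * x) * G x)"
    "continuous_on UNIV (\<lambda>x. exp (- a * x) * sin (w * x) * G x)" by (intro continuous_intros G)+
  then obtain C S where C: "\<And>x. (C has_real_derivative exp (- a * x) * cos (w * x) * G x) (at x)"
    and S: "\<And>x. (S has_real_derivative exp (- a * x) * sin (w * x) * G x) (at x)"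
    using antiderivative_exists by meson
  define u where "u x = exp (a * x) * (sin (w * x) * C x - cos (w * x) * S x) / w" for x
  define r where "r x = exp (a * x) * (cos (w * x) * C x + sin (w * x) * S x)" for x
  have ex: "exp (a * x) * exp (- a * x) = 1" for x by (simp add: exp_minus_inverse)
  have sc: "sin (w * x) * sin (w * x) + cos (w * x) * cos (w * x) = 1" for x
    using sin_cos_squared_add[of "w * x"] by (simp add: power2_eq_square)
  have u: "(u has_real_derivative a * u x + r x) (at x)" for x
    unfolding u_def r_def
    by (rule derivative_eq_intros C S refl w)+ (use w in \<open>simp add: field_simps\<close>)
  have uw: "(- w\<^sup>2) * u x = - (w * (exp (a * x) * (sin (w * x) * C x - cos (w * x) * S x)))" for x
    using w by (simp add: u_def power2_eq_square)
  have alg: "a * E * (c * Cx + s * Sx) + E * ((- w * s) * Cx + c * (E' * c * g) + (w * c * Sx + s * (E' * s * g)))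
      = a * (E * (c * Cx + s * Sx)) + (- (w * (E * (s * Cx - c * Sx))) + (E * E') * (s * s + c * c) * g)"
    for E E' s c Cx Sx g
    by (simp add: algebra_simps)
  have r: "(r has_real_derivative a * r x + ((- w\<^sup>2) * u x + G x)) (at x)" for x
  proof -
    have "(r has_real_derivative
        a * exp (a * x) * (cos (w * x) * C x + sin (w * x) * S x) +
        exp (a * x) * ((- w * sin (w * x)) * C x + cos (w * x) * (exp (- a * x) * cos (w * x) * G x) +
          (w * cos (w * x) * S x + sin (w * x) * (exp (- a * x) * sin (w * x) * G x)))) (at x)"
      unfolding r_def by (auto intro!: derivative_eq_intros C S)
    moreover have "a * exp (a * x) * (cos (w * x) * C x + sin (w * x) * S x) +
        exp (a * x) * ((- w * sin (w * x)) * C x + cos (w * x) * (exp (- a * x) * cos (w * x) * G x) +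
          (w * cos (w * x) * S x + sin (w * x) * (exp (- a * x) * sin (w * x) * G x)))
      = a * r x + ((- w\<^sup>2) * u x + (exp (a * x) * exp (- a * x)) *
          (sin (w * x) * sin (w * x) + cos (w * x) * cos (w * x)) * G x)"
      unfolding uw r_def by (rule alg)
    ultimately show ?thesis by (simp only: ex sc mult_1)
  qed
  have cu: "continuous_on UNIV u" using u by (auto intro!: DERIV_continuous_on)
  have cr: "continuous_on UNIV r" using r by (auto intro!: DERIV_continuous_on)
  have "dist_deriv (dist_of_fun u) = dist_of_fun (\<lambda>x. a * u x + r x)"
    by (intro dist_deriv_dist_of_fun u continuous_intros cu cr)
  also have "\<dots> = a *\<^sub>R dist_of_fun u + dist_of_fun r"
    by (simp add: dist_of_fun_add dist_of_fun_scale cu cr continuous_intros)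
  finally have 1: "dist_deriv (dist_of_fun u) = a *\<^sub>R dist_of_fun u + dist_of_fun r" .
  have "dist_deriv (dist_of_fun r) = dist_of_fun (\<lambda>x. a * r x + ((- w\<^sup>2) * u x + G x))"
    by (intro dist_deriv_dist_of_fun r continuous_intros cu cr G)
  also have "\<dots> = dist_of_fun (\<lambda>x. a * r x) + dist_of_fun (\<lambda>x. (- w\<^sup>2) * u x + G x)"
    by (rule dist_of_fun_add) (intro continuous_intros cu cr G)+
  also have "dist_of_fun (\<lambda>x. (- w\<^sup>2) * u x + G x) = dist_of_fun (\<lambda>x. (- w\<^sup>2) * u x) + dist_of_fun G"
    by (rule dist_of_fun_add) (intro continuous_intros cu cr G)+
  finally have 2: "dist_deriv (dist_of_fun r) = a *\<^sub>R dist_of_fun r + ((- w\<^sup>2) *\<^sub>R dist_of_fun u + dist_of_fun G)"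
    by (simp only: dist_of_fun_scale cu cr)
  have double: "(- 2 * a) *\<^sub>R T = (- a) *\<^sub>R T + (- a) *\<^sub>R T" for T :: distribution
    unfolding scaleR_add_left[symmetric] by simp
  have "odo_apply [:a\<^sup>2 + w\<^sup>2, - 2 * a, 1:] (dist_of_fun u) = dist_of_fun G"
    unfolding odo_apply_pCons double 1 2 linear_add[OF linear_dist_deriv] linear_scale[OF linear_dist_deriv]
    by (simp add: algebra_simps power2_eq_square)
  with cu show ?thesis by blast
qed

lemma map_poly_of_real_mult:
  "map_poly complex_of_real (p * q) = map_poly complex_of_real p * map_poly complex_of_real q"
  by (rule poly_eqI) (simp add: coeff_map_poly coeff_mult)

lemma map_poly_of_real_add:
  "map_poly complex_of_real (p + q) = map_poly complex_of_real p + map_poly complex_of_real q"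
  by (rule poly_eqI) (simp add: coeff_map_poly)

text \<open>The factor comes from a complex root \<open>z\<close>: if \<open>z\<close> is not real, then \<open>(x - z) (x - cnj z)\<close> is a real
polynomial, and the remainder of the division by it is a real polynomial of degree at most one with
the root \<open>z\<close>, hence zero.\<close>

lemma real_poly_has_small_factor:
  fixes P :: "real poly"
  assumes "0 < degree P"
  obtains (linear) a where "[:- a, 1:] dvd P"
  | (quadratic) a w where "w \<noteq> 0" "[:a\<^sup>2 + w\<^sup>2, - 2 * a, 1:] dvd P"
proof -
  let ?c = "map_poly complex_of_real"
  have "degree (?c P) = degree P" by (rule degree_map_poly) simp
  then have "\<not> constant (poly (?c P))"
    using assms by (simp add: constant_degree)
  then obtain z where z: "poly (?c P) z = 0" using fundamental_theorem_of_algebra by blast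
  define a w where "a = Re z" and "w = Im z"
  have zaw: "z = complex_of_real a + \<i> * complex_of_real w" by (simp add: a_def w_def complex_eq)
  show thesis
  proof (cases "w = 0")
    case True
    have "poly (?c P) (complex_of_real a) = complex_of_real (poly P a)"
      by (induction P) (simp_all add: map_poly_pCons)
    then have "poly P a = 0" using z zaw True by simp
    then show thesis using linear by (simp add: poly_eq_0_iff_dvd)
  next
    case False
    let ?Q = "[:a\<^sup>2 + w\<^sup>2, - 2 * a, 1:] :: real poly"
    have degQ: "degree ?Q = 2" by simp
    define R where "R = P mod ?Q"
    have "degree R < 2" unfolding R_def
      using degree_mod_less[of ?Q P] degQ by (metis degree_0 zero_less_numeral pCons_eq_0_iff one_neq_zero)
    then obtain b0 b1 where R: "R = [:b0, b1:]"
      by (metis One_nat_def Suc_1 degree_0_id less_Suc_eq less_antisym degree_pCons_eq_if not_less_eq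
          nat_neq_iff pCons_cases less_one of_nat_0 pCons_0_0 lessI)
    have "P = ?Q * (P div ?Q) + R"
      unfolding R_def by (rule mult_div_mod_eq[symmetric])
    then have "poly (?c P) z = poly (?c ?Q) z * poly (?c (P div ?Q)) z + poly (?c R) z"
      by (metis map_poly_of_real_add map_poly_of_real_mult poly_add poly_mult)
    moreover have "poly (?c ?Q) z = 0"
      by (simp add: map_poly_pCons zaw power2_eq_square algebra_simps)
    ultimately have "poly (?c R) z = 0" using z by simp
    then have "complex_of_real b0 + z * complex_of_real b1 = 0" by (simp add: R map_poly_pCons)
    then have "b0 + a * b1 = 0" "w * b1 = 0" by (auto simp: zaw complex_eq_iff)
    then have "R = 0" using R False by simp
    then show thesis using quadratic[OF False] by (simp add: R_def mod_eq_0_iff_dvd)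
  qed
qed

text \<open>If \<open>P = Q * R\<close> with a small factor \<open>Q\<close>, one solves \<open>Q{v} = G\<close> and then \<open>R{u} = v\<close>. This works because the
solution \<open>v\<close> is again a continuous function.\<close>

lemma solve_odo_continuous:
  assumes "P \<noteq> 0" "continuous_on UNIV G"
  shows "\<exists>u. continuous_on UNIV u \<and> odo_apply P (dist_of_fun u) = dist_of_fun G"
  using assms
proof (induction "degree P" arbitrary: P G rule: less_induct)
  case less
  have factor: ?case if Q: "Q dvd P" "0 < degree Q"
    and solve: "\<And>G. continuous_on UNIV G \<Longrightarrow>
      \<exists>u. continuous_on UNIV u \<and> odo_apply Q (dist_of_fun u) = dist_of_fun G" for Q
  proof -
    obtain R where R: "P = Q * R" using Q(1) by (elim dvdE)
    then have nz: "Q \<noteq> 0" "R \<noteq> 0" using less.prems(1) by auto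
    then have "degree R < degree P" using Q(2) R by (simp add: degree_mult_eq)
    obtain v where v: "continuous_on UNIV v" "odo_apply Q (dist_of_fun v) = dist_of_fun G"
      using solve[OF less.prems(2)] by blast
    obtain u where "continuous_on UNIV u" "odo_apply R (dist_of_fun u) = dist_of_fun v"
      using less.hyps[OF \<open>degree R < degree P\<close> nz(2) v(1)] by blast
    then show ?case using v(2) by (auto simp: R odo_apply_mult)
  qed
  show ?case
  proof (cases "degree P = 0")
    case True
    then obtain c where c: "P = [:c:]" using degree_eq_zeroE by blast
    then have "c \<noteq> 0" using less.prems(1) by simp
    have "odo_apply P (dist_of_fun (\<lambda>x. (1 / c) * G x)) = dist_of_fun G"
      unfolding dist_of_fun_scale[OF less.prems(2)] c by (simp add: odo_apply_pCons \<open>c \<noteq> 0\<close>)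
    then show ?thesis
      by (intro exI[of _ "\<lambda>x. (1 / c) * G x"] conjI continuous_intros less.prems(2))
  next
    case False
    then have "0 < degree P" by simp
    then show ?thesis
    proof (cases rule: real_poly_has_small_factor)
      case (linear a)
      then show ?thesis by (rule factor) (auto intro: solve_linear_factor)
    next
      case (quadratic a w)
      from quadratic(2) show ?thesis
        by (rule factor) (use solve_quadratic_factor[OF _ quadratic(1)] in auto)
    qed
  qed
qed

section \<open>Finite measures as distributions\<close>

lemma test_apply_borel [measurable]: "test_apply \<psi> \<in> borel_measurable borel"
  by (intro borel_measurable_continuous_onI continuous_test_apply)

lemma bounded_test_apply: "bounded (range (test_apply \<psi>))"
  using abs_le_test_seminorm[of \<psi>] by (auto simp: bounded_iff)

lemma signed_integral_interval_bump:
  "(\<lambda>n. signed_integral \<mu> (test_apply (interval_bump a b n))) \<longlonglongrightarrow> smeasure \<mu> {a<..<b}"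
proof -
  have *: "(\<lambda>n. LINT x|M. test_apply (interval_bump a b n) x) \<longlonglongrightarrow> measure M {a<..<b}"
    if M: "sets M = sets borel" "space M = UNIV" "finite_measure M" for M :: "real measure"
  proof -
    interpret finite_measure M by fact
    have "(\<lambda>n. LINT x|M. test_apply (interval_bump a b n) x) \<longlonglongrightarrow> (LINT x|M. indicator {a<..<b} x)"
    proof (rule integral_dominated_convergence[where w="\<lambda>_. 1"])
      show "AE x in M. norm (test_apply (interval_bump a b n) x) \<le> 1" for n
        using interval_bump_bounds[of a b n] by auto
    qed (use M interval_bump_tendsto in \<open>auto cong: measurable_cong_sets\<close>)
    then show ?thesis using M by simp
  qed
  have "smeasure \<mu> {a<..<b} = measure (pos_part \<mu>) {a<..<b} - measure (neg_part \<mu>) {a<..<b}"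
    by (rule smeasure_eq_pos_minus_neg) simp
  then show ?thesis
    unfolding signed_integral_def
    using tendsto_diff[OF *[OF upper_variation_props[of "smeasure \<mu>"]]
        *[OF upper_variation_props[of "\<lambda>E. - smeasure \<mu> E"]]] by simp
qed

text \<open>The two parts of \<open>\<mu>\<close> agree on the open intervals, which generate the Borel sets and are closed under
intersection.\<close>

lemma smeasure_0_if_intervals:
  assumes "\<And>a b. smeasure \<mu> {a<..<b} = 0"
  shows "\<mu> = 0"
proof -
  interpret P: finite_measure "pos_part \<mu>" by (rule upper_variation_props)
  interpret N: finite_measure "neg_part \<mu>" by (rule upper_variation_props)
  let ?E = "range (\<lambda>(a, b). {a<..<b} :: real set)"
  have sets: "sets borel = sigma_sets UNIV ?E"
    by (subst borel_eq_box) (simp add: box_real split_def)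
  have "pos_part \<mu> = neg_part \<mu>"
  proof (rule measure_eqI_generator_eq[where \<Omega>=UNIV and E="?E" and A="\<lambda>n. {- real n<..<real n}"])
    show "Int_stable ?E"
    proof (rule Int_stableI)
      fix A B :: "real set" assume "A \<in> ?E" "B \<in> ?E"
      then obtain a b c d where "A = {a<..<b}" "B = {c<..<d}" by auto
      then have "A \<inter> B = {max a c<..<min b d}" by auto
      then show "A \<inter> B \<in> ?E" by auto
    qed
    show "emeasure (pos_part \<mu>) X = emeasure (neg_part \<mu>) X" if "X \<in> ?E" for X
    proof -
      have "X \<in> sets borel" "smeasure \<mu> X = 0" using that assms by auto
      then show ?thesis
        using smeasure_eq_pos_minus_neg[of X \<mu>] by (simp add: P.emeasure_eq_measure N.emeasure_eq_measure)
    qed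
    show "(\<Union>i. {- real i<..<real i}) = UNIV"
    proof -
      have "\<exists>n. x \<in> {- real n<..<real n}" for x
      proof -
        obtain n where "\<bar>x\<bar> < real n" using reals_Archimedean2 by blast
        then have "x \<in> {- real n<..<real n}" by auto
        then show ?thesis by blast
      qed
      then show ?thesis by blast
    qed
  qed (use sets in \<open>auto simp: upper_variation_props P.emeasure_eq_measure\<close>)
  then have "smeasure \<mu> E = smeasure 0 E" if "E \<in> sets borel" for E
    using smeasure_eq_pos_minus_neg[OF that, of \<mu>] by (simp add: zero_signed_measure.rep_eq)
  then show ?thesis by (rule smeasure_eqI)
qed

lemma dist_of_measure_add: "dist_of_measure (\<mu> + \<nu>) = dist_of_measure \<mu> + dist_of_measure \<nu>"
  by (rule dist_apply_inject[THEN iffD1], rule ext)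
     (simp add: dist_of_measure.rep_eq plus_distribution.rep_eq signed_integral_add bounded_test_apply)

lemma dist_of_measure_scaleR: "dist_of_measure (c *\<^sub>R \<mu>) = c *\<^sub>R dist_of_measure \<mu>"
  by (rule dist_apply_inject[THEN iffD1], rule ext)
     (simp add: dist_of_measure.rep_eq scaleR_distribution.rep_eq signed_integral_scaleR bounded_test_apply)

lemma linear_dist_of_measure: "linear dist_of_measure"
  by (rule linearI) (simp_all add: dist_of_measure_add dist_of_measure_scaleR)

text \<open>Test functions increase to the indicators of open intervals, so they determine the values of a
measure there.\<close>

lemma inj_dist_of_measure: "inj dist_of_measure"
proof (subst linear_injective_0[OF linear_dist_of_measure], intro allI impI)
  fix \<mu> assume "dist_of_measure \<mu> = 0"
  then have "signed_integral \<mu> (test_apply \<psi>) = 0" for \<psi>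
    by (metis dist_of_measure.rep_eq zero_distribution.rep_eq)
  then have "smeasure \<mu> {a<..<b} = 0" for a b
    using signed_integral_interval_bump[of \<mu> a b] by (simp add: LIMSEQ_const_iff)
  then show "\<mu> = 0" by (rule smeasure_0_if_intervals)
qed

lemma linear_dist_of_vmeasure: "linear dist_of_vmeasure"
  by (rule linearI)
     (simp_all add: dist_of_vmeasure_def vec_eq_iff dist_of_measure_add dist_of_measure_scaleR)

lemma inj_dist_of_vmeasure: "inj (dist_of_vmeasure :: signed_measure ^ 'd \<Rightarrow> _)"
proof (rule injI)
  fix \<mu> \<nu> :: "signed_measure ^ 'd" assume "dist_of_vmeasure \<mu> = dist_of_vmeasure \<nu>"
  then have "dist_of_measure (\<mu> $ d) = dist_of_measure (\<nu> $ d)" for d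
    unfolding dist_of_vmeasure_def vec_eq_iff by simp
  then show "\<mu> = \<nu>" using injD[OF inj_dist_of_measure] by (simp add: vec_eq_iff)
qed

lemma inv_dist_of_vmeasure [simp]: "inv dist_of_vmeasure (dist_of_vmeasure \<mu>) = \<mu>"
  by (rule inv_f_f[OF inj_dist_of_vmeasure])

section \<open>Solving the system\<close>

text \<open>The kernel \<open>(\<bar>x - y\<bar> - \<bar>y\<bar>) / 2\<close> is, as a function of \<open>x\<close>, a second primitive of the Dirac
  measure at \<open>y\<close>. Subtracting \<open>\<bar>y\<bar> / 2\<close> makes it bounded in \<open>y\<close>, so that it can be integrated
  against every finite measure.\<close>

definition potential :: "signed_measure \<Rightarrow> real \<Rightarrow> real" where
  "potential \<mu> x = signed_integral \<mu> (\<lambda>y. (\<bar>x - y\<bar> - \<bar>y\<bar>) / 2)"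

text \<open>On both sides of \<open>y\<close> the integrand has an explicit primitive: \<open>k \<psi>' + \<psi> / 2\<close> to the left and
\<open>k \<psi>' - \<psi> / 2\<close> to the right, where \<open>k\<close> is the kernel. The jump at \<open>y\<close> is \<open>\<psi> y\<close>.\<close>

lemma potential_kernel:
  "(LBINT x. (\<bar>x - y\<bar> - \<bar>y\<bar>) / 2 * test_apply (test_deriv (test_deriv \<psi>)) x) = test_apply \<psi> y"
proof -
  let ?f = "test_apply \<psi>" and ?f' = "test_apply (test_deriv \<psi>)"
    and ?f'' = "test_apply (test_deriv (test_deriv \<psi>))"
  obtain a0 b0 where s0: "\<And>x. x \<notin> {a0<..<b0} \<Longrightarrow> ?f x = 0" using test_apply_support by blast
  obtain a1 b1 where s1: "\<And>x. x \<notin> {a1<..<b1} \<Longrightarrow> ?f' x = 0" using test_apply_support by blast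
  obtain a2 b2 where s2: "\<And>x. x \<notin> {a2<..<b2} \<Longrightarrow> ?f'' x = 0" using test_apply_support by blast
  \<comment> \<open>The interval \<open>{a..b}\<close> contains \<open>y\<close> and the supports of \<open>\<psi>\<close>, \<open>\<psi>'\<close> and \<open>\<psi>''\<close>.\<close>
  define a where "a = min y (min a0 (min a1 a2))"
  define b where "b = max y (max b0 (max b1 b2))"
  have ab: "a \<le> y" "y \<le> b" by (auto simp: a_def b_def)
  have za: "?f a = 0" "?f' a = 0" by (auto simp: a_def intro!: s0 s1)
  have zb: "?f b = 0" "?f' b = 0" by (auto simp: b_def intro!: s0 s1)
  have z: "?f'' x = 0" if "x \<notin> {a..b}" for x
    using that by (intro s2) (auto simp: a_def b_def)
  let ?l = "\<lambda>x. (y - x - \<bar>y\<bar>) / 2 * ?f'' x" and ?r = "\<lambda>x. (x - y - \<bar>y\<bar>) / 2 * ?f'' x"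
  have cl: "continuous_on UNIV ?l" and cr: "continuous_on UNIV ?r"
    by (intro continuous_intros continuous_test_apply; simp)+
  have L: "(LBINT x. ?l x * indicator {a..y} x) =
      ((y - y - \<bar>y\<bar>) / 2 * ?f' y + ?f y / 2) - ((y - a - \<bar>y\<bar>) / 2 * ?f' a + ?f a / 2)"
  proof (rule integral_FTC_Icc_real[OF ab(1)])
    show "((\<lambda>x. (y - x - \<bar>y\<bar>) / 2 * ?f' x + ?f x / 2) has_real_derivative ?l x) (at x)" for x
      by (rule derivative_eq_intros DERIV_test_apply refl | simp)+
    show "isCont ?l x" for x using cl by (simp add: continuous_on_eq_continuous_at)
  qed
  have R: "(LBINT x. ?r x * indicator {y..b} x) =
      ((b - y - \<bar>y\<bar>) / 2 * ?f' b - ?f b / 2) - ((y - y - \<bar>y\<bar>) / 2 * ?f' y - ?f y / 2)"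
  proof (rule integral_FTC_Icc_real[OF ab(2)])
    show "((\<lambda>x. (x - y - \<bar>y\<bar>) / 2 * ?f' x - ?f x / 2) has_real_derivative ?r x) (at x)" for x
      by (rule derivative_eq_intros DERIV_test_apply refl | simp)+
    show "isCont ?r x" for x using cr by (simp add: continuous_on_eq_continuous_at)
  qed
  have il: "integrable lborel (\<lambda>x. ?l x * indicator {a..y} x)"
    using borel_integrable_compact[of "{a..y}" ?l] continuous_on_subset[OF cl]
    by (simp add: mult.commute)
  have ir: "integrable lborel (\<lambda>x. ?r x * indicator {y..b} x)"
    using borel_integrable_compact[of "{y..b}" ?r] continuous_on_subset[OF cr]
    by (simp add: mult.commute)
  have "(LBINT x. (\<bar>x - y\<bar> - \<bar>y\<bar>) / 2 * ?f'' x) =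
      (LBINT x. ?l x * indicator {a..y} x + ?r x * indicator {y..b} x)"
  proof (rule integral_cong_AE)
    show "AE x in lborel. (\<bar>x - y\<bar> - \<bar>y\<bar>) / 2 * ?f'' x =
        ?l x * indicator {a..y} x + ?r x * indicator {y..b} x"
    proof (rule AE_mp[OF AE_lborel_singleton[of y]], rule AE_I2, rule impI)
      fix x assume "x \<noteq> y"
      then show "(\<bar>x - y\<bar> - \<bar>y\<bar>) / 2 * ?f'' x = ?l x * indicator {a..y} x + ?r x * indicator {y..b} x"
        using ab z[of x] by (cases "x \<in> {a..b}"; cases "x < y") (auto simp: indicator_def)
    qed
  qed (use il ir in auto)
  also have "\<dots> = (LBINT x. ?l x * indicator {a..y} x) + (LBINT x. ?r x * indicator {y..b} x)"
    using il ir by simp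
  finally show ?thesis unfolding L R using za zb by simp
qed

lemma kernel_borel: "(\<lambda>y::real. (\<bar>x - y\<bar> - \<bar>y\<bar>) / 2) \<in> borel_measurable borel"
  by measurable

lemma kernel_abs_le: "\<bar>(\<bar>x - y\<bar> - \<bar>y\<bar>) / 2\<bar> \<le> \<bar>x\<bar>" for x y :: real
proof -
  have "\<bar>\<bar>x - y\<bar> - \<bar>y\<bar>\<bar> \<le> \<bar>x\<bar>" by arith
  then show ?thesis by simp
qed

lemma kernel_bounded: "bounded (range (\<lambda>y::real. (\<bar>x - y\<bar> - \<bar>y\<bar>) / 2))"
  unfolding bounded_iff by (rule exI[of _ "\<bar>x\<bar>"]) (simp only: ball_simps real_norm_def kernel_abs_le simp_thms)

lemma signed_integral_integrand_diff:
  assumes "f \<in> borel_measurable borel" "bounded (range f)" "g \<in> borel_measurable borel" "bounded (range g)"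
  shows "signed_integral \<mu> (\<lambda>x. f x - g x) = signed_integral \<mu> f - signed_integral \<mu> g"
  using assms upper_variation_props(1,3)
  by (simp add: signed_integral_def integrable_bounded_borel)

lemma continuous_potential: "continuous_on UNIV (potential \<mu>)"
proof -
  have "dist (potential \<mu> x) (potential \<mu> z) \<le> total_mass \<mu> * dist x z" for x z
  proof -
    let ?k = "\<lambda>x y. (\<bar>x - y\<bar> - \<bar>y\<bar>) / 2 :: real"
    have "potential \<mu> x - potential \<mu> z = signed_integral \<mu> (\<lambda>y. ?k x y - ?k z y)"
      unfolding potential_def
      by (rule signed_integral_integrand_diff[symmetric]) (intro kernel_borel kernel_bounded)+
    also have "\<bar>\<dots>\<bar> \<le> \<bar>x - z\<bar> * total_mass \<mu>"
    proof (rule signed_integral_abs_le)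
      show "\<bar>?k x y - ?k z y\<bar> \<le> \<bar>x - z\<bar>" for y
      proof -
        have "?k x y - ?k z y = (\<bar>x - y\<bar> - \<bar>z - y\<bar>) / 2" by (simp add: field_simps)
        moreover have *: "\<bar>\<bar>x - y\<bar> - \<bar>z - y\<bar>\<bar> \<le> \<bar>x - z\<bar>" by arith
        ultimately have "\<bar>?k x y - ?k z y\<bar> = \<bar>\<bar>x - y\<bar> - \<bar>z - y\<bar>\<bar> / 2"
          by (simp only: abs_divide) simp
        with * show ?thesis using abs_ge_zero[of "\<bar>x - y\<bar> - \<bar>z - y\<bar>"] by linarith
      qed
    qed measurable
    finally show ?thesis by (simp add: dist_real_def mult.commute)
  qed
  then have "(total_mass \<mu>)-lipschitz_on UNIV (potential \<mu>)"
    by (intro lipschitz_onI total_mass_nonneg)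
  then show ?thesis by (rule lipschitz_on_continuous_on)
qed

text \<open>Fubini's theorem applies because the kernel is bounded by \<open>\<bar>x\<bar>\<close>, uniformly in \<open>y\<close>, and \<open>\<psi>''\<close> has
compact support.\<close>

lemma integral_potential_part:
  fixes M :: "real measure"
  assumes M: "sets M = sets borel" "space M = UNIV" "finite_measure M"
  defines "U \<equiv> \<lambda>x. LINT y|M. (\<bar>x - y\<bar> - \<bar>y\<bar>) / 2"
  shows "integrable lborel (\<lambda>x. U x * test_apply (test_deriv (test_deriv \<psi>)) x)"
    and "(LBINT x. U x * test_apply (test_deriv (test_deriv \<psi>)) x) = (LINT y|M. test_apply \<psi> y)"
proof -
  interpret M: finite_measure M by fact
  interpret pair_sigma_finite lborel M
    by (intro pair_sigma_finite.intro lborel.sigma_finite_measure_axioms M.sigma_finite_measure_axioms)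
  let ?t = "test_apply (test_deriv (test_deriv \<psi>))"
  let ?F = "\<lambda>x y. (\<bar>x - y\<bar> - \<bar>y\<bar>) / 2 * ?t x"
  have pm: "sets (lborel \<Otimes>\<^sub>M M) = sets (borel \<Otimes>\<^sub>M borel)"
    using M(1) by (intro sets_pair_measure_cong) auto
  have mF: "case_prod ?F \<in> borel_measurable (lborel \<Otimes>\<^sub>M M)"
    unfolding measurable_cong_sets[OF pm refl] split_def by measurable
  have mg: "(\<lambda>(x, y). x * ?t x) \<in> borel_measurable (lborel \<Otimes>\<^sub>M M)"
    unfolding measurable_cong_sets[OF pm refl] split_def by measurable
  have ix: "integrable lborel (\<lambda>x. x * ?t x)"
    by (intro integrable_continuous_test continuous_intros)
  have ig: "integrable (lborel \<Otimes>\<^sub>M M) (\<lambda>(x, y). x * ?t x)"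
  proof (rule Fubini_integrable[OF mg])
    show "integrable lborel (\<lambda>x. LINT y|M. norm (case (x, y) of (x, y) \<Rightarrow> x * ?t x))"
      using integrable_norm[OF ix] by simp
  qed simp
  have iF: "integrable (lborel \<Otimes>\<^sub>M M) (case_prod ?F)"
  proof (rule Bochner_Integration.integrable_bound[OF ig mF], rule AE_I2)
    fix p :: "real \<times> real"
    show "norm (case p of (x, y) \<Rightarrow> ?F x y) \<le> norm (case p of (x, y) \<Rightarrow> x * ?t x)"
      by (cases p) (simp only: prod.case real_norm_def abs_mult, intro mult_right_mono kernel_abs_le, simp)
  qed
  have "integrable lborel (\<lambda>x. LINT y|M. ?F x y)"
    using integrable_fst[OF iF] by simp
  moreover have U: "(LINT y|M. ?F x y) = U x * ?t x" for x
    unfolding U_def by simp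
  ultimately show "integrable lborel (\<lambda>x. U x * ?t x)" by (simp only: U)
  have "(LINT y|M. test_apply \<psi> y) = (LINT y|M. (LBINT x. ?F x y))"
    by (simp only: potential_kernel)
  also have "\<dots> = (LBINT x. (LINT y|M. ?F x y))"
    by (rule Fubini_integral[OF iF])
  finally show "(LBINT x. U x * ?t x) = (LINT y|M. test_apply \<psi> y)"
    by (simp only: U)
qed

lemma second_deriv_potential:
  "dist_deriv (dist_deriv (dist_of_fun (potential \<mu>))) = dist_of_measure \<mu>"
proof (rule dist_apply_inject[THEN iffD1], rule ext)
  fix \<psi>
  let ?t = "test_apply (test_deriv (test_deriv \<psi>))"
  note P = integral_potential_part[OF upper_variation_props[of "smeasure \<mu>"], of \<psi>]
  note N = integral_potential_part[OF upper_variation_props[of "\<lambda>E. - smeasure \<mu> E"], of \<psi>]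
  have "dist_apply (dist_deriv (dist_deriv (dist_of_fun (potential \<mu>)))) \<psi> = (LBINT x. potential \<mu> x * ?t x)"
    by (simp add: dist_deriv.rep_eq dist_apply_dist_of_fun continuous_potential)
  also have "\<dots> = (LINT y|pos_part \<mu>. test_apply \<psi> y) - (LINT y|neg_part \<mu>. test_apply \<psi> y)"
    unfolding potential_def signed_integral_def left_diff_distrib
    by (subst Bochner_Integration.integral_diff[OF P(1) N(1)]) (simp only: P(2) N(2))
  finally show "dist_apply (dist_deriv (dist_deriv (dist_of_fun (potential \<mu>)))) \<psi> =
      dist_apply (dist_of_measure \<mu>) \<psi>"
    by (simp add: dist_of_measure.rep_eq signed_integral_def)
qed

text \<open>A solution for the continuous right-hand side \<open>potential \<mu>\<close>, differentiated twice.\<close>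

lemma solve_odo_measure:
  assumes "P \<noteq> 0"
  shows "\<exists>h. odo_apply P h = dist_of_measure \<mu>"
proof -
  obtain u where "odo_apply P (dist_of_fun u) = dist_of_fun (potential \<mu>)"
    using solve_odo_continuous[OF assms continuous_potential] by blast
  then have "odo_apply P (dist_deriv (dist_deriv (dist_of_fun u))) = dist_of_measure \<mu>"
    by (simp add: odo_apply_deriv second_deriv_potential)
  then show ?thesis by blast
qed

text \<open>The adjugate matrix, with its entries written as determinants in which a row is replaced by a unit
vector. In this form \<open>A\<close> times the adjugate can be computed from the linearity of the determinant in
that row.\<close>

definition row_adjugate :: "'a::comm_ring_1 ^ 'd ^ 'd \<Rightarrow> 'd::finite \<Rightarrow> 'd \<Rightarrow> 'a" where
  "row_adjugate A j i = det (\<chi> k. if k = i then axis j 1 else A $ k)"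

lemma det_row_sum:
  assumes "finite S"
  shows "det (\<chi> k. if k = i then (\<Sum>j\<in>S. c j *s a j) else (b k :: 'a::comm_ring_1 ^ 'd)) =
    (\<Sum>j\<in>S. c j * det (\<chi> k. if k = i then a j else b k))"
  using assms
proof (induction S)
  case (insert x S)
  then show ?case
    using det_row_add[of i "\<lambda>_. c x *s a x" "\<lambda>_. \<Sum>j\<in>S. c j *s a j" b] det_row_mul[of i "c x" "\<lambda>_. a x" b]
    by (simp cong del: if_weak_cong)
next
  case empty
  show ?case using det_row_0[of i b] by (simp cong del: if_weak_cong)
qed

text \<open>By linearity in row \<open>i\<close>, the sum is the determinant of \<open>A\<close> with row \<open>i\<close> replaced by row \<open>k\<close>. It has
two equal rows unless \<open>k = i\<close>.\<close>

lemma mult_row_adjugate: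
  fixes A :: "'a::comm_ring_1 ^ 'd ^ 'd::finite"
  shows "(\<Sum>j\<in>UNIV. A $ k $ j * row_adjugate A j i) = (if k = i then det A else 0)"
proof -
  have "(\<Sum>j\<in>UNIV. A $ k $ j *s axis j 1) = A $ k"
    by (simp add: vec_eq_iff axis_def if_distrib cong: if_cong)
  then have "(\<Sum>j\<in>UNIV. A $ k $ j * row_adjugate A j i) = det (\<chi> l. if l = i then A $ k else A $ l)"
    unfolding row_adjugate_def using det_row_sum[of UNIV i "\<lambda>j. A $ k $ j" "\<lambda>j. axis j 1" "\<lambda>l. A $ l"]
    by (simp cong del: if_weak_cong)
  also have "\<dots> = (if k = i then det A else 0)"
  proof (cases "k = i")
    case True
    then have "(\<chi> l. if l = i then A $ k else A $ l) = A" by (simp add: vec_eq_iff)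
    then show ?thesis using True by simp
  next
    case False
    then have "row k (\<chi> l. if l = i then A $ k else A $ l) = row i (\<chi> l. if l = i then A $ k else A $ l)"
      by (simp add: row_def vec_eq_iff)
    then show ?thesis using False det_identical_rows by simp blast
  qed
  finally show ?thesis .
qed

lemma odo_apply_sum: "odo_apply p (\<Sum>i\<in>S. T i) = (\<Sum>i\<in>S. odo_apply p (T i))"
  by (induction S rule: infinite_finite_induct) (simp_all add: odo_apply_linear_arg)

lemma odo_apply_sum_left: "odo_apply (\<Sum>i\<in>S. p i) T = (\<Sum>i\<in>S. odo_apply (p i) T)"
  by (induction S rule: infinite_finite_induct) (simp_all add: odo_apply_add)

lemma linear_mdo_apply: "linear (mdo_apply L)"
  by (rule linearI)
     (simp_all add: mdo_apply_def vec_eq_iff odo_apply_linear_arg sum.distrib scaleR_sum_right)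

text \<open>If \<open>det L{h\<^sub>i} = \<mu>\<^sub>i\<close> for all \<open>i\<close>, then the adjugate matrix applied to \<open>h\<close> solves the system.\<close>

lemma mdo_apply_onto_measures:
  fixes L :: "'d::finite mdo"
  assumes "det L \<noteq> 0"
  shows "\<exists>f. mdo_apply L f = dist_of_vmeasure \<mu>"
proof -
  have "\<forall>i. \<exists>h. odo_apply (det L) h = dist_of_measure (\<mu> $ i)"
    using solve_odo_measure[OF assms] by blast
  then obtain h where h: "\<And>i. odo_apply (det L) (h i) = dist_of_measure (\<mu> $ i)"
    unfolding choice_iff by blast
  define f where "f = (\<chi> j. \<Sum>i\<in>UNIV. odo_apply (row_adjugate L j i) (h i))"
  have "(\<Sum>j\<in>UNIV. odo_apply (L $ k $ j) (f $ j)) = dist_of_measure (\<mu> $ k)" for k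
  proof -
    have "(\<Sum>j\<in>UNIV. odo_apply (L $ k $ j) (f $ j)) =
        (\<Sum>j\<in>UNIV. \<Sum>i\<in>UNIV. odo_apply (L $ k $ j * row_adjugate L j i) (h i))"
      by (simp add: f_def odo_apply_sum odo_apply_mult)
    also have "\<dots> = (\<Sum>i\<in>UNIV. odo_apply (\<Sum>j\<in>UNIV. L $ k $ j * row_adjugate L j i) (h i))"
      by (subst sum.swap) (simp add: odo_apply_sum_left)
    also have "\<dots> = (\<Sum>i\<in>UNIV. if k = i then dist_of_measure (\<mu> $ i) else 0)"
      unfolding mult_row_adjugate by (rule sum.cong) (auto simp: h)
    finally show ?thesis by simp
  qed
  then show ?thesis
    by (intro exI[of _ f]) (simp add: mdo_apply_def dist_of_vmeasure_def vec_eq_iff)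
qed

section \<open>Test functions inside the native space\<close>

lemma odo_adj_pCons: "odo_adj (pCons a p) = pCons a (- odo_adj p)"
  by (rule poly_eqI) (simp add: coeff_odo_adj coeff_pCons split: nat.split)

lemma linear_dist_apply: "linear (dist_apply T)"
  using dist_apply[of T] by simp

text \<open>The test function \<open>\<theta>\<close> is \<open>P(D) \<psi>\<close>. It serves two purposes: it represents the distribution obtained by
applying the operator to \<open>\<psi>\<close>, and pairing with it moves the adjoint operator to the other factor.\<close>

lemma odo_apply_test:
  "\<exists>\<theta>. odo_apply p (dist_of_fun (test_apply \<psi>)) = dist_of_fun (test_apply \<theta>) \<and>
    (\<forall>T. dist_apply (odo_apply (odo_adj p) T) \<psi> = dist_apply T \<theta>)"
proof (induction p arbitrary: \<psi>)
  case 0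
  have "dist_of_fun (test_apply 0) = 0"
    using dist_of_fun_scale[OF continuous_test_apply[of UNIV 0], of 0] by (simp add: zero_test_fun.rep_eq)
  then show ?case
    by (intro exI[of _ 0])
       (simp add: linear_0[OF linear_dist_apply] odo_adj_def zero_distribution.rep_eq)
next
  case (pCons a p)
  obtain \<theta> where \<theta>: "odo_apply p (dist_of_fun (test_apply (test_deriv \<psi>))) = dist_of_fun (test_apply \<theta>)"
    "\<And>T. dist_apply (odo_apply (odo_adj p) T) (test_deriv \<psi>) = dist_apply T \<theta>"
    using pCons.IH[of "test_deriv \<psi>"] by blast
  have "dist_deriv (dist_of_fun (test_apply \<psi>)) = dist_of_fun (test_apply (test_deriv \<psi>))"
    by (intro dist_deriv_dist_of_fun DERIV_test_apply continuous_test_apply)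
  then have "odo_apply (pCons a p) (dist_of_fun (test_apply \<psi>)) =
      dist_of_fun (\<lambda>x. a * test_apply \<psi> x + test_apply \<theta> x)"
    by (simp add: odo_apply_pCons \<theta> dist_of_fun_add dist_of_fun_scale continuous_test_apply continuous_intros)
  also have "(\<lambda>x. a * test_apply \<psi> x + test_apply \<theta> x) = test_apply (a *\<^sub>R \<psi> + \<theta>)"
    by (simp add: fun_eq_iff plus_test_fun.rep_eq scaleR_test_fun.rep_eq)
  finally have 1: "odo_apply (pCons a p) (dist_of_fun (test_apply \<psi>)) =
      dist_of_fun (test_apply (a *\<^sub>R \<psi> + \<theta>))" .
  have m: "dist_apply (odo_apply (- odo_adj p) S) \<eta> = - dist_apply (odo_apply (odo_adj p) S) \<eta>" for S \<eta>
  proof -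
    have "odo_apply (- odo_adj p) S = (- 1) *\<^sub>R odo_apply (odo_adj p) S"
      using odo_apply_smult[of "-1" "odo_adj p" S] by simp
    then have "dist_apply (odo_apply (- odo_adj p) S) = (\<lambda>\<psi>. - 1 * dist_apply (odo_apply (odo_adj p) S) \<psi>)"
      by (simp only: scaleR_distribution.rep_eq)
    then show ?thesis by simp
  qed
  have "dist_apply (odo_apply (odo_adj (pCons a p)) T) \<psi> = dist_apply T (a *\<^sub>R \<psi> + \<theta>)" for T
    unfolding odo_adj_pCons odo_apply_pCons
    by (simp add: plus_distribution.rep_eq scaleR_distribution.rep_eq m odo_apply_deriv dist_deriv.rep_eq \<theta>
        linear_add[OF linear_dist_apply] linear_scale[OF linear_dist_apply])
  with 1 show ?case by blast
qed

lemma dist_of_fun_sum_test: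
  "dist_of_fun (test_apply (\<Sum>i\<in>S. \<theta> i)) = (\<Sum>i\<in>S. dist_of_fun (test_apply (\<theta> i)))"
proof (induction S rule: infinite_finite_induct)
  case (insert x S)
  have "test_apply (\<theta> x + (\<Sum>i\<in>S. \<theta> i)) = (\<lambda>y. test_apply (\<theta> x) y + test_apply (\<Sum>i\<in>S. \<theta> i) y)"
    by (simp add: fun_eq_iff plus_test_fun.rep_eq)
  then show ?case using insert by (simp add: dist_of_fun_add continuous_test_apply)
qed (use dist_of_fun_scale[OF continuous_test_apply[of UNIV 0], of 0] in \<open>simp_all add: zero_test_fun.rep_eq\<close>)

lemma mdo_apply_test:
  fixes L :: "'d::finite mdo"
  shows "\<exists>\<Theta>. mdo_apply L (dist_of_test \<psi>) = dist_of_test \<Theta> \<and>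
    (\<forall>T. pairing (mdo_apply (mdo_adj L) T) \<psi> = pairing T \<Theta>)"
proof -
  have "\<forall>r d. \<exists>\<theta>. odo_apply (L $ r $ d) (dist_of_fun (test_apply (\<psi> $ d))) = dist_of_fun (test_apply \<theta>) \<and>
      (\<forall>T. dist_apply (odo_apply (odo_adj (L $ r $ d)) T) (\<psi> $ d) = dist_apply T \<theta>)"
    by (intro allI odo_apply_test)
  then obtain \<theta> where \<theta>: "\<And>r d. odo_apply (L $ r $ d) (dist_of_fun (test_apply (\<psi> $ d))) = dist_of_fun (test_apply (\<theta> r d))"
    "\<And>r d T. dist_apply (odo_apply (odo_adj (L $ r $ d)) T) (\<psi> $ d) = dist_apply T (\<theta> r d)"
    unfolding choice_iff by blast
  define \<Theta> where "\<Theta> = (\<chi> r. \<Sum>d\<in>UNIV. \<theta> r d)"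
  have "mdo_apply L (dist_of_test \<psi>) = dist_of_test \<Theta>"
    by (simp add: mdo_apply_def dist_of_test_def \<Theta>_def vec_eq_iff \<theta>(1) dist_of_fun_sum_test)
  moreover have "pairing (mdo_apply (mdo_adj L) T) \<psi> = pairing T \<Theta>" for T
  proof -
    have s: "dist_apply (\<Sum>i\<in>S. R i) \<eta> = (\<Sum>i\<in>S. dist_apply (R i) \<eta>)" for S :: "'d set" and R \<eta>
      by (induction S rule: infinite_finite_induct)
         (simp_all add: plus_distribution.rep_eq zero_distribution.rep_eq)
    have "pairing (mdo_apply (mdo_adj L) T) \<psi> = (\<Sum>d\<in>UNIV. \<Sum>r\<in>UNIV. dist_apply (T $ r) (\<theta> r d))"
      by (simp add: pairing_def mdo_apply_def mdo_adj_def s \<theta>(2))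
    also have "\<dots> = (\<Sum>r\<in>UNIV. \<Sum>d\<in>UNIV. dist_apply (T $ r) (\<theta> r d))" by (rule sum.swap)
    also have "\<dots> = pairing T \<Theta>"
      by (simp add: pairing_def \<Theta>_def linear_sum[OF linear_dist_apply])
    finally show ?thesis .
  qed
  ultimately show ?thesis by blast
qed

text \<open>The measure with density \<open>\<theta>\<close>, as the difference of the measures whose densities are the positive
and the negative part of \<open>\<theta>\<close>.\<close>

lemma test_function_is_measure:
  "\<exists>\<nu>. dist_of_fun (test_apply \<theta>) = dist_of_measure \<nu> \<and>
    (\<forall>v. v \<in> borel_measurable borel \<longrightarrow> bounded (range v) \<longrightarrow>
      signed_integral \<nu> v = (LBINT x. v x * test_apply \<theta> x))"
proof -
  obtain a b where "\<And>x. x \<notin> {a<..<b} \<Longrightarrow> test_apply \<theta> x = 0" using test_apply_support by blast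
  then have it: "integrable lborel (test_apply \<theta>)"
    by (rule integrable_if_continuous_compact[OF continuous_test_apply])
  define g h where "g = (\<lambda>x. max 0 (test_apply \<theta> x))" and "h = (\<lambda>x. max 0 (- test_apply \<theta> x))"
  have gh: "test_apply \<theta> x = g x - h x" for x by (simp add: g_def h_def)
  have g: "integrable lborel g" "\<And>x. 0 \<le> g x" and h: "integrable lborel h" "\<And>x. 0 \<le> h x"
    using it by (auto simp: g_def h_def intro!: integrable_max)
  let ?M = "\<lambda>g. density lborel (\<lambda>x. ennreal (g x))"
  have fin: "finite_measure (?M g)" if "integrable lborel g" "\<And>x. 0 \<le> g x" for g :: "real \<Rightarrow> real"
  proof (rule finite_measureI)
    have "emeasure (?M g) UNIV = (\<integral>\<^sup>+ x. ennreal (g x) \<partial>lborel)"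
      using that by (subst emeasure_density) auto
    also have "\<dots> < \<infinity>" using that nn_integral_eq_integral[of lborel g] by (simp add: less_top)
    finally show "emeasure (?M g) (space (?M g)) \<noteq> \<infinity>" by simp
  qed
  define \<nu> where "\<nu> = diff_measure (?M g) (?M h)"
  have *: "signed_integral \<nu> v = (LBINT x. v x * test_apply \<theta> x)"
    if v: "v \<in> borel_measurable borel" "bounded (range v)" for v
  proof -
    obtain B where B: "\<And>x. \<bar>v x\<bar> \<le> B" using v(2) by (auto simp: bounded_iff)
    have i: "integrable lborel (\<lambda>x. g x * v x)" if g: "integrable lborel g" "\<And>x. 0 \<le> g x" for g
    proof (rule Bochner_Integration.integrable_bound[OF integrable_mult_left[OF g(1), of B]])
      show "AE x in lborel. norm (g x * v x) \<le> norm (g x * B)"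
        using B g(2) order_trans[OF B abs_ge_self] by (auto simp: abs_mult intro!: mult_left_mono)
    qed (use v(1) g(1) in simp)
    have d: "integral\<^sup>L (?M g) v = (LBINT x. g x * v x)" if "integrable lborel g" "\<And>x. 0 \<le> g x" for g
      using that v(1) by (subst integral_density) auto
    have "signed_integral \<nu> v = (LBINT x. g x * v x) - (LBINT x. h x * v x)"
      unfolding \<nu>_def using fin[OF g] fin[OF h] v
      by (subst signed_integral_diff_measure) (simp_all add: d[OF g] d[OF h])
    also have "\<dots> = (LBINT x. g x * v x - h x * v x)"
      by (rule Bochner_Integration.integral_diff[symmetric, OF i[OF g] i[OF h]])
    finally show ?thesis by (simp add: gh left_diff_distrib right_diff_distrib mult.commute)
  qed
  have "dist_of_fun (test_apply \<theta>) = dist_of_measure \<nu>"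
    by (rule dist_apply_inject[THEN iffD1], rule ext)
       (simp add: dist_apply_dist_of_fun continuous_test_apply dist_of_measure.rep_eq * bounded_test_apply mult.commute)
  with * show ?thesis by blast
qed

lemma pairing_dist_of_test_commute: "pairing (dist_of_test \<psi>) \<phi> = pairing (dist_of_test \<phi>) \<psi>"
  by (simp add: pairing_def dist_of_test_def dist_apply_dist_of_fun continuous_test_apply mult.commute)

text \<open>On test functions the weak action of \<open>L\<^sup>\<star>\<close> on \<open>v\<close> is the distributional one: \<open>L{\<psi>}\<close> is a measure with
a test function as density, and \<open>\<integral> v L{\<psi>}\<close> can be read as \<open>\<langle>L\<^sup>\<star>{v}, \<psi>\<rangle>\<close>.\<close>

lemma dist_of_test_native_space:
  fixes L :: "'d::finite mdo"
  shows "dist_of_test \<psi> \<in> native_space L"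
    and "continuous_on UNIV v \<Longrightarrow> bounded (range v) \<Longrightarrow>
      measure_pairing (inv dist_of_vmeasure (mdo_apply L (dist_of_test \<psi>))) v =
        pairing (mdo_apply (mdo_adj L) (dist_of_vfun v)) \<psi>"
proof -
  obtain \<Theta> where \<Theta>: "mdo_apply L (dist_of_test \<psi>) = dist_of_test \<Theta>"
    "\<And>T. pairing (mdo_apply (mdo_adj L) T) \<psi> = pairing T \<Theta>"
    using mdo_apply_test[of L \<psi>] by (elim exE conjE) simp
  have "\<forall>d. \<exists>\<nu>. dist_of_fun (test_apply (\<Theta> $ d)) = dist_of_measure \<nu> \<and>
      (\<forall>v. v \<in> borel_measurable borel \<longrightarrow> bounded (range v) \<longrightarrow>
        signed_integral \<nu> v = (LBINT x. v x * test_apply (\<Theta> $ d) x))"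
    by (intro allI test_function_is_measure)
  from choice[OF this] obtain \<nu> where "\<forall>d. dist_of_fun (test_apply (\<Theta> $ d)) = dist_of_measure (\<nu> d) \<and>
      (\<forall>v. v \<in> borel_measurable borel \<longrightarrow> bounded (range v) \<longrightarrow>
        signed_integral (\<nu> d) v = (LBINT x. v x * test_apply (\<Theta> $ d) x))"
    by (rule exE)
  then have \<nu>: "dist_of_fun (test_apply (\<Theta> $ d)) = dist_of_measure (\<nu> d)"
    "v \<in> borel_measurable borel \<Longrightarrow> bounded (range v) \<Longrightarrow>
        signed_integral (\<nu> d) v = (LBINT x. v x * test_apply (\<Theta> $ d) x)" for d v
    by auto
  have eq: "mdo_apply L (dist_of_test \<psi>) = dist_of_vmeasure (\<chi> d. \<nu> d)"
  proof -
    have "dist_of_test \<Theta> = dist_of_vmeasure (\<chi> d. \<nu> d)"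
      unfolding dist_of_test_def dist_of_vmeasure_def by (simp add: \<nu>(1))
    with \<Theta>(1) show ?thesis by simp
  qed
  then show "dist_of_test \<psi> \<in> native_space L" by (simp add: native_space_def)
  assume v: "continuous_on UNIV v" "bounded (range v)"
  have vd: "continuous_on UNIV (\<lambda>x. v x $ d)" for d using v(1) by (intro continuous_intros)
  have bd: "bounded (range (\<lambda>x. v x $ d))" for d
    using v(2) by (auto simp: bounded_iff intro: order_trans[OF component_le_norm_cart])
  show "measure_pairing (inv dist_of_vmeasure (mdo_apply L (dist_of_test \<psi>))) v =
        pairing (mdo_apply (mdo_adj L) (dist_of_vfun v)) \<psi>"
    unfolding \<Theta>(2) eq inv_dist_of_vmeasure
    by (simp add: measure_pairing_def pairing_def dist_of_vfun_def dist_apply_dist_of_fun vd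
        \<nu>(2)[OF borel_measurable_continuous_onI[OF vd] bd])
qed

section \<open>Riesz representation on the line\<close>

definition C0_scalar :: "(real \<Rightarrow> real) set" where
  "C0_scalar = {f. continuous_on UNIV f \<and> (f \<longlongrightarrow> 0) at_infinity}"

lemma C0_scalarI_support:
  fixes f :: "real \<Rightarrow> real"
  assumes "continuous_on UNIV f" "\<And>t. t \<notin> {a..b} \<Longrightarrow> f t = 0"
  shows "f \<in> C0_scalar"
proof -
  have "\<forall>\<^sub>F t in at_infinity. f t = 0"
    unfolding eventually_at_infinity
  proof (intro exI allI impI)
    fix t :: real assume "\<bar>a\<bar> + \<bar>b\<bar> + 1 \<le> norm t"
    then show "f t = 0" by (intro assms(2)) auto
  qed
  then have "(f \<longlongrightarrow> 0) at_infinity" by (rule tendsto_eventually)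
  then show ?thesis using assms(1) by (simp add: C0_scalar_def)
qed

lemma C0_scalar_add: "f \<in> C0_scalar \<Longrightarrow> g \<in> C0_scalar \<Longrightarrow> (\<lambda>t. f t + g t) \<in> C0_scalar"
  using tendsto_add[of f 0 at_infinity g 0] by (auto simp: C0_scalar_def intro: continuous_intros)

lemma C0_scalar_scale: "f \<in> C0_scalar \<Longrightarrow> (\<lambda>t. c * f t) \<in> C0_scalar"
  using tendsto_mult_right_zero[of f at_infinity c] by (auto simp: C0_scalar_def intro: continuous_intros)

lemma C0_scalar_diff: "f \<in> C0_scalar \<Longrightarrow> g \<in> C0_scalar \<Longrightarrow> (\<lambda>t. f t - g t) \<in> C0_scalar"
  using tendsto_diff[of f 0 at_infinity g 0] by (auto simp: C0_scalar_def intro: continuous_intros)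

lemma C0_scalar_sum: "(\<And>i. i \<in> S \<Longrightarrow> f i \<in> C0_scalar) \<Longrightarrow> (\<lambda>t. \<Sum>i\<in>S. f i t) \<in> C0_scalar"
proof (induction S rule: infinite_finite_induct)
  case (insert x S)
  then show ?case using C0_scalar_add[of "f x" "\<lambda>t. \<Sum>i\<in>S. f i t"] by simp
qed (simp_all add: C0_scalar_def)

lemma C0_scalar_dominated:
  assumes "f \<in> C0_scalar" "continuous_on UNIV g" "\<And>t. \<bar>g t\<bar> \<le> \<bar>f t\<bar>"
  shows "g \<in> C0_scalar"
proof -
  have "((\<lambda>t. \<bar>f t\<bar>) \<longlongrightarrow> 0) at_infinity"
    using assms(1) tendsto_rabs_zero by (auto simp: C0_scalar_def)
  then have "(g \<longlongrightarrow> 0) at_infinity"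
    by (rule Lim_null_comparison[rotated]) (use assms(3) in simp)
  then show ?thesis using assms(2) by (simp add: C0_scalar_def)
qed

lemma C0_scalar_small_outside:
  assumes "f \<in> C0_scalar" "0 < e"
  shows "\<exists>R. \<forall>t. R \<le> \<bar>t\<bar> \<longrightarrow> \<bar>f t\<bar> < e"
  using assms unfolding C0_scalar_def tendsto_iff eventually_at_infinity dist_real_def by simp

lemma C0_scalar_borel: "f \<in> C0_scalar \<Longrightarrow> f \<in> borel_measurable borel"
  by (auto simp: C0_scalar_def intro!: borel_measurable_continuous_onI)

lemma C0_scalar_bounded:
  assumes f: "f \<in> C0_scalar"
  shows "bounded (range f)"
proof -
  have "(0::real) < 1" by simp
  then obtain R where R: "\<And>t. R \<le> \<bar>t\<bar> \<Longrightarrow> \<bar>f t\<bar> < 1"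
    using C0_scalar_small_outside[OF f] by blast
  have "bounded (f ` {- \<bar>R\<bar>..\<bar>R\<bar>})"
    using f by (intro compact_imp_bounded compact_continuous_image) (auto simp: C0_scalar_def intro: continuous_on_subset)
  then obtain K where K: "\<forall>t\<in>{- \<bar>R\<bar>..\<bar>R\<bar>}. \<bar>f t\<bar> \<le> K" by (auto simp: bounded_iff)
  have "\<bar>f t\<bar> \<le> max K 1" for t
  proof (cases "t \<in> {- \<bar>R\<bar>..\<bar>R\<bar>}")
    case False
    then have "R \<le> \<bar>t\<bar>" by auto
    then show ?thesis using R[of t] by linarith
  qed (use K in force)
  then show ?thesis by (auto simp: bounded_iff)
qed

lemma C0_scalar_uniformly_continuous:
  assumes f: "f \<in> C0_scalar" and e: "0 < e"
  obtains d where "0 < d" "\<And>s t. \<bar>s - t\<bar> \<le> d \<Longrightarrow> \<bar>f s - f t\<bar> \<le> e"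
proof -
  have "0 < e / 2" using e by simp
  then obtain R where R: "\<And>t. R \<le> \<bar>t\<bar> \<Longrightarrow> \<bar>f t\<bar> < e / 2"
    using C0_scalar_small_outside[OF f] by blast
  have "uniformly_continuous_on {- (\<bar>R\<bar> + 1)..\<bar>R\<bar> + 1} f"
    using f by (intro compact_uniformly_continuous) (auto simp: C0_scalar_def intro: continuous_on_subset)
  then obtain d where d: "0 < d"
    "\<And>s t. s \<in> {- (\<bar>R\<bar> + 1)..\<bar>R\<bar> + 1} \<Longrightarrow> t \<in> {- (\<bar>R\<bar> + 1)..\<bar>R\<bar> + 1} \<Longrightarrow> \<bar>t - s\<bar> < d \<Longrightarrow> \<bar>f t - f s\<bar> < e"
    unfolding uniformly_continuous_on_def dist_real_def using e by metis
  define d' where "d' = min (d / 2) 1"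
  have "\<bar>f s - f t\<bar> \<le> e" if st: "\<bar>s - t\<bar> \<le> d'" for s t
  proof (cases "s \<in> {- (\<bar>R\<bar> + 1)..\<bar>R\<bar> + 1} \<and> t \<in> {- (\<bar>R\<bar> + 1)..\<bar>R\<bar> + 1}")
    case True
    have "\<bar>s - t\<bar> < d" using st d(1) by (simp add: d'_def)
    then show ?thesis using d(2)[of t s] True by simp
  next
    case False
    have "\<bar>s - t\<bar> \<le> 1" using st by (simp add: d'_def)
    then have "R \<le> \<bar>s\<bar>" "R \<le> \<bar>t\<bar>" using False by auto
    then show ?thesis using R[of s] R[of t] by linarith
  qed
  then show thesis using that[of d'] d(1) by (simp add: d'_def)
qed

text \<open>\<open>ramp h a\<close> rises from \<open>0\<close> to \<open>1\<close> on \<open>{a..a + h}\<close>; the difference of two ramps of the same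
  width is a trapezoid.\<close>

definition ramp :: "real \<Rightarrow> real \<Rightarrow> real \<Rightarrow> real" where
  "ramp h a t = max 0 (min 1 ((t - a) / h))"

definition trapezoid :: "real \<Rightarrow> real \<Rightarrow> real \<Rightarrow> real \<Rightarrow> real" where
  "trapezoid h a b t = ramp h a t - ramp h b t"

lemma ramp_bounds: "0 \<le> ramp h a t" "ramp h a t \<le> 1"
  by (auto simp: ramp_def)

lemma ramp_eq_0: "0 < h \<Longrightarrow> t \<le> a \<Longrightarrow> ramp h a t = 0"
  using divide_nonpos_pos[of "t - a" h] by (simp add: ramp_def)

lemma ramp_eq_1: "0 < h \<Longrightarrow> a + h \<le> t \<Longrightarrow> ramp h a t = 1"
  by (auto simp: ramp_def min_def field_simps)

lemma ramp_antimono: "0 < h \<Longrightarrow> a \<le> b \<Longrightarrow> ramp h b t \<le> ramp h a t"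
  unfolding ramp_def by (intro max.mono min.mono divide_right_mono) auto

lemma continuous_ramp: "continuous_on A (ramp h a)"
  unfolding ramp_def divide_inverse by (intro continuous_intros)

lemma trapezoid_bounds: "0 < h \<Longrightarrow> a \<le> b \<Longrightarrow> 0 \<le> trapezoid h a b t" "0 < h \<Longrightarrow> a \<le> b \<Longrightarrow> trapezoid h a b t \<le> 1"
  using ramp_bounds[of h] ramp_antimono[of h a b t] by (auto simp: trapezoid_def) (smt (verit))

lemma trapezoid_eq_0: "0 < h \<Longrightarrow> a \<le> b \<Longrightarrow> t \<le> a \<or> b + h \<le> t \<Longrightarrow> trapezoid h a b t = 0"
  by (auto simp: trapezoid_def ramp_eq_0 ramp_eq_1)

lemma trapezoid_eq_1: "0 < h \<Longrightarrow> a + h \<le> t \<Longrightarrow> t \<le> b \<Longrightarrow> trapezoid h a b t = 1"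
  by (auto simp: trapezoid_def ramp_eq_0 ramp_eq_1)

lemma trapezoid_C0: "0 < h \<Longrightarrow> a \<le> b \<Longrightarrow> trapezoid h a b \<in> C0_scalar"
proof (rule C0_scalarI_support[of _ a "b + h"])
  show "continuous_on UNIV (trapezoid h a b)"
    unfolding trapezoid_def[abs_def] by (intro continuous_intros continuous_ramp)
  show "0 < h \<Longrightarrow> a \<le> b \<Longrightarrow> t \<notin> {a..b + h} \<Longrightarrow> trapezoid h a b t = 0" for t
    by (rule trapezoid_eq_0) auto
qed

lemma sum_unit_ramps:
  "(\<Sum>i<n. max 0 (min 1 (y - real i))) = max 0 (min (real n) y)"
  by (induction n) (auto simp: min_def max_def)

text \<open>A ramp of width \<open>h\<close> is the average of \<open>n\<close> consecutive ramps of width \<open>h / n\<close>.\<close>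

lemma ramp_subdivide:
  assumes "0 < h" "0 < n"
  shows "(\<Sum>i<n. ramp (h / n) (a + real i * (h / n)) t) = real n * ramp h a t"
proof -
  define y where "y = (t - a) / (h / n)"
  have "ramp (h / n) (a + real i * (h / n)) t = max 0 (min 1 (y - real i))" for i
  proof -
    have "(t - (a + real i * (h / n))) / (h / n) = y - real i"
      using assms by (simp add: y_def field_simps)
    then show ?thesis by (simp only: ramp_def)
  qed
  then have "(\<Sum>i<n. ramp (h / n) (a + real i * (h / n)) t) = max 0 (min (real n) y)"
    by (simp add: sum_unit_ramps)
  also have "y = real n * ((t - a) / h)" using assms by (simp add: y_def)
  also have "max 0 (min (real n) (real n * ((t - a) / h))) = real n * ramp h a t"
    using assms by (simp add: ramp_def max_mult_distrib_left min_mult_distrib_left)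
  finally show ?thesis .
qed

lemma trapezoid_subdivide:
  assumes "0 < h" "0 < n"
  shows "(\<Sum>i<n. trapezoid (h / n) (a + real i * (h / n)) (b + real i * (h / n)) t) =
    real n * trapezoid h a b t"
  unfolding trapezoid_def sum_subtractf ramp_subdivide[OF assms] right_diff_distrib ..

subsection \<open>Distribution function of the positive variation\<close>

definition unit_bumps :: "real \<Rightarrow> (real \<Rightarrow> real) set" where
  "unit_bumps x = {g \<in> C0_scalar. \<forall>t. 0 \<le> g t \<and> g t \<le> 1 \<and> (x \<le> t \<longrightarrow> g t = 0)}"

text \<open>Once the functional is known to be integration against a signed measure, this is the mass
  that the positive part of the measure gives to the half line \<open>{..<x}\<close>.\<close>

definition left_mass :: "((real \<Rightarrow> real) \<Rightarrow> real) \<Rightarrow> real \<Rightarrow> real" where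
  "left_mass u x = (SUP g\<in>unit_bumps x. u g)"

text \<open>A bounded linear functional on \<open>C0_scalar\<close>; \<open>B\<close> bounds its norm.\<close>

locale C0_functional =
  fixes u :: "(real \<Rightarrow> real) \<Rightarrow> real" and B :: real
  assumes add: "f \<in> C0_scalar \<Longrightarrow> g \<in> C0_scalar \<Longrightarrow> u (\<lambda>t. f t + g t) = u f + u g"
    and scale: "f \<in> C0_scalar \<Longrightarrow> u (\<lambda>t. c * f t) = c * u f"
    and bound: "f \<in> C0_scalar \<Longrightarrow> (\<And>t. \<bar>f t\<bar> \<le> r) \<Longrightarrow> \<bar>u f\<bar> \<le> B * r"
begin

lemma diff:
  assumes "f \<in> C0_scalar" "g \<in> C0_scalar"
  shows "u (\<lambda>t. f t - g t) = u f - u g"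
  using add[OF assms(1) C0_scalar_scale[OF assms(2), of "-1"]] scale[OF assms(2), of "-1"] by simp

lemma zero_C0: "(\<lambda>_. 0) \<in> C0_scalar"
  by (simp add: C0_scalar_def)

lemma zero: "u (\<lambda>_. 0) = 0"
  using scale[OF zero_C0, of 0] by simp

lemma sum: "(\<And>i. i \<in> S \<Longrightarrow> f i \<in> C0_scalar) \<Longrightarrow> u (\<lambda>t. \<Sum>i\<in>S. f i t) = (\<Sum>i\<in>S. u (f i))"
proof (induction S rule: infinite_finite_induct)
  case (insert x S)
  then show ?case
    using add[of "f x" "\<lambda>t. \<Sum>i\<in>S. f i t"] C0_scalar_sum[of S f] by simp
qed (simp_all add: zero)

lemma negative: "C0_functional (\<lambda>f. - u f) B"
  by standard (use add scale bound in auto)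

lemma bump_le:
  assumes "g \<in> unit_bumps x"
  shows "u g \<le> B"
proof -
  have "\<bar>u g\<bar> \<le> B * 1" using assms by (intro bound) (auto simp: unit_bumps_def)
  then show ?thesis by simp
qed

lemma bdd_bumps: "bdd_above (u ` unit_bumps x)"
  using bump_le by (auto simp: bdd_above_def)

lemma zero_bump: "(\<lambda>_. 0) \<in> unit_bumps x"
  by (simp add: unit_bumps_def zero_C0)

lemma le_left_mass: "g \<in> unit_bumps x \<Longrightarrow> u g \<le> left_mass u x"
  unfolding left_mass_def by (rule cSUP_upper[OF _ bdd_bumps])

lemma left_mass_le: "(\<And>g. g \<in> unit_bumps x \<Longrightarrow> u g \<le> c) \<Longrightarrow> left_mass u x \<le> c"
  unfolding left_mass_def using zero_bump by (intro cSUP_least) blast+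

lemma left_mass_bounds: "0 \<le> left_mass u x" "left_mass u x \<le> B"
  using le_left_mass[OF zero_bump] zero left_mass_le[OF bump_le] by auto

text \<open>A bump between \<open>x\<close> and \<open>y\<close> can be added to any competitor for \<open>left_mass u x\<close>.\<close>

lemma gap_le:
  assumes g: "g \<in> C0_scalar" "\<And>t. 0 \<le> g t" "\<And>t. g t \<le> 1" "\<And>t. t \<le> x \<or> y \<le> t \<Longrightarrow> g t = 0" and "x \<le> y"
  shows "u g \<le> left_mass u y - left_mass u x"
proof -
  have "left_mass u x \<le> left_mass u y - u g"
  proof (rule left_mass_le)
    fix h assume h: "h \<in> unit_bumps x"
    have "(\<lambda>t. h t + g t) \<in> unit_bumps y"
    proof -
      have "0 \<le> h t + g t \<and> h t + g t \<le> 1 \<and> (y \<le> t \<longrightarrow> h t + g t = 0)" for t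
      proof -
        have "0 \<le> h t" "h t \<le> 1" "x \<le> t \<Longrightarrow> h t = 0" using h by (auto simp: unit_bumps_def)
        then show ?thesis
          using g(2,3)[of t] g(4)[of t] \<open>x \<le> y\<close> by (cases "t \<le> x") auto
      qed
      moreover have "(\<lambda>t. h t + g t) \<in> C0_scalar"
        using h g(1) by (intro C0_scalar_add) (auto simp: unit_bumps_def)
      ultimately show ?thesis by (simp add: unit_bumps_def)
    qed
    then have "u (\<lambda>t. h t + g t) \<le> left_mass u y" by (rule le_left_mass)
    moreover have "u (\<lambda>t. h t + g t) = u h + u g" using h g by (intro add) (auto simp: unit_bumps_def)
    ultimately show "u h \<le> left_mass u y - u g" by simp
  qed
  then show ?thesis by simp
qed

lemma left_mass_mono: "x \<le> y \<Longrightarrow> left_mass u x \<le> left_mass u y"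
  using gap_le[of "\<lambda>_. 0" x y] zero zero_C0 by simp

lemma mono_left_mass: "mono (left_mass u)"
  by (rule monoI) (rule left_mass_mono)

text \<open>For a signed measure with parts \<open>P\<close> and \<open>N\<close> the integral of the trapezoid differs from the mass of the
half-open interval from \<open>a\<close> to \<open>b + h\<close> only by mass under the two slopes. To prove the lower bound
for a functional, a competitor \<open>g\<close> for \<open>left_mass u (b + h)\<close> is cut at the left slope into
\<open>gl + gr\<close>, and \<open>gr\<close> is compared with the trapezoid: by the gap lemma, passing to the minimum \<open>m\<close>
of the two costs at most the positive mass under the right slope, and the rest of the trapezoid
contributes at least minus the negative mass between \<open>a\<close> and \<open>b + h\<close>. The upper bound is
this bound for \<open>- u\<close>.\<close>

lemma trapezoid_ge:
  assumes h: "0 < h" "a + h \<le> b"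
  defines "P \<equiv> left_mass u" and "N \<equiv> left_mass (\<lambda>f. - u f)"
  shows "(P (b + h) - N (b + h)) - (P a - N a) - (P (a + h) - P a) - (P (b + h) - P b)
    \<le> u (trapezoid h a b)"
proof -
  interpret neg: C0_functional "\<lambda>f. - u f" B by (rule negative)
  let ?T = "trapezoid h a b"
  have TC: "?T \<in> C0_scalar" using h by (intro trapezoid_C0) auto
  have "P (b + h) \<le> u ?T + P (a + h) + (P (b + h) - P b) + (N (b + h) - N a)"
    unfolding P_def
  proof (rule left_mass_le)
    fix g assume g: "g \<in> unit_bumps (b + h)"
    then have gC: "g \<in> C0_scalar" and g01: "\<And>t. 0 \<le> g t" "\<And>t. g t \<le> 1" and g0: "\<And>t. b + h \<le> t \<Longrightarrow> g t = 0"
      by (auto simp: unit_bumps_def)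
    have gc: "continuous_on UNIV g" using gC by (simp add: C0_scalar_def)
    define gl where "gl t = g t * (1 - ramp h a t)" for t
    define gr where "gr t = g t * ramp h a t" for t
    define m where "m t = min (?T t) (gr t)" for t
    have glr: "g t = gl t + gr t" for t by (simp add: gl_def gr_def algebra_simps)
    have glC: "gl \<in> C0_scalar"
      by (rule C0_scalar_dominated[OF gC])
         (use ramp_bounds[of h a] in \<open>auto simp: gl_def[abs_def] abs_mult mult_left_le intro!: continuous_intros gc continuous_ramp\<close>)
    have grC: "gr \<in> C0_scalar"
      by (rule C0_scalar_dominated[OF gC])
         (use ramp_bounds[of h a] in \<open>auto simp: gr_def[abs_def] abs_mult mult_left_le intro!: continuous_intros gc continuous_ramp\<close>)
    have gr01: "0 \<le> gr t" "gr t \<le> 1" "gr t \<le> ramp h a t" for t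
      using g01[of t] ramp_bounds[of h a t] by (auto simp: gr_def mult_le_one mult_left_le_one_le)
    have T01: "0 \<le> ?T t" "?T t \<le> 1" for t using h trapezoid_bounds[of h a b t] by auto
    have m01: "0 \<le> m t" "m t \<le> ?T t" "m t \<le> gr t" for t using gr01[of t] T01[of t] by (auto simp: m_def)
    have mC: "m \<in> C0_scalar"
      by (rule C0_scalar_dominated[OF grC])
         (use gr01 m01 grC TC in \<open>auto simp: m_def[abs_def] C0_scalar_def intro!: continuous_intros\<close>)
    have "gl \<in> unit_bumps (a + h)"
      using glC g01 ramp_bounds[of h a] ramp_eq_1[OF h(1), of a]
      by (auto simp: unit_bumps_def gl_def mult_le_one)
    then have 1: "u gl \<le> left_mass u (a + h)" by (rule le_left_mass)
    have 2: "u (\<lambda>t. gr t - m t) \<le> left_mass u (b + h) - left_mass u b"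
    proof (rule gap_le)
      fix t
      show "gr t - m t \<le> 1" using gr01[of t] m01[of t] by linarith
      assume "t \<le> b \<or> b + h \<le> t"
      then show "gr t - m t = 0"
      proof
        assume "t \<le> b"
        then have "?T t = ramp h a t" by (simp add: trapezoid_def ramp_eq_0 h)
        then show ?thesis using gr01(3)[of t] by (simp add: m_def)
      next
        assume "b + h \<le> t"
        then have "gr t = 0" by (simp add: gr_def g0)
        then show ?thesis using m01[of t] by simp
      qed
    qed (use grC mC m01 h in \<open>auto intro: C0_scalar_diff\<close>)
    have 3: "- u (\<lambda>t. ?T t - m t) \<le> N (b + h) - N a"
      unfolding N_def
    proof (rule neg.gap_le)
      fix t
      show "?T t - m t \<le> 1" using T01[of t] m01[of t] by linarith
      assume "t \<le> a \<or> b + h \<le> t"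
      then have "?T t = 0" using h by (intro trapezoid_eq_0) auto
      then show "?T t - m t = 0" using m01[of t] by simp
    qed (use TC mC m01 h in \<open>auto intro: C0_scalar_diff\<close>)
    have "u g = u gl + u gr" using add[OF glC grC] by (simp add: glr[symmetric])
    moreover have "u (\<lambda>t. gr t - m t) = u gr - u m" by (rule diff[OF grC mC])
    moreover have "u (\<lambda>t. ?T t - m t) = u ?T - u m" by (rule diff[OF TC mC])
    ultimately show "u g \<le> u ?T + left_mass u (a + h) + (left_mass u (b + h) - left_mass u b) + (N (b + h) - N a)"
      using 1 2 3 by linarith
  qed
  then show ?thesis by linarith
qed

end

subsection \<open>From distribution functions to measures\<close>

definition right_limit :: "(real \<Rightarrow> real) \<Rightarrow> real \<Rightarrow> real" where
  "right_limit P x = (INF y\<in>{x<..}. P y)"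

text \<open>The Stieltjes measure of the right-continuous version of \<open>P\<close>. Its distribution function at \<open>x\<close> lies
between \<open>P x\<close> and \<open>P y\<close> for every \<open>y > x\<close>; this is why the error involves \<open>P\<close> at distance
\<open>2 * h\<close> instead of \<open>h\<close>.\<close>

lemma stieltjes_measure:
  fixes P :: "real \<Rightarrow> real"
  assumes "mono P" and bounds: "\<And>x. 0 \<le> P x" "\<And>x. P x \<le> B"
  shows "\<exists>M. finite_measure M \<and> sets M = sets borel \<and>
    (\<forall>a b h. 0 < h \<longrightarrow> a + h \<le> b \<longrightarrow>
      \<bar>(LINT t|M. trapezoid h a b t) - (P (b + h) - P a)\<bar> \<le> (P (a + 2 * h) - P a) + (P (b + 2 * h) - P b))"
proof -
  note mono = monoD[OF \<open>mono P\<close>]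
  let ?F = "right_limit P"
  have bdd: "bdd_below (P ` {x<..})" for x using bounds by (auto simp: bdd_below_def)
  have Fle: "?F x \<le> P y" if "x < y" for x y
    unfolding right_limit_def by (rule cINF_lower[OF bdd]) (use that in auto)
  have leF: "c \<le> ?F x" if "\<And>y. x < y \<Longrightarrow> c \<le> P y" for c x
    unfolding right_limit_def by (rule cINF_greatest) (use that in auto)
  have PF: "P x \<le> ?F x" for x by (rule leF) (simp add: mono)
  have Fmono: "?F x \<le> ?F y" if "x \<le> y" for x y
    by (rule leF) (use that in \<open>auto intro!: Fle\<close>)
  have Fb: "0 \<le> ?F x" "?F x \<le> B" for x
    using bounds(1)[of x] PF[of x] Fle[of x "x + 1"] bounds(2)[of "x + 1"] by auto
  have Fcont: "continuous (at_right x) ?F" for x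
  proof (subst continuous_at_right_real_increasing)
    show "\<forall>e>0. \<exists>d>0. ?F (x + d) - ?F x < e"
    proof (intro allI impI)
      fix e :: real assume "0 < e"
      have "\<exists>y>x. P y < ?F x + e"
      proof (rule ccontr)
        assume "\<not> ?thesis"
        then have "?F x + e \<le> ?F x" by (intro leF) force
        then show False using \<open>0 < e\<close> by simp
      qed
      then obtain y where y: "x < y" "P y < ?F x + e" by blast
      have "?F (x + (y - x) / 2) \<le> P y" using y(1) by (intro Fle) (simp add: field_simps)
      then show "\<exists>d>0. ?F (x + d) - ?F x < e" using y by (intro exI[of _ "(y - x) / 2"]) auto
    qed
  qed (rule Fmono)
  let ?M = "interval_measure ?F"
  have Ioc: "emeasure ?M {a<..b} = ennreal (?F b - ?F a)" if "a \<le> b" for a b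
    by (rule emeasure_interval_measure_Ioc[OF that Fmono Fcont])
  have setsM: "sets ?M = sets borel" by simp
  have fin: "finite_measure ?M"
  proof (rule finite_measureI)
    have U: "(\<Union>n. {- real n<..real n}) = (UNIV :: real set)"
    proof -
      have "\<exists>n. x \<in> {- real n<..real n}" for x :: real
      proof -
        obtain n where "\<bar>x\<bar> < real n" using reals_Archimedean2 by blast
        then show ?thesis by (intro exI[of _ n]) auto
      qed
      then show ?thesis by blast
    qed
    have "emeasure ?M (\<Union>n. {- real n<..real n}) = (SUP n. emeasure ?M {- real n<..real n})"
      by (rule SUP_emeasure_incseq[symmetric]) (auto simp: incseq_def)
    also have "\<dots> \<le> ennreal B"
    proof (rule SUP_least)
      fix n :: nat
      show "emeasure ?M {- real n<..real n} \<le> ennreal B"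
        using Fb[of "real n"] Fb[of "- real n"] by (simp add: Ioc ennreal_leI)
    qed
    finally have "emeasure ?M UNIV \<le> ennreal B" unfolding U .
    then show "emeasure ?M (space ?M) \<noteq> \<infinity>"
      using ennreal_neq_top[of B] top_unique[of "ennreal B"] by auto
  qed
  interpret finite_measure ?M by (rule fin)
  have mIoc: "measure ?M {a<..b} = ?F b - ?F a" if "a \<le> b" for a b
    using Ioc[OF that] Fmono[OF that] by (simp add: measure_def)
  show ?thesis
  proof (intro exI[of _ ?M] conjI fin setsM allI impI)
    fix a b h :: real assume h: "0 < h" "a + h \<le> b"
    have cT: "continuous_on UNIV (trapezoid h a b)"
      using trapezoid_C0[of h a b] h by (simp add: C0_scalar_def)
    have T01: "0 \<le> trapezoid h a b t" "trapezoid h a b t \<le> 1" for t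
      using h trapezoid_bounds[of h a b t] by auto
    have iT: "integrable ?M (trapezoid h a b)"
      by (rule integrable_const_bound[of _ 1])
         (use T01 cT in \<open>auto intro!: borel_measurable_continuous_onI cong: measurable_cong_sets\<close>)
    have iI: "integrable ?M (indicator {c<..d} :: real \<Rightarrow> real)" for c d :: real
      by (rule integrable_real_indicator) (auto simp: less_top[symmetric])
    have "(LINT t|?M. trapezoid h a b t) \<le> (LINT t|?M. indicator {a<..b + h} t)"
    proof (rule integral_mono[OF iT iI])
      fix t
      show "trapezoid h a b t \<le> indicator {a<..b + h} t"
        using T01[of t] trapezoid_eq_0[of h a b t] h by (cases "t \<in> {a<..b + h}") auto
    qed
    also have "\<dots> = ?F (b + h) - ?F a" using h by (simp add: mIoc)
    finally have 1: "(LINT t|?M. trapezoid h a b t) \<le> ?F (b + h) - ?F a" .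
    have "(LINT t|?M. indicator {a + h<..b} t) \<le> (LINT t|?M. trapezoid h a b t)"
    proof (rule integral_mono[OF iI iT])
      fix t
      show "indicator {a + h<..b} t \<le> trapezoid h a b t"
        using T01[of t] trapezoid_eq_1[of h a t b] h by (cases "t \<in> {a + h<..b}") auto
    qed
    moreover have "(LINT t|?M. indicator {a + h<..b} t) = ?F b - ?F (a + h)" using h by (simp add: mIoc)
    ultimately have 2: "?F b - ?F (a + h) \<le> (LINT t|?M. trapezoid h a b t)" by simp
    have "?F (b + h) \<le> P (b + 2 * h)" "?F (a + h) \<le> P (a + 2 * h)" using h by (auto intro!: Fle)
    moreover have "P a \<le> ?F a" "P b \<le> ?F b" by (rule PF)+
    moreover have "P b \<le> P (b + h)" "P (b + h) \<le> P (b + 2 * h)" "P a \<le> P (a + 2 * h)" using h by (auto intro!: mono)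
    ultimately show "\<bar>(LINT t|?M. trapezoid h a b t) - (P (b + h) - P a)\<bar> \<le>
        (P (a + 2 * h) - P a) + (P (b + 2 * h) - P b)"
      using 1 2 by linarith
  qed
qed

lemma sum_two_step_differences:
  fixes V :: "nat \<Rightarrow> real"
  shows "(\<Sum>i<n. V (i + 2) - V i) = V (n + 1) + V n - V 1 - V 0"
  by (induction n) auto

context C0_functional
begin

text \<open>The errors in the previous estimates are mass under the slopes, which need not be small for a single
trapezoid. But a trapezoid is the average of \<open>n\<close> trapezoids whose slopes are \<open>n\<close> times steeper and lie
side by side, so that their errors add up to a bounded sum. The error of the average is at most
\<open>16 * B / n\<close>, hence zero.\<close>

lemma represented_on_trapezoids:
  obtains \<mu> where "\<And>h a. 0 < h \<Longrightarrow> u (trapezoid h a (a + h)) = signed_integral \<mu> (trapezoid h a (a + h))"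
proof -
  interpret neg: C0_functional "\<lambda>f. - u f" B by (rule negative)
  let ?P = "left_mass u" and ?N = "left_mass (\<lambda>f. - u f)"
  define V where "V x = ?P x + ?N x" for x
  obtain M1 where M1: "finite_measure M1" "sets M1 = sets borel"
    "\<And>a b h. 0 < h \<Longrightarrow> a + h \<le> b \<Longrightarrow>
      \<bar>(LINT t|M1. trapezoid h a b t) - (?P (b + h) - ?P a)\<bar> \<le> (?P (a + 2 * h) - ?P a) + (?P (b + 2 * h) - ?P b)"
    using stieltjes_measure[OF mono_left_mass left_mass_bounds] by auto
  obtain M2 where M2: "finite_measure M2" "sets M2 = sets borel"
    "\<And>a b h. 0 < h \<Longrightarrow> a + h \<le> b \<Longrightarrow>
      \<bar>(LINT t|M2. trapezoid h a b t) - (?N (b + h) - ?N a)\<bar> \<le> (?N (a + 2 * h) - ?N a) + (?N (b + 2 * h) - ?N b)"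
    using stieltjes_measure[OF neg.mono_left_mass neg.left_mass_bounds] by auto
  define \<mu> where "\<mu> = diff_measure M1 M2"
  have meas: "trapezoid h a b \<in> borel_measurable borel" "bounded (range (trapezoid h a b))" if "0 < h" "a \<le> b" for h a b
    using trapezoid_C0[OF that] trapezoid_bounds[OF that]
    by (auto simp: C0_scalar_def bounded_iff intro!: borel_measurable_continuous_onI)
  have close: "\<bar>u (trapezoid h a b) - signed_integral \<mu> (trapezoid h a b)\<bar> \<le>
      2 * ((V (a + 2 * h) - V a) + (V (b + 2 * h) - V b))" if h: "0 < h" "a + h \<le> b" for h a b
  proof -
    have "signed_integral \<mu> (trapezoid h a b) =
        (LINT t|M1. trapezoid h a b t) - (LINT t|M2. trapezoid h a b t)"
      unfolding \<mu>_def using h by (intro signed_integral_diff_measure M1 M2 meas) auto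
    moreover have "?P (a + h) \<le> ?P (a + 2 * h)" "?P (b + h) \<le> ?P (b + 2 * h)"
      "?N (a + h) \<le> ?N (a + 2 * h)" "?N (b + h) \<le> ?N (b + 2 * h)"
      "?P a \<le> ?P (a + h)" "?P b \<le> ?P (b + h)" "?N a \<le> ?N (a + h)" "?N b \<le> ?N (b + h)"
      using h by (auto intro!: left_mass_mono neg.left_mass_mono)
    ultimately show ?thesis
      using M1(3)[OF h] M2(3)[OF h] trapezoid_ge[OF h] neg.trapezoid_ge[OF h]
      unfolding V_def by simp
  qed
  have V: "0 \<le> V x" "V x \<le> 2 * B" for x
    using left_mass_bounds[of x] neg.left_mass_bounds[of x] by (auto simp: V_def)
  have "u (trapezoid h a (a + h)) = signed_integral \<mu> (trapezoid h a (a + h))" if h: "0 < h" for h a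
  proof -
    let ?b = "a + h"
    define D where "D = u (trapezoid h a ?b) - signed_integral \<mu> (trapezoid h a ?b)"
    \<comment> \<open>There are two sums of two-step differences of \<open>V\<close>, each at most \<open>4 * B\<close>, and every error counts
      twice, for the functional and for the measure.\<close>
    have nD: "real n * \<bar>D\<bar> \<le> 16 * B" if n: "0 < n" for n
    proof -
      let ?k = "h / real n"
      let ?T = "\<lambda>i. trapezoid ?k (a + real i * ?k) (?b + real i * ?k)"
      have k: "0 < ?k" "?k \<le> h" using h n by (auto simp: field_simps)
      have TC: "?T i \<in> C0_scalar" for i using k h by (intro trapezoid_C0) auto
      have tr: "(\<Sum>i<n. ?T i t) = real n * trapezoid h a ?b t" for t
        by (rule trapezoid_subdivide[OF h n])
      have uS: "real n * u (trapezoid h a ?b) = (\<Sum>i<n. u (?T i))"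
      proof -
        have "u (\<lambda>t. real n * trapezoid h a ?b t) = (\<Sum>i<n. u (?T i))"
          using sum[of "{..<n}" ?T, OF TC] by (simp only: tr)
        then show ?thesis using scale[OF trapezoid_C0[OF h, of a ?b], of "real n"] h by simp
      qed
      have si: "signed_integral \<mu> (\<lambda>t. \<Sum>i<m. ?T i t) = (\<Sum>i<m. signed_integral \<mu> (?T i))" for m
      proof (induction m)
        case 0
        show ?case using signed_integral_integrand_scale[of \<mu> 0 "\<lambda>_. 0"] by simp
      next
        case (Suc m)
        have "(\<lambda>t. \<Sum>i<m. ?T i t) \<in> C0_scalar" by (rule C0_scalar_sum) (rule TC)
        then have "(\<lambda>t. \<Sum>i<m. ?T i t) \<in> borel_measurable borel"
          by (auto simp: C0_scalar_def intro!: borel_measurable_continuous_onI)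
        moreover have "bounded (range (\<lambda>t. \<Sum>i<m. ?T i t))"
        proof -
          have "\<bar>\<Sum>i<m. ?T i t\<bar> \<le> (\<Sum>i<m. 1)" for t
            using trapezoid_bounds[OF k(1)] h
            by (intro order_trans[OF sum_abs] sum_mono) (simp add: abs_of_nonneg)
          then show ?thesis by (auto simp: bounded_iff)
        qed
        ultimately show ?case
          using signed_integral_integrand_add[of "\<lambda>t. \<Sum>i<m. ?T i t" "?T m" \<mu>] meas[OF k(1)] h Suc by simp
      qed
      have mS: "real n * signed_integral \<mu> (trapezoid h a ?b) = (\<Sum>i<n. signed_integral \<mu> (?T i))"
      proof -
        have "signed_integral \<mu> (\<lambda>t. real n * trapezoid h a ?b t) = (\<Sum>i<n. signed_integral \<mu> (?T i))"
          using si[of n] by (simp only: tr)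
        then show ?thesis using signed_integral_integrand_scale[of \<mu> "real n" "trapezoid h a ?b"] by simp
      qed
      define A where "A i = V (a + real i * ?k)" for i
      define C where "C i = V (?b + real i * ?k)" for i
      have "real n * \<bar>D\<bar> = \<bar>\<Sum>i<n. u (?T i) - signed_integral \<mu> (?T i)\<bar>"
        unfolding D_def sum_subtractf uS[symmetric] mS[symmetric]
        by (simp add: right_diff_distrib[symmetric] abs_mult)
      also have "\<dots> \<le> (\<Sum>i<n. 2 * ((A (i + 2) - A i) + (C (i + 2) - C i)))"
      proof (intro order_trans[OF sum_abs] sum_mono)
        fix i
        have e: "a + real i * ?k + 2 * ?k = a + real (i + 2) * ?k" "?b + real i * ?k + 2 * ?k = ?b + real (i + 2) * ?k"
          by (simp_all add: algebra_simps add_divide_distrib)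
        have "a + real i * ?k + ?k \<le> ?b + real i * ?k" using k by simp
        from close[OF k(1) this]
        show "\<bar>u (?T i) - signed_integral \<mu> (?T i)\<bar> \<le> 2 * ((A (i + 2) - A i) + (C (i + 2) - C i))"
          unfolding A_def C_def e .
      qed
      also have "\<dots> = 2 * ((A (n + 1) + A n - A 1 - A 0) + (C (n + 1) + C n - C 1 - C 0))"
        by (simp only: sum_distrib_left[symmetric] sum.distrib sum_two_step_differences)
      also have "\<dots> \<le> 16 * B"
      proof -
        have "0 \<le> A i" "A i \<le> 2 * B" "0 \<le> C i" "C i \<le> 2 * B" for i
          unfolding A_def C_def by (rule V)+
        then have "A (n + 1) + A n - A 1 - A 0 \<le> 4 * B" "C (n + 1) + C n - C 1 - C 0 \<le> 4 * B"
          by (smt (verit))+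
        then show ?thesis by simp
      qed
      finally show ?thesis .
    qed
    have "D = 0"
    proof (rule ccontr)
      assume "D \<noteq> 0"
      obtain n where n: "16 * B / \<bar>D\<bar> < real n" using reals_Archimedean2 by blast
      have "0 \<le> B" using V[of 0] by linarith
      then have "0 < n" using n \<open>D \<noteq> 0\<close> by (metis abs_ge_zero divide_nonneg_nonneg gr0I mult_nonneg_nonneg not_le of_nat_0 zero_le_numeral)
      then show False using nD[of n] n \<open>D \<noteq> 0\<close> by (simp add: field_simps)
    qed
    then show ?thesis by (simp add: D_def)
  qed
  then show thesis by (rule that)
qed

text \<open>Trapezoids with \<open>b = a + h\<close> are tent functions. Tents on an equidistant grid form a partition of unity,
so that a \<open>C0\<close> function is uniformly close to a combination of finitely many of them.\<close>

lemma riesz_representation: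
  obtains \<mu> where "\<And>f. f \<in> C0_scalar \<Longrightarrow> u f = signed_integral \<mu> f"
proof -
  obtain \<mu> where \<mu>: "\<And>h a. 0 < h \<Longrightarrow> u (trapezoid h a (a + h)) = signed_integral \<mu> (trapezoid h a (a + h))"
    using represented_on_trapezoids by blast
  note mb = C0_scalar_borel C0_scalar_bounded
  have "u f = signed_integral \<mu> f" if f: "f \<in> C0_scalar" for f
  proof (rule eq_if_arbitrarily_close)
    fix e :: real assume e: "0 < e"
    obtain d where d: "0 < d" "\<And>s t. \<bar>s - t\<bar> \<le> d \<Longrightarrow> \<bar>f s - f t\<bar> \<le> e"
      using C0_scalar_uniformly_continuous[OF f e] by blast
    \<comment> \<open>A tent \<open>trapezoid h a (a + h)\<close> has a support of length \<open>2 * h = d\<close>.\<close>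
    define h where "h = d / 2"
    have h: "0 < h" using d by (simp add: h_def)
    obtain R where R: "\<And>t. R \<le> \<bar>t\<bar> \<Longrightarrow> \<bar>f t\<bar> < e"
      using C0_scalar_small_outside[OF f e] by blast
    obtain n where n: "(\<bar>R\<bar> + h + \<bar>R\<bar>) / h < real n" using reals_Archimedean2 by blast
    \<comment> \<open>The grid starts one step to the left of \<open>- \<bar>R\<bar>\<close>, because the sum of the tents reaches \<open>1\<close> only after
      one step.\<close>
    define x where "x i = - \<bar>R\<bar> - h + real i * h" for i
    have xn: "\<bar>R\<bar> \<le> x n" using n h by (simp add: x_def field_simps)
    have xS: "x (Suc i) = x i + h" for i by (simp add: x_def algebra_simps)
    let ?T = "\<lambda>i. trapezoid h (x i) (x (Suc i))"
    define F where "F t = (\<Sum>i<n. f (x i) * ?T i t)" for t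
    have TC: "?T i \<in> C0_scalar" for i using h by (intro trapezoid_C0) (auto simp: xS)
    have FC: "F \<in> C0_scalar"
      unfolding F_def by (intro C0_scalar_sum C0_scalar_scale TC)
    have uF: "u F = (\<Sum>i<n. f (x i) * u (?T i))"
      unfolding F_def by (subst sum) (auto intro: C0_scalar_scale TC simp: scale TC)
    have sF: "signed_integral \<mu> (\<lambda>t. \<Sum>i<m. f (x i) * ?T i t) = (\<Sum>i<m. f (x i) * signed_integral \<mu> (?T i))" for m
    proof (induction m)
      case 0
      show ?case using signed_integral_integrand_scale[of \<mu> 0 "\<lambda>_. 0"] by simp
    next
      case (Suc m)
      have "(\<lambda>t. \<Sum>i<m. f (x i) * ?T i t) \<in> C0_scalar" by (intro C0_scalar_sum C0_scalar_scale TC)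
      from signed_integral_integrand_add[OF mb[OF this] mb[OF C0_scalar_scale[OF TC[of m], of "f (x m)"]], of \<mu>]
      show ?case by (simp add: Suc signed_integral_integrand_scale)
    qed
    have uFs: "u F = signed_integral \<mu> F"
      unfolding uF using sF[of n] \<mu>[OF h] by (simp add: F_def[abs_def] xS)
    have close: "\<bar>f t - F t\<bar> \<le> e" for t
    proof -
      define w where "w = (\<Sum>i<n. ?T i t)"
      have weq: "w = trapezoid h (x 0) (x n) t"
        unfolding w_def trapezoid_def using sum_lessThan_telescope'[of "\<lambda>i. ramp h (x i) t" n] by simp
      have x0n: "x 0 \<le> x n" using h by (simp add: x_def)
      have w01: "0 \<le> w" "w \<le> 1" unfolding weq using trapezoid_bounds[OF h x0n] by auto
      have T0: "0 \<le> ?T i t" for i using h by (intro trapezoid_bounds) (auto simp: xS)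
      have 1: "\<bar>f t * (1 - w)\<bar> \<le> e * (1 - w)"
      proof (cases "x 0 + h \<le> t \<and> t \<le> x n")
        case True
        then have "w = 1" unfolding weq using h by (intro trapezoid_eq_1) auto
        then show ?thesis by simp
      next
        case False
        then have "R \<le> \<bar>t\<bar>" using xn by (auto simp: x_def)
        then show ?thesis using R[of t] w01 by (simp add: abs_mult mult_right_mono)
      qed
      have "\<bar>\<Sum>i<n. (f t - f (x i)) * ?T i t\<bar> \<le> (\<Sum>i<n. e * ?T i t)"
      proof (intro order_trans[OF sum_abs] sum_mono)
        fix i
        show "\<bar>(f t - f (x i)) * ?T i t\<bar> \<le> e * ?T i t"
        proof (cases "t \<le> x i \<or> x (Suc i) + h \<le> t")
          case True
          then have "?T i t = 0" using h by (intro trapezoid_eq_0) (auto simp: xS)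
          then show ?thesis by simp
        next
          case False
          then have "\<bar>t - x i\<bar> \<le> d" using xS[of i] by (auto simp: h_def)
          from d(2)[OF this] show ?thesis using T0[of i] by (simp add: abs_mult mult_right_mono)
        qed
      qed
      then have 2: "\<bar>f t * w - F t\<bar> \<le> e * w"
        by (simp add: w_def F_def sum_distrib_left left_diff_distrib sum_subtractf)
      have "f t - F t = f t * (1 - w) + (f t * w - F t)" "e = e * (1 - w) + e * w" by (simp_all add: algebra_simps)
      then show ?thesis using 1 2 by linarith
    qed
    have D: "(\<lambda>t. f t - F t) \<in> C0_scalar" by (rule C0_scalar_diff[OF f FC])
    have "\<bar>u f - u F\<bar> \<le> B * e" using bound[OF D close] diff[OF f FC] by simp
    moreover have "\<bar>signed_integral \<mu> f - signed_integral \<mu> F\<bar> \<le> e * total_mass \<mu>"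
    proof -
      have "signed_integral \<mu> f = signed_integral \<mu> (\<lambda>t. f t - F t) + signed_integral \<mu> F"
        using signed_integral_integrand_add[OF mb[OF D] mb[OF FC], of \<mu>] by simp
      then show ?thesis using signed_integral_abs_le[OF mb(1)[OF D] close, of \<mu>] by simp
    qed
    ultimately show "\<bar>u f - signed_integral \<mu> f\<bar> \<le> e * (B + total_mass \<mu>)"
      using uFs by (simp add: algebra_simps)
  qed
  then show thesis by (rule that)
qed

end

section \<open>Continuous functions vanishing at infinity\<close>

lemma C0_component: "v \<in> C0 \<Longrightarrow> (\<lambda>x. v x $ d) \<in> C0_scalar"
  using tendsto_vec_nth[of v 0 at_infinity d] by (auto simp: C0_def C0_scalar_def intro: continuous_intros)

lemma C0_if_components:
  fixes v :: "real \<Rightarrow> real ^ 'd"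
  assumes "\<And>d. (\<lambda>x. v x $ d) \<in> C0_scalar"
  shows "v \<in> C0"
proof -
  have "continuous_on UNIV v"
    using assms by (subst continuous_on_componentwise)
      (auto simp: C0_scalar_def Basis_vec_def inner_axis)
  moreover have "(v \<longlongrightarrow> 0) at_infinity"
    by (rule vec_tendstoI) (use assms in \<open>simp add: C0_scalar_def\<close>)
  ultimately show ?thesis by (simp add: C0_def)
qed

lemma C0_bounded:
  assumes "v \<in> C0"
  shows "bounded (range v)"
proof -
  have "\<forall>d. \<exists>b. \<forall>x. \<bar>v x $ d\<bar> \<le> b"
    using C0_scalar_bounded[OF C0_component[OF assms]] by (auto simp: bounded_iff)
  then obtain b where b: "\<And>d x. \<bar>v x $ d\<bar> \<le> b d" unfolding choice_iff by blast
  have "norm (v x) \<le> sum b UNIV" for x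
    by (rule order_trans[OF norm_le_l1_cart]) (rule sum_mono, rule b)
  then show ?thesis by (auto simp: bounded_iff)
qed

lemma C0_borel: "v \<in> C0 \<Longrightarrow> v \<in> borel_measurable borel"
  by (auto simp: C0_def intro!: borel_measurable_continuous_onI)

lemma subspace_C0: "subspace C0"
  unfolding subspace_def
proof (intro conjI ballI allI)
  show "0 \<in> C0" by (simp add: C0_def zero_fun_def)
  show "f + g \<in> C0" if "f \<in> C0" "g \<in> C0" for f g :: "real \<Rightarrow> real ^ 'd"
    using that tendsto_add[of f 0 at_infinity g 0] by (auto simp: C0_def plus_fun_def intro: continuous_intros)
  show "c *\<^sub>R f \<in> C0" if "f \<in> C0" for c and f :: "real \<Rightarrow> real ^ 'd"
    using that tendsto_scaleR[of "\<lambda>_. c" c at_infinity f 0] by (auto simp: C0_def scaleR_fun_def intro: continuous_intros)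
qed

section \<open>Norms on finite-dimensional spaces\<close>

lemma norm_onD:
  assumes "norm_on V Z"
  shows "x \<in> V \<Longrightarrow> 0 \<le> Z x" "x \<in> V \<Longrightarrow> Z x = 0 \<longleftrightarrow> x = 0" "x \<in> V \<Longrightarrow> Z (c *\<^sub>R x) = \<bar>c\<bar> * Z x"
    "x \<in> V \<Longrightarrow> y \<in> V \<Longrightarrow> Z (x + y) \<le> Z x + Z y"
  using assms by (auto simp: norm_on_def)

lemma norm_on_sum_le:
  assumes Z: "norm_on V Z" and V: "subspace V" and f: "\<And>i. i \<in> S \<Longrightarrow> f i \<in> V"
  shows "Z (\<Sum>i\<in>S. f i) \<le> (\<Sum>i\<in>S. Z (f i))"
  using f
proof (induction S rule: infinite_finite_induct)
  case (insert x S)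
  have "Z (f x + (\<Sum>i\<in>S. f i)) \<le> Z (f x) + Z (\<Sum>i\<in>S. f i)"
    using insert.prems V by (intro norm_onD(4)[OF Z] subspace_sum) auto
  then show ?case using insert by force
qed (use norm_onD(2)[OF Z subspace_0[OF V]] in simp_all)

lemma norm_on_minus: "norm_on V Z \<Longrightarrow> x \<in> V \<Longrightarrow> Z (- x) = Z x"
  using norm_onD(3)[of V Z x "-1"] by simp

lemma norm_equivalent_euclidean:
  fixes Z :: "real ^ 'd \<Rightarrow> real"
  assumes Z: "norm_on UNIV Z"
  obtains c C where "0 < c" "0 < C" "\<And>x. norm x \<le> c * Z x" "\<And>x. Z x \<le> C * norm x"
proof -
  define C where "C = (\<Sum>d\<in>UNIV. Z (axis d 1)) + 1"
  have Z0: "0 \<le> Z x" for x using norm_onD(1)[OF Z] by simp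
  have C0: "0 < C" unfolding C_def by (intro add_nonneg_pos sum_nonneg Z0) auto
  have up: "Z x \<le> C * norm x" for x
  proof -
    have "Z x = Z (\<Sum>d\<in>UNIV. (x $ d) *\<^sub>R axis d 1)"
      by (rule arg_cong[of _ _ Z]) (simp add: vec_eq_iff axis_def if_distrib cong: if_cong)
    also have "\<dots> \<le> (\<Sum>d\<in>UNIV. Z ((x $ d) *\<^sub>R axis d 1))"
      by (rule norm_on_sum_le[OF Z]) (auto intro: subspace_UNIV)
    also have "\<dots> = (\<Sum>d\<in>UNIV. \<bar>x $ d\<bar> * Z (axis d 1))"
      by (simp add: norm_onD(3)[OF Z])
    also have "\<dots> \<le> (\<Sum>d\<in>UNIV. norm x * Z (axis d 1))"
      by (intro sum_mono mult_right_mono component_le_norm_cart Z0)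
    also have "\<dots> \<le> C * norm x" by (simp add: C_def sum_distrib_left[symmetric] algebra_simps)
    finally show ?thesis .
  qed
  have "\<bar>Z x - Z y\<bar> \<le> C * dist x y" for x y
  proof -
    have "Z x \<le> Z (x - y) + Z y" "Z y \<le> Z (y - x) + Z x"
      using norm_onD(4)[OF Z, of "x - y" y] norm_onD(4)[OF Z, of "y - x" x] by auto
    then show ?thesis using up[of "x - y"] up[of "y - x"] by (auto simp: dist_norm norm_minus_commute)
  qed
  then have "C-lipschitz_on UNIV Z"
    using C0 by (intro lipschitz_onI) (auto simp: dist_real_def)
  then have "continuous_on UNIV Z" by (rule lipschitz_on_continuous_on)
  then have cont: "continuous_on (sphere 0 1) Z" by (rule continuous_on_subset) simp
  have "axis undefined 1 \<in> (sphere 0 1 :: (real ^ 'd) set)" by (simp add: norm_axis_1)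
  then have "sphere 0 1 \<noteq> ({} :: (real ^ 'd) set)" by blast
  then obtain a where a: "a \<in> sphere 0 1" "\<And>x. x \<in> sphere 0 1 \<Longrightarrow> Z a \<le> Z x"
    using continuous_attains_inf[OF compact_sphere _ cont] by auto
  have "a \<noteq> 0" using a(1) by auto
  then have "0 < Z a" using Z0[of a] norm_onD(2)[OF Z, of a] by auto
  have low: "norm x \<le> (1 / Z a) * Z x" for x
  proof (cases "x = 0")
    case False
    have "Z a \<le> Z ((1 / norm x) *\<^sub>R x)" by (rule a(2)) (use False in simp)
    also have "\<dots> = Z x / norm x" by (simp add: norm_onD(3)[OF Z])
    finally show ?thesis using False \<open>0 < Z a\<close> by (simp add: field_simps)
  qed (use norm_onD(2)[OF Z, of 0] in simp)
  show thesis by (rule that[OF _ C0 low up]) (use \<open>0 < Z a\<close> in simp)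
qed

locale vector_norm =
  fixes Z :: "real ^ 'd \<Rightarrow> real"
  assumes Z: "norm_on UNIV Z"
begin

lemma nonneg: "0 \<le> Z x"
  using norm_onD(1)[OF Z] by simp

lemma zero: "Z 0 = 0"
  using norm_onD(2)[OF Z] by simp

lemma dual_bdd: "bdd_above ((\<lambda>v. w \<bullet> v) ` {v. Z v \<le> 1})"
proof -
  obtain c where c: "0 < c" "\<And>x. norm x \<le> c * Z x" using norm_equivalent_euclidean[OF Z] by metis
  have "w \<bullet> v \<le> norm w * c" if "Z v \<le> 1" for v
  proof -
    have "w \<bullet> v \<le> norm w * norm v" by (rule norm_cauchy_schwarz)
    also have "\<dots> \<le> norm w * c"
    proof (rule mult_left_mono)
      have "c * Z v \<le> c * 1" using that c(1) by (intro mult_left_mono) auto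
      then show "norm v \<le> c" using c(2)[of v] by simp
    qed simp
    finally show ?thesis .
  qed
  then show ?thesis by (auto intro!: bdd_aboveI2)
qed

lemma dual_ge: "Z v \<le> 1 \<Longrightarrow> w \<bullet> v \<le> dual_norm Z w"
  unfolding dual_norm_def by (rule cSUP_upper[OF _ dual_bdd]) simp

lemma dual_approx:
  assumes "0 < e"
  obtains v where "Z v \<le> 1" "dual_norm Z w - e < w \<bullet> v"
proof -
  have "{v. Z v \<le> 1} \<noteq> {}" using zero by (auto intro!: exI[of _ 0])
  moreover have "dual_norm Z w - e < (SUP v\<in>{v. Z v \<le> 1}. w \<bullet> v)"
    using assms by (simp add: dual_norm_def)
  ultimately show thesis
    using less_cSUP_iff[OF _ dual_bdd] that by auto
qed

lemma dual_le_norm: obtains c where "0 < c" "\<And>w. dual_norm Z w \<le> c * norm w"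
proof -
  obtain c where c: "0 < c" "\<And>x. norm x \<le> c * Z x" using norm_equivalent_euclidean[OF Z] by metis
  have "dual_norm Z w \<le> c * norm w" for w
    unfolding dual_norm_def
  proof (rule cSUP_least)
    fix v assume "v \<in> {v. Z v \<le> 1}"
    then have "c * Z v \<le> c * 1" using c(1) by (intro mult_left_mono) auto
    then have "norm v \<le> c" using c(2)[of v] by simp
    then have "norm w * norm v \<le> norm w * c" by (intro mult_left_mono) auto
    then show "w \<bullet> v \<le> c * norm w" using norm_cauchy_schwarz[of w v] by (simp add: mult.commute)
  qed (use zero in \<open>auto intro!: exI[of _ 0]\<close>)
  with c(1) show thesis by (rule that)
qed

lemma convex_unit_ball: "convex {v. Z v \<le> 1}"
proof (rule convexI)
  fix x y :: "real ^ 'd" and s t :: real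
  assume *: "x \<in> {v. Z v \<le> 1}" "y \<in> {v. Z v \<le> 1}" "0 \<le> s" "0 \<le> t" "s + t = 1"
  have "Z (s *\<^sub>R x + t *\<^sub>R y) \<le> s * Z x + t * Z y"
    using norm_onD(4)[OF Z, of "s *\<^sub>R x" "t *\<^sub>R y"] * by (simp add: norm_onD(3)[OF Z])
  also have "\<dots> \<le> s * 1 + t * 1" using * by (intro add_mono mult_left_mono) auto
  finally show "s *\<^sub>R x + t *\<^sub>R y \<in> {v. Z v \<le> 1}" using * by simp
qed

lemma bounded_unit_ball: "bounded {v. Z v \<le> 1}"
proof -
  obtain c where c: "0 < c" "\<And>x. norm x \<le> c * Z x" using norm_equivalent_euclidean[OF Z] by metis
  have "norm x \<le> c" if "Z x \<le> 1" for x
  proof -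
    have "c * Z x \<le> c * 1" using that c(1) by (intro mult_left_mono) auto
    then show ?thesis using c(2)[of x] by simp
  qed
  then show ?thesis by (auto simp: bounded_iff)
qed

end

section \<open>Duality between measures and continuous functions\<close>

definition vector_mass :: "signed_measure ^ 'd \<Rightarrow> real set \<Rightarrow> real ^ 'd" where
  "vector_mass \<mu> E = (\<chi> d. smeasure (\<mu> $ d) E)"

lemma sum_measure_partition:
  assumes "finite_measure M" "sets M = sets borel" "\<pi> \<in> finite_partitions"
  shows "(\<Sum>E\<in>\<pi>. measure M E) = measure M UNIV"
proof -
  interpret finite_measure M by fact
  have "disjoint_family_on (\<lambda>E. E) \<pi>"
    using finite_partitionsD(4)[OF assms(3)] by (auto simp: disjoint_def disjoint_family_on_def)
  moreover have "(\<lambda>E. E) ` \<pi> \<subseteq> sets M" using finite_partitionsD(2)[OF assms(3)] assms(2) by auto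
  ultimately show ?thesis
    using finite_measure_finite_Union[OF finite_partitionsD(1)[OF assms(3)], of "\<lambda>E. E"]
      finite_partitionsD(3)[OF assms(3)] by simp
qed

lemma sum_abs_partition_le:
  assumes \<pi>: "\<pi> \<in> finite_partitions"
  shows "(\<Sum>E\<in>\<pi>. \<bar>smeasure \<mu> E\<bar>) \<le> total_mass \<mu>"
proof -
  have "(\<Sum>E\<in>\<pi>. \<bar>smeasure \<mu> E\<bar>) \<le> (\<Sum>E\<in>\<pi>. measure (pos_part \<mu>) E + measure (neg_part \<mu>) E)"
  proof (rule sum_mono)
    fix E assume "E \<in> \<pi>"
    then have "smeasure \<mu> E = measure (pos_part \<mu>) E - measure (neg_part \<mu>) E"
      by (intro smeasure_eq_pos_minus_neg finite_partitionsD(2)[OF \<pi>])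
    then show "\<bar>smeasure \<mu> E\<bar> \<le> measure (pos_part \<mu>) E + measure (neg_part \<mu>) E"
      using measure_nonneg[of "pos_part \<mu>" E] measure_nonneg[of "neg_part \<mu>" E] by linarith
  qed
  also have "\<dots> = total_mass \<mu>"
    using upper_variation_props(1,3) \<pi> by (simp add: sum.distrib total_mass_def sum_measure_partition)
  finally show ?thesis .
qed

lemma measure_pairing_near_partition_sum:
  assumes v: "v \<in> C0" and \<pi>: "\<pi> \<in> finite_partitions" and near: "\<forall>E\<in>\<pi>. \<forall>x\<in>E. norm (v x - c E) \<le> e"
  shows "\<bar>measure_pairing \<mu> v - (\<Sum>E\<in>\<pi>. c E \<bullet> vector_mass \<mu> E)\<bar> \<le> e * (\<Sum>d\<in>UNIV. total_mass (\<mu> $ d))"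
proof -
  have "(\<Sum>E\<in>\<pi>. c E \<bullet> vector_mass \<mu> E) = (\<Sum>d\<in>UNIV. \<Sum>E\<in>\<pi>. c E $ d * smeasure (\<mu> $ d) E)"
    by (subst sum.swap) (simp add: inner_vec_def vector_mass_def)
  then have "\<bar>measure_pairing \<mu> v - (\<Sum>E\<in>\<pi>. c E \<bullet> vector_mass \<mu> E)\<bar> \<le>
      (\<Sum>d\<in>UNIV. \<bar>signed_integral (\<mu> $ d) (\<lambda>x. v x $ d) - (\<Sum>E\<in>\<pi>. c E $ d * smeasure (\<mu> $ d) E)\<bar>)"
    unfolding measure_pairing_def by (simp add: sum_subtractf[symmetric])
  also have "\<dots> \<le> (\<Sum>d\<in>UNIV. e * total_mass (\<mu> $ d))"
  proof (rule sum_mono, rule signed_integral_near_partition_sum)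
    fix d
    show "(\<lambda>x. v x $ d) \<in> borel_measurable borel" "bounded (range (\<lambda>x. v x $ d))"
      using C0_component[OF v] C0_scalar_borel C0_scalar_bounded by blast+
    show "\<forall>E\<in>\<pi>. \<forall>x\<in>E. \<bar>v x $ d - c E $ d\<bar> \<le> e"
      using near order_trans[OF component_le_norm_cart[of "v _ - c _" d]] by force
  qed (rule \<pi>)
  finally show ?thesis by (simp add: sum_distrib_left)
qed

text \<open>Inner regularity, with the measure of the difference instead of a supremum.\<close>

lemma inner_compact:
  fixes M :: "real measure"
  assumes M: "finite_measure M" "sets M = sets borel" and E: "E \<in> sets borel" and e: "0 < e"
  shows "\<exists>K. compact K \<and> K \<subseteq> E \<and> measure M (E - K) \<le> e"
proof -
  interpret finite_measure M by fact
  have "emeasure M E = (SUP K\<in>{K. K \<subseteq> E \<and> compact K}. emeasure M K)"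
    by (rule inner_regular[OF M(2) _ E]) simp
  then have "(SUP K\<in>{K. K \<subseteq> E \<and> compact K}. emeasure M K) = ennreal (measure M E)"
    by (simp add: emeasure_eq_measure)
  show ?thesis
  proof (rule ccontr)
    assume no: "\<not> ?thesis"
    have "emeasure M K \<le> ennreal (measure M E - e)" if K: "K \<subseteq> E" "compact K" for K
    proof -
      have Kb: "K \<in> sets borel" using K(2) by (simp add: compact_imp_closed)
      have "measure M (E - K) = measure M E - measure M K"
        using K(1) Kb E M(2) by (intro finite_measure_Diff) auto
      moreover have "e < measure M (E - K)" using no K by (meson not_le)
      ultimately have "measure M K \<le> measure M E - e" by simp
      then show ?thesis by (simp add: emeasure_eq_measure ennreal_leI)
    qed
    then have "emeasure M E \<le> ennreal (measure M E - e)"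
      unfolding \<open>emeasure M E = _\<close> by (intro SUP_least) auto
    then have "measure M E \<le> 0"
      using e by (auto simp: emeasure_eq_measure ennreal_le_iff2)
    then have "measure M E = 0" using measure_nonneg[of M E] by linarith
    then have "measure M (E - {}) \<le> e" using e by simp
    then show False using no by (meson compact_empty empty_subsetI)
  qed
qed

text \<open>Step functions with values in a convex set can be replaced, up to a small error, by
  continuous functions with values in the same set: inner regularity replaces the pieces by compact
  sets, where the step function is continuous, and Dugundji's extension theorem extends it without
  leaving the convex set. Multiplication by a cutoff keeps the values in the set, too, since it
  contains \<open>0\<close>.\<close>

lemma step_function_approx_C0:
  fixes \<mu> :: "signed_measure ^ 'd"
  assumes K: "convex K" "0 \<in> K" "bounded K" and \<pi>: "\<pi> \<in> finite_partitions"
    and w: "\<And>E. E \<in> \<pi> \<Longrightarrow> w E \<in> K" and e: "0 < e"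
  shows "\<exists>v\<in>C0. range v \<subseteq> K \<and> (\<Sum>E\<in>\<pi>. w E \<bullet> vector_mass \<mu> E) - e \<le> measure_pairing \<mu> v"
proof -
  note \<pi>D = finite_partitionsD[OF \<pi>]
  obtain b where b: "0 < b" "\<And>x. x \<in> K \<Longrightarrow> norm x \<le> b"
    using K(3) by (auto simp: bounded_pos)
  have "\<pi> \<noteq> {}" using \<pi>D(3) by auto
  then have card: "0 < real (card \<pi>)" using \<pi>D(1) by (simp add: card_gt_0_iff)
  \<comment> \<open>For each of the \<open>2 * CARD('d)\<close> parts of the components of \<open>\<mu>\<close> the error is at most
    \<open>2 * b * card \<pi> * \<eta>\<close>.\<close>
  define \<eta> where "\<eta> = e / (4 * b * card \<pi> * CARD('d))"
  have \<eta>: "0 < \<eta>" using e b card by (simp add: \<eta>_def)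
  define M where "M d s = (if s then pos_part (\<mu> $ d) else neg_part (\<mu> $ d))" for d s
  have M: "finite_measure (M d s)" "sets (M d s) = sets borel" "space (M d s) = UNIV" for d s
    by (auto simp: M_def upper_variation_props)
  have "\<forall>E\<in>\<pi>. \<exists>C. compact C \<and> C \<subseteq> E \<and> (\<forall>d s. measure (M d s) (E - C) \<le> \<eta>)"
  proof
    fix E assume "E \<in> \<pi>"
    then have E: "E \<in> sets borel" by (rule \<pi>D(2))
    have "\<forall>d s. \<exists>C. compact C \<and> C \<subseteq> E \<and> measure (M d s) (E - C) \<le> \<eta>"
      by (intro allI inner_compact M E \<eta>)
    then obtain C where C: "\<And>d s. compact (C d s)" "\<And>d s. C d s \<subseteq> E" "\<And>d s. measure (M d s) (E - C d s) \<le> \<eta>"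
      unfolding choice_iff by auto
    let ?C = "\<Union>d. \<Union>s. C d s"
    have "compact ?C" by (intro compact_UN C(1)) auto
    moreover have "measure (M d s) (E - ?C) \<le> \<eta>" for d s
    proof -
      interpret finite_measure "M d s" by (rule M)
      have "measure (M d s) (E - ?C) \<le> measure (M d s) (E - C d s)"
        by (rule finite_measure_mono) (use E C(1) M(2) in \<open>auto simp: compact_imp_closed\<close>)
      then show ?thesis using C(3)[of d s] by linarith
    qed
    ultimately show "\<exists>C. compact C \<and> C \<subseteq> E \<and> (\<forall>d s. measure (M d s) (E - C) \<le> \<eta>)"
      using UN_least[of UNIV "\<lambda>d. \<Union>s. C d s" E] UN_least[of UNIV "C _" E] C(2) by (intro exI[of _ ?C]) simp
  qed
  from bchoice[OF this] obtain C where "\<forall>E\<in>\<pi>. compact (C E) \<and> C E \<subseteq> E \<and> (\<forall>d s. measure (M d s) (E - C E) \<le> \<eta>)"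
    by (rule exE)
  then have C: "\<And>E. E \<in> \<pi> \<Longrightarrow> compact (C E)" "\<And>E. E \<in> \<pi> \<Longrightarrow> C E \<subseteq> E"
    "\<And>E d s. E \<in> \<pi> \<Longrightarrow> measure (M d s) (E - C E) \<le> \<eta>" by auto
  define g where "g x = (\<Sum>E\<in>\<pi>. indicator E x *\<^sub>R w E)" for x
  have g: "g x = w E" if "E \<in> \<pi>" "x \<in> E" for E x
    unfolding g_def by (rule sum_indicator_partition[OF \<pi> that])
  let ?S = "\<Union>E\<in>\<pi>. C E"
  have "compact ?S" by (intro compact_UN \<pi>D(1) C(1))
  have contg: "continuous_on ?S g"
  proof (rule continuous_on_closed_Union[OF \<pi>D(1)])
    fix E assume E: "E \<in> \<pi>"
    show "closed (C E)" using C(1)[OF E] by (rule compact_imp_closed)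
    have "continuous_on (C E) (\<lambda>_. w E)" by simp
    moreover have "g x = w E" if "x \<in> C E" for x using g[OF E] C(2)[OF E] that by blast
    ultimately show "continuous_on (C E) g" by (metis (no_types, lifting) continuous_on_cong)
  qed
  have gK: "g ` ?S \<subseteq> K" using g C(2) w by fastforce
  have "closedin (top_of_set UNIV) ?S" using \<open>compact ?S\<close> by (simp add: compact_imp_closed)
  moreover have "K \<noteq> {}" using K(2) by auto
  ultimately obtain v0 where v0: "continuous_on UNIV v0" "range v0 \<subseteq> K" "\<And>x. x \<in> ?S \<Longrightarrow> v0 x = g x"
    using Dugundji[OF K(1) _ _ contg gK] by blast
  obtain R where R: "0 < R" "\<And>x. x \<in> ?S \<Longrightarrow> \<bar>x\<bar> \<le> R"
    using \<open>compact ?S\<close> compact_imp_bounded bounded_pos by (metis real_norm_def)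
  define cut where "cut = trapezoid 1 (- R - 1) R"
  have cut01: "0 \<le> cut x" "cut x \<le> 1" for x using R trapezoid_bounds[of 1 "- R - 1" R x] by (auto simp: cut_def)
  have cut1: "cut x = 1" if "x \<in> ?S" for x
    using R(2)[OF that] unfolding cut_def by (intro trapezoid_eq_1) auto
  have cutC: "cut \<in> C0_scalar" unfolding cut_def using R by (intro trapezoid_C0) auto
  define v where "v x = cut x *\<^sub>R v0 x" for x
  have vK: "v x \<in> K" for x
    using convexD_alt[OF K(1), of 0 "v0 x" "cut x"] K(2) v0(2) cut01[of x] by (auto simp: v_def)
  have "v \<in> C0"
  proof (rule C0_if_components)
    fix d
    have "\<bar>v0 x $ d\<bar> \<le> b" for x using b(2)[of "v0 x"] v0(2) component_le_norm_cart[of "v0 x" d] by force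
    then have "cut x * \<bar>v0 x $ d\<bar> \<le> cut x * b" for x
      using cut01(1) by (intro mult_left_mono) auto
    then have "\<bar>v x $ d\<bar> \<le> \<bar>b * cut x\<bar>" for x
      using cut01[of x] b(1) by (simp add: v_def abs_mult mult.commute)
    moreover have "continuous_on UNIV (\<lambda>x. v x $ d)"
      using cutC v0(1) unfolding v_def C0_scalar_def by (auto intro!: continuous_intros)
    ultimately show "(\<lambda>x. v x $ d) \<in> C0_scalar"
      by (intro C0_scalar_dominated[OF C0_scalar_scale[OF cutC, of b]])
  qed
  have vg: "v x = w E" if "E \<in> \<pi>" "x \<in> C E" for E x
  proof -
    have "x \<in> ?S" using that by blast
    then have "v x = g x" by (simp add: v_def cut1 v0(3))
    moreover have "x \<in> E" using C(2)[OF that(1)] that(2) by (rule subsetD)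
    ultimately show ?thesis using g[OF that(1)] by simp
  qed
  have part: "\<bar>(LINT x|(M d s). v x $ d) - (\<Sum>E\<in>\<pi>. w E $ d * measure (M d s) E)\<bar> \<le> 2 * b * card \<pi> * \<eta>" for d s
  proof -
    interpret finite_measure "M d s" by (rule M)
    have iv: "integrable (M d s) (\<lambda>x. v x $ d)"
      by (rule integrable_bounded_borel[OF M(1,2) C0_scalar_borel C0_scalar_bounded])
         (rule C0_component[OF \<open>v \<in> C0\<close>])+
    have ii: "integrable (M d s) (indicator A :: real \<Rightarrow> real)" if "A \<in> sets borel" for A
      by (rule integrable_real_indicator) (use that M(2) in \<open>auto simp: less_top[symmetric]\<close>)
    have iw: "integrable (M d s) (\<lambda>x. \<Sum>E\<in>\<pi>. w E $ d * indicator E x)"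
      by (intro Bochner_Integration.integrable_sum integrable_mult_right ii \<pi>D(2))
    have EC: "E - C E \<in> sets borel" if "E \<in> \<pi>" for E
      using \<pi>D(2)[OF that] C(1)[OF that] by (auto simp: compact_imp_closed)
    have iE: "integrable (M d s) (\<lambda>x. \<Sum>E\<in>\<pi>. (2 * b) * indicator (E - C E) x)"
      by (intro Bochner_Integration.integrable_sum integrable_mult_right ii EC)
    have bound: "\<bar>v x $ d - (\<Sum>E\<in>\<pi>. w E $ d * indicator E x)\<bar> \<le> (\<Sum>E\<in>\<pi>. (2 * b) * indicator (E - C E) x)" for x
    proof -
      obtain E where E: "E \<in> \<pi>" "x \<in> E" using \<pi>D(3) by blast
      have "(\<Sum>E\<in>\<pi>. w E $ d * indicator E x) = g x $ d"
        by (simp add: g_def mult.commute)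
      then have "\<bar>v x $ d - (\<Sum>E\<in>\<pi>. w E $ d * indicator E x)\<bar> = \<bar>v x $ d - w E $ d\<bar>"
        using g[OF E] by simp
      also have "\<dots> \<le> (2 * b) * indicator (E - C E) x"
      proof (cases "x \<in> C E")
        case False
        have "\<bar>v x $ d\<bar> \<le> b" "\<bar>w E $ d\<bar> \<le> b"
          using b(2)[OF vK[of x]] b(2)[OF w[OF E(1)]] component_le_norm_cart[of "v x" d] component_le_norm_cart[of "w E" d]
          by auto
        then show ?thesis using False E(2) by simp
      qed (use vg[OF E(1)] in simp)
      also have "\<dots> \<le> (\<Sum>E\<in>\<pi>. (2 * b) * indicator (E - C E) x)"
        by (rule member_le_sum[OF E(1), of "\<lambda>E. (2 * b) * indicator (E - C E) x"]) (use b(1) \<pi>D(1) in auto)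
      finally show ?thesis .
    qed
    have "(LINT x|(M d s). v x $ d) - (\<Sum>E\<in>\<pi>. w E $ d * measure (M d s) E) =
        (LINT x|(M d s). v x $ d - (\<Sum>E\<in>\<pi>. w E $ d * indicator E x))"
    proof -
      have "(LINT x|(M d s). (\<Sum>E\<in>\<pi>. w E $ d * indicator E x)) = (\<Sum>E\<in>\<pi>. w E $ d * measure (M d s) E)"
        using ii \<pi>D(2) by (simp add: M(3) integrable_mult_right)
      then show ?thesis by (simp add: Bochner_Integration.integral_diff[OF iv iw])
    qed
    also have "\<bar>\<dots>\<bar> \<le> (LINT x|(M d s). (\<Sum>E\<in>\<pi>. (2 * b) * indicator (E - C E) x))"
      using iv iw iE bound by (intro order_trans[OF integral_abs_bound] integral_mono integrable_abs) auto
    also have "\<dots> = (\<Sum>E\<in>\<pi>. (2 * b) * measure (M d s) (E - C E))"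
      using ii EC by (simp add: M(3) integrable_mult_right)
    also have "\<dots> \<le> (\<Sum>E\<in>\<pi>. (2 * b) * \<eta>)"
      using C(3) b(1) by (intro sum_mono mult_left_mono) auto
    finally show ?thesis by (simp add: mult.commute mult.left_commute)
  qed
  have "\<bar>measure_pairing \<mu> v - (\<Sum>E\<in>\<pi>. w E \<bullet> vector_mass \<mu> E)\<bar> \<le> e"
  proof -
    have "(\<Sum>E\<in>\<pi>. w E \<bullet> vector_mass \<mu> E) = (\<Sum>d\<in>UNIV. \<Sum>E\<in>\<pi>. w E $ d * smeasure (\<mu> $ d) E)"
      by (subst sum.swap) (simp add: inner_vec_def vector_mass_def)
    also have "\<dots> = (\<Sum>d\<in>UNIV. (\<Sum>E\<in>\<pi>. w E $ d * measure (M d True) E) - (\<Sum>E\<in>\<pi>. w E $ d * measure (M d False) E))"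
      using \<pi>D(2) by (simp add: M_def smeasure_eq_pos_minus_neg right_diff_distrib sum_subtractf)
    finally have eq: "(\<Sum>E\<in>\<pi>. w E \<bullet> vector_mass \<mu> E) =
        (\<Sum>d\<in>UNIV. (\<Sum>E\<in>\<pi>. w E $ d * measure (M d True) E) - (\<Sum>E\<in>\<pi>. w E $ d * measure (M d False) E))" .
    have "\<bar>measure_pairing \<mu> v - (\<Sum>E\<in>\<pi>. w E \<bullet> vector_mass \<mu> E)\<bar> =
        \<bar>\<Sum>d\<in>UNIV. ((LINT x|(M d True). v x $ d) - (\<Sum>E\<in>\<pi>. w E $ d * measure (M d True) E)) -
          ((LINT x|(M d False). v x $ d) - (\<Sum>E\<in>\<pi>. w E $ d * measure (M d False) E))\<bar>"
    proof -
      have "measure_pairing \<mu> v = (\<Sum>d\<in>UNIV. (LINT x|(M d True). v x $ d) - (LINT x|(M d False). v x $ d))"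
        by (simp add: measure_pairing_def signed_integral_def M_def)
      then show ?thesis unfolding eq by (simp add: sum_subtractf)
    qed
    also have "\<dots> \<le> (\<Sum>d\<in>(UNIV :: 'd set). 2 * (2 * b * card \<pi> * \<eta>))"
    proof (intro order_trans[OF sum_abs] sum_mono)
      fix d
      show "\<bar>((LINT x|(M d True). v x $ d) - (\<Sum>E\<in>\<pi>. w E $ d * measure (M d True) E)) -
          ((LINT x|(M d False). v x $ d) - (\<Sum>E\<in>\<pi>. w E $ d * measure (M d False) E))\<bar> \<le> 2 * (2 * b * card \<pi> * \<eta>)"
        using part[of d True] part[of d False] by linarith
    qed
    also have "\<dots> = e" using b(1) card by (simp add: \<eta>_def)
    finally show ?thesis .
  qed
  then show ?thesis using \<open>v \<in> C0\<close> vK by (intro bexI[of _ v]) auto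
qed

lemma measure_pairing_add:
  assumes "v \<in> C0" "v' \<in> C0"
  shows "measure_pairing \<mu> (v + v') = measure_pairing \<mu> v + measure_pairing \<mu> v'"
  using C0_scalar_borel[OF C0_component[OF assms(1)]] C0_scalar_bounded[OF C0_component[OF assms(1)]]
    C0_scalar_borel[OF C0_component[OF assms(2)]] C0_scalar_bounded[OF C0_component[OF assms(2)]]
  by (simp add: measure_pairing_def sum.distrib signed_integral_integrand_add)

lemma measure_pairing_scale: "measure_pairing \<mu> (c *\<^sub>R v) = c * measure_pairing \<mu> v"
  by (simp add: measure_pairing_def scaleR_fun_def signed_integral_integrand_scale sum_distrib_left)

lemma measure_pairing_sum:
  assumes "\<And>i. i \<in> S \<Longrightarrow> v i \<in> C0"
  shows "measure_pairing \<mu> (\<Sum>i\<in>S. v i) = (\<Sum>i\<in>S. measure_pairing \<mu> (v i))"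
  using assms
proof (induction S rule: infinite_finite_induct)
  case (insert x S)
  have "(\<Sum>i\<in>S. v i) \<in> C0" using insert.prems by (intro subspace_sum[OF subspace_C0]) auto
  then have "measure_pairing \<mu> (v x + sum v S) = measure_pairing \<mu> (v x) + measure_pairing \<mu> (sum v S)"
    using insert.prems by (intro measure_pairing_add) auto
  then show ?case using insert by (simp only: sum.insert insertI2 not_False_eq_True)
qed (use measure_pairing_scale[of \<mu> 0 0] in simp_all)

lemma measure_pairing_add_measure:
  assumes "v \<in> C0"
  shows "measure_pairing (\<mu> + \<nu>) v = measure_pairing \<mu> v + measure_pairing \<nu> v"
  using C0_scalar_borel[OF C0_component[OF assms(1)]] C0_scalar_bounded[OF C0_component[OF assms(1)]]
  by (simp add: measure_pairing_def sum.distrib signed_integral_add)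

lemma measure_pairing_scale_measure:
  assumes "v \<in> C0"
  shows "measure_pairing (c *\<^sub>R \<mu>) v = c * measure_pairing \<mu> v"
  using C0_scalar_borel[OF C0_component[OF assms(1)]] C0_scalar_bounded[OF C0_component[OF assms(1)]]
  by (simp add: measure_pairing_def sum_distrib_left signed_integral_scaleR)

subsection \<open>The inner norm\<close>

context vector_norm
begin

lemma bdd_inner_norm: "bdd_above ((\<lambda>\<pi>. \<Sum>E\<in>\<pi>. dual_norm Z (vector_mass \<mu> E)) ` finite_partitions)"
proof -
  obtain c where c: "0 < c" "\<And>w. dual_norm Z w \<le> c * norm w" by (rule dual_le_norm) (rule that)
  show ?thesis
  proof (rule bdd_aboveI2)
    fix \<pi> assume \<pi>: "\<pi> \<in> finite_partitions"
    have "(\<Sum>E\<in>\<pi>. dual_norm Z (vector_mass \<mu> E)) \<le> (\<Sum>E\<in>\<pi>. \<Sum>d\<in>UNIV. c * \<bar>smeasure (\<mu> $ d) E\<bar>)"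
    proof (rule sum_mono)
      fix E
      have "dual_norm Z (vector_mass \<mu> E) \<le> c * (\<Sum>d\<in>UNIV. \<bar>vector_mass \<mu> E $ d\<bar>)"
        by (rule order_trans[OF c(2)]) (intro mult_left_mono norm_le_l1_cart, use c(1) in simp)
      then show "dual_norm Z (vector_mass \<mu> E) \<le> (\<Sum>d\<in>UNIV. c * \<bar>smeasure (\<mu> $ d) E\<bar>)"
        by (simp add: vector_mass_def sum_distrib_left)
    qed
    also have "\<dots> = (\<Sum>d\<in>UNIV. c * (\<Sum>E\<in>\<pi>. \<bar>smeasure (\<mu> $ d) E\<bar>))"
      by (subst sum.swap) (simp add: sum_distrib_left)
    also have "\<dots> \<le> (\<Sum>d\<in>UNIV. c * total_mass (\<mu> $ d))"
      using c(1) by (intro sum_mono mult_left_mono sum_abs_partition_le \<pi>) auto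
    finally show "(\<Sum>E\<in>\<pi>. dual_norm Z (vector_mass \<mu> E)) \<le> (\<Sum>d\<in>UNIV. c * total_mass (\<mu> $ d))" .
  qed
qed

lemma inner_norm_eq: "inner_norm (dual_norm Z) \<mu> = (SUP \<pi>\<in>finite_partitions. \<Sum>E\<in>\<pi>. dual_norm Z (vector_mass \<mu> E))"
  by (simp add: inner_norm_def vector_mass_def)

text \<open>A function in \<open>C0\<close> is uniformly close to a step function with values in its range, and for step
functions the estimate holds term by term.\<close>

lemma measure_pairing_le_inner_norm:
  assumes v: "v \<in> C0" and le: "\<And>x. Z (v x) \<le> 1"
  shows "measure_pairing \<mu> v \<le> inner_norm (dual_norm Z) \<mu>"
proof -
  let ?T = "\<Sum>d\<in>UNIV. total_mass (\<mu> $ d)"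
  have T: "0 \<le> ?T" by (intro sum_nonneg total_mass_nonneg)
  have step: "measure_pairing \<mu> v \<le> inner_norm (dual_norm Z) \<mu> + e * ?T" if e: "0 < e" for e
  proof -
    obtain \<pi> c where \<pi>: "\<pi> \<in> finite_partitions" "\<forall>E\<in>\<pi>. \<forall>x\<in>E. norm (v x - c E) \<le> e"
      "\<And>E. E \<in> \<pi> \<Longrightarrow> c E \<in> range v"
      using fine_value_partition[OF C0_borel[OF v] C0_bounded[OF v] e] by metis
    have "(\<Sum>E\<in>\<pi>. c E \<bullet> vector_mass \<mu> E) \<le> (\<Sum>E\<in>\<pi>. dual_norm Z (vector_mass \<mu> E))"
    proof (rule sum_mono)
      fix E assume "E \<in> \<pi>"
      then have "Z (c E) \<le> 1" using \<pi>(3) le by force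
      then show "c E \<bullet> vector_mass \<mu> E \<le> dual_norm Z (vector_mass \<mu> E)"
        using dual_ge[of "c E" "vector_mass \<mu> E"] by (simp add: inner_commute)
    qed
    also have "\<dots> \<le> inner_norm (dual_norm Z) \<mu>"
      unfolding inner_norm_eq by (rule cSUP_upper[OF \<pi>(1) bdd_inner_norm])
    finally show ?thesis using measure_pairing_near_partition_sum[OF v \<pi>(1,2), of \<mu>] by linarith
  qed
  show ?thesis
  proof (rule field_le_epsilon)
    fix e :: real assume "0 < e"
    have "measure_pairing \<mu> v \<le> inner_norm (dual_norm Z) \<mu> + e / (?T + 1) * ?T"
      by (rule step) (use \<open>0 < e\<close> T in simp)
    also have "e / (?T + 1) * ?T \<le> e" using \<open>0 < e\<close> T by (simp add: field_simps)
    finally show "measure_pairing \<mu> v \<le> inner_norm (dual_norm Z) \<mu> + e" by simp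
  qed
qed

text \<open>On the sets of an almost optimal partition one takes vectors that almost attain the dual norm, and
approximates the resulting step function.\<close>

lemma inner_norm_approx:
  assumes e: "0 < e"
  shows "\<exists>v\<in>C0. (\<forall>x. Z (v x) \<le> 1) \<and> inner_norm (dual_norm Z) \<mu> - e \<le> measure_pairing \<mu> v"
proof -
  have "{UNIV} \<in> finite_partitions" by (auto simp: finite_partitions_def partition_on_def)
  then have "finite_partitions \<noteq> {}" by blast
  moreover have "inner_norm (dual_norm Z) \<mu> - e / 3 < (SUP \<pi>\<in>finite_partitions. \<Sum>E\<in>\<pi>. dual_norm Z (vector_mass \<mu> E))"
    using e by (simp add: inner_norm_eq)
  ultimately obtain \<pi> where \<pi>: "\<pi> \<in> finite_partitions"
    "inner_norm (dual_norm Z) \<mu> - e / 3 < (\<Sum>E\<in>\<pi>. dual_norm Z (vector_mass \<mu> E))"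
    using less_cSUP_iff[OF _ bdd_inner_norm] by blast
  note \<pi>D = finite_partitionsD[OF \<pi>(1)]
  have "\<pi> \<noteq> {}" using \<pi>D(3) by auto
  then have card: "0 < real (card \<pi>)" using \<pi>D(1) by (simp add: card_gt_0_iff)
  have "\<forall>E. \<exists>w. Z w \<le> 1 \<and> dual_norm Z (vector_mass \<mu> E) - e / 3 / card \<pi> < vector_mass \<mu> E \<bullet> w"
  proof
    fix E
    have "0 < e / 3 / card \<pi>" using e card by simp
    then show "\<exists>w. Z w \<le> 1 \<and> dual_norm Z (vector_mass \<mu> E) - e / 3 / card \<pi> < vector_mass \<mu> E \<bullet> w"
      using dual_approx by metis
  qed
  from choice[OF this] obtain w where
    w: "\<forall>E. Z (w E) \<le> 1 \<and> dual_norm Z (vector_mass \<mu> E) - e / 3 / card \<pi> < vector_mass \<mu> E \<bullet> w E" by (rule exE)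
  have "0 < e / 3" using e by simp
  then obtain v where v: "v \<in> C0" "range v \<subseteq> {v. Z v \<le> 1}"
    "(\<Sum>E\<in>\<pi>. w E \<bullet> vector_mass \<mu> E) - e / 3 \<le> measure_pairing \<mu> v"
    using step_function_approx_C0[OF convex_unit_ball _ bounded_unit_ball \<pi>(1), of w "e / 3" \<mu>] w zero by auto
  have "(\<Sum>E\<in>\<pi>. dual_norm Z (vector_mass \<mu> E)) - e / 3 = (\<Sum>E\<in>\<pi>. dual_norm Z (vector_mass \<mu> E) - e / 3 / card \<pi>)"
    using card by (simp add: sum_subtractf)
  also have "\<dots> \<le> (\<Sum>E\<in>\<pi>. w E \<bullet> vector_mass \<mu> E)"
    by (rule sum_mono) (use w in \<open>simp add: inner_commute less_imp_le\<close>)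
  finally have "inner_norm (dual_norm Z) \<mu> - e \<le> measure_pairing \<mu> v"
    using \<pi>(2) v(3) by linarith
  then show ?thesis using v(1,2) by (intro bexI[of _ v]) auto
qed

end

subsection \<open>The outer norm\<close>

lemma bdd_tv_norm: "bdd_above ((\<lambda>\<pi>. \<Sum>E\<in>\<pi>. \<bar>smeasure \<mu> E\<bar>) ` finite_partitions)"
  using sum_abs_partition_le by (rule bdd_aboveI2)

lemma tv_norm_nonneg: "0 \<le> tv_norm \<mu>"
proof -
  have "{UNIV} \<in> finite_partitions" by (auto simp: finite_partitions_def partition_on_def)
  from cSUP_upper[OF this bdd_tv_norm, of \<mu>] show ?thesis unfolding tv_norm_def by simp
qed

lemma signed_integral_le_tv_norm:
  assumes f: "f \<in> borel_measurable borel" and r: "\<And>x. \<bar>f x\<bar> \<le> r"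
  shows "signed_integral \<mu> f \<le> r * tv_norm \<mu>"
proof -
  have b: "bounded (range f)" using r by (auto simp: bounded_iff)
  have r0: "0 \<le> r" using r[of 0] by simp
  have step: "signed_integral \<mu> f \<le> r * tv_norm \<mu> + e * total_mass \<mu>" if e: "0 < e" for e
  proof -
    obtain \<pi> c where \<pi>: "\<pi> \<in> finite_partitions" "\<forall>E\<in>\<pi>. \<forall>x\<in>E. \<bar>f x - c E\<bar> \<le> e"
      "\<And>E. E \<in> \<pi> \<Longrightarrow> c E \<in> range f"
      using fine_value_partition[OF f b e] by (metis real_norm_def)
    have "(\<Sum>E\<in>\<pi>. c E * smeasure \<mu> E) \<le> (\<Sum>E\<in>\<pi>. r * \<bar>smeasure \<mu> E\<bar>)"
    proof (rule sum_mono)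
      fix E assume "E \<in> \<pi>"
      then have "\<bar>c E\<bar> \<le> r" using \<pi>(3) r by force
      then have "\<bar>c E\<bar> * \<bar>smeasure \<mu> E\<bar> \<le> r * \<bar>smeasure \<mu> E\<bar>" by (rule mult_right_mono) simp
      then show "c E * smeasure \<mu> E \<le> r * \<bar>smeasure \<mu> E\<bar>" by (simp add: abs_mult[symmetric])
    qed
    also have "\<dots> = r * (\<Sum>E\<in>\<pi>. \<bar>smeasure \<mu> E\<bar>)" by (simp add: sum_distrib_left)
    also have "\<dots> \<le> r * tv_norm \<mu>"
      unfolding tv_norm_def by (rule mult_left_mono[OF cSUP_upper[OF \<pi>(1) bdd_tv_norm] r0])
    finally show ?thesis using signed_integral_near_partition_sum[OF f b \<pi>(1,2), of \<mu>] by linarith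
  qed
  show ?thesis
  proof (rule field_le_epsilon)
    fix e :: real assume "0 < e"
    have "signed_integral \<mu> f \<le> r * tv_norm \<mu> + e / (total_mass \<mu> + 1) * total_mass \<mu>"
      by (rule step) (use \<open>0 < e\<close> total_mass_nonneg[of \<mu>] in simp)
    also have "e / (total_mass \<mu> + 1) * total_mass \<mu> \<le> e"
      using \<open>0 < e\<close> total_mass_nonneg[of \<mu>] by (simp add: field_simps)
    finally show "signed_integral \<mu> f \<le> r * tv_norm \<mu> + e" by simp
  qed
qed

text \<open>The segment of multiples of \<open>axis d 1\<close> is a convex set, so the vector-valued approximation
  specialises to one component.\<close>

lemma tv_norm_approx_C0:
  fixes \<mu> :: "signed_measure ^ 'd"
  assumes s: "0 \<le> s" and e: "0 < e"
  shows "\<exists>v\<in>C0. (\<forall>x. \<bar>v x $ d\<bar> \<le> s \<and> (\<forall>j. j \<noteq> d \<longrightarrow> v x $ j = 0)) \<and>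
    s * tv_norm (\<mu> $ d) - e \<le> measure_pairing \<mu> v"
proof -
  let ?K = "(\<lambda>t. t *\<^sub>R axis d 1) ` {- s..s} :: (real ^ 'd) set"
  have lin: "linear (\<lambda>t. t *\<^sub>R axis d 1 :: real ^ 'd)" by (rule linearI) (simp_all add: scaleR_add_left)
  have K: "convex ?K" "0 \<in> ?K" "bounded ?K"
  proof -
    show "convex ?K" by (rule convex_linear_image[OF lin]) simp
    show "0 \<in> ?K" using s by (intro image_eqI[of _ _ 0]) auto
    show "bounded ?K" by (auto simp: bounded_iff norm_axis_1 intro!: exI[of _ s])
  qed
  define e' where "e' = e / (2 * (s + 1))"
  have e': "0 < e'" "s * e' \<le> e / 2" using e s by (auto simp: e'_def field_simps)
  have "{UNIV} \<in> finite_partitions" by (auto simp: finite_partitions_def partition_on_def)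
  then have "finite_partitions \<noteq> {}" by blast
  moreover have "tv_norm (\<mu> $ d) - e' < (SUP \<pi>\<in>finite_partitions. \<Sum>E\<in>\<pi>. \<bar>smeasure (\<mu> $ d) E\<bar>)"
    using e' by (simp add: tv_norm_def)
  ultimately obtain \<pi> where \<pi>: "\<pi> \<in> finite_partitions"
    "tv_norm (\<mu> $ d) - e' < (\<Sum>E\<in>\<pi>. \<bar>smeasure (\<mu> $ d) E\<bar>)"
    using less_cSUP_iff[OF _ bdd_tv_norm] by blast
  define w where "w E = (s * sgn (smeasure (\<mu> $ d) E)) *\<^sub>R axis d (1::real)" for E
  have wK: "w E \<in> ?K" for E
    unfolding w_def using s by (intro imageI) (auto simp: sgn_if)
  obtain v where v: "v \<in> C0" "range v \<subseteq> ?K" "(\<Sum>E\<in>\<pi>. w E \<bullet> vector_mass \<mu> E) - e / 2 \<le> measure_pairing \<mu> v"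
    using step_function_approx_C0[OF K \<pi>(1), of w "e / 2" \<mu>] wK e by auto
  have "(\<Sum>E\<in>\<pi>. w E \<bullet> vector_mass \<mu> E) = s * (\<Sum>E\<in>\<pi>. \<bar>smeasure (\<mu> $ d) E\<bar>)"
    by (simp add: w_def inner_axis' vector_mass_def sum_distrib_left abs_sgn mult.commute mult.left_commute)
  moreover have "s * (tv_norm (\<mu> $ d) - e') \<le> s * (\<Sum>E\<in>\<pi>. \<bar>smeasure (\<mu> $ d) E\<bar>)"
    using s \<pi>(2) by (intro mult_left_mono) auto
  ultimately have "s * tv_norm (\<mu> $ d) - e \<le> measure_pairing \<mu> v"
    using v(3) e'(2) by (simp add: right_diff_distrib)
  moreover have "\<bar>v x $ d\<bar> \<le> s \<and> (\<forall>j. j \<noteq> d \<longrightarrow> v x $ j = 0)" for x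
  proof -
    obtain t where "t \<in> {- s..s}" "v x = t *\<^sub>R axis d 1" using v(2) by blast
    then show ?thesis by (auto simp: axis_def)
  qed
  ultimately show ?thesis using v(1) by blast
qed

lemma C0_sup_upper:
  fixes v :: "real \<Rightarrow> real ^ 'd"
  assumes "v \<in> C0"
  shows "\<bar>v x $ d\<bar> \<le> (SUP x. \<bar>v x $ d\<bar>)"
proof -
  have "bounded (range (\<lambda>x. v x $ d))" by (rule C0_scalar_bounded[OF C0_component[OF assms]])
  then have "bdd_above (range (\<lambda>x. \<bar>v x $ d\<bar>))" by (auto simp: bounded_iff bdd_above_def)
  then show ?thesis by (rule cSUP_upper[OF UNIV_I])
qed

context vector_norm
begin

lemma measure_pairing_le_outer_norm:
  assumes v: "v \<in> C0" and le: "norm_of_sup Z v \<le> 1"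
  shows "measure_pairing \<mu> v \<le> outer_norm (dual_norm Z) \<mu>"
proof -
  let ?s = "\<chi> d. SUP x. \<bar>v x $ d\<bar>" and ?t = "\<chi> d. tv_norm (\<mu> $ d)"
  have "measure_pairing \<mu> v \<le> (\<Sum>d\<in>UNIV. (SUP x. \<bar>v x $ d\<bar>) * tv_norm (\<mu> $ d))"
    unfolding measure_pairing_def
    by (intro sum_mono signed_integral_le_tv_norm C0_scalar_borel C0_component v C0_sup_upper)
  also have "\<dots> = ?t \<bullet> ?s" by (simp add: inner_vec_def mult.commute)
  also have "\<dots> \<le> dual_norm Z ?t" using le by (intro dual_ge) (simp add: norm_of_sup_def)
  finally show ?thesis by (simp add: outer_norm_def)
qed

text \<open>Let \<open>s\<close> almost attain the dual norm of the vector of total variations. The components of \<open>v\<close> are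
bounded by the numbers \<open>\<bar>s $ d\<bar>\<close> and almost attain the corresponding multiples of the total
variations. Monotonicity bounds the norm of the vector of suprema by \<open>Z s\<close>.\<close>

lemma outer_norm_approx:
  assumes mono: "monotone_norm Z" and e: "0 < e"
  shows "\<exists>v\<in>C0. norm_of_sup Z v \<le> 1 \<and> outer_norm (dual_norm Z) \<mu> - e \<le> measure_pairing \<mu> v"
proof -
  let ?t = "\<chi> d. tv_norm (\<mu> $ d)"
  have "0 < e / 2" using e by simp
  then obtain s where s: "Z s \<le> 1" "dual_norm Z ?t - e / 2 < ?t \<bullet> s" by (rule dual_approx)
  let ?e = "e / 2 / CARD('d)"
  have "0 < ?e" using e by simp
  have "\<forall>d. \<exists>v. v \<in> C0 \<and> (\<forall>x. \<bar>v x $ d\<bar> \<le> \<bar>s $ d\<bar> \<and> (\<forall>j. j \<noteq> d \<longrightarrow> v x $ j = 0)) \<and>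
      \<bar>s $ d\<bar> * tv_norm (\<mu> $ d) - ?e \<le> measure_pairing \<mu> v"
    unfolding Bex_def[symmetric] by (intro allI tv_norm_approx_C0 abs_ge_zero \<open>0 < ?e\<close>)
  from choice[OF this] obtain V where V: "\<forall>d. V d \<in> C0 \<and>
      (\<forall>x. \<bar>V d x $ d\<bar> \<le> \<bar>s $ d\<bar> \<and> (\<forall>j. j \<noteq> d \<longrightarrow> V d x $ j = 0)) \<and>
      \<bar>s $ d\<bar> * tv_norm (\<mu> $ d) - ?e \<le> measure_pairing \<mu> (V d)" by (rule exE)
  define v where "v = (\<Sum>d\<in>UNIV. V d)"
  have "v \<in> C0" unfolding v_def using V by (intro subspace_sum[OF subspace_C0]) auto
  have sum_apply: "(\<Sum>d\<in>S. V d) x $ j = (\<Sum>d\<in>S. V d x $ j)" for S x j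
    by (induction S rule: infinite_finite_induct) auto
  have comp: "v x $ j = V j x $ j" for x j
  proof -
    have "v x $ j = (\<Sum>d\<in>UNIV. if d = j then V j x $ j else 0)"
      unfolding v_def sum_apply using V by (intro sum.cong) auto
    then show ?thesis by simp
  qed
  have sup: "\<bar>SUP x. \<bar>v x $ j\<bar>\<bar> \<le> \<bar>s $ j\<bar>" for j
  proof -
    have "(SUP x. \<bar>v x $ j\<bar>) \<le> \<bar>s $ j\<bar>" by (rule cSUP_least) (use V comp in auto)
    moreover have "0 \<le> (SUP x. \<bar>v x $ j\<bar>)" using C0_sup_upper[OF \<open>v \<in> C0\<close>, of 0 j] by linarith
    ultimately show ?thesis by simp
  qed
  have "norm_of_sup Z v \<le> Z s"
    unfolding norm_of_sup_def using mono sup by (simp add: monotone_norm_def)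
  moreover have "outer_norm (dual_norm Z) \<mu> - e \<le> measure_pairing \<mu> v"
  proof -
    have "?t \<bullet> s \<le> (\<Sum>d\<in>UNIV. \<bar>s $ d\<bar> * tv_norm (\<mu> $ d))"
      unfolding inner_vec_def
    proof (rule sum_mono)
      fix d
      have "s $ d * tv_norm (\<mu> $ d) \<le> \<bar>s $ d\<bar> * tv_norm (\<mu> $ d)"
        by (intro mult_right_mono tv_norm_nonneg) simp
      then show "?t $ d \<bullet> s $ d \<le> \<bar>s $ d\<bar> * tv_norm (\<mu> $ d)" by (simp add: mult.commute)
    qed
    moreover have "(\<Sum>d\<in>UNIV. \<bar>s $ d\<bar> * tv_norm (\<mu> $ d)) - e / 2 = (\<Sum>d\<in>UNIV. \<bar>s $ d\<bar> * tv_norm (\<mu> $ d) - ?e)"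
      by (simp add: sum_subtractf)
    moreover have "\<dots> \<le> (\<Sum>d\<in>UNIV. measure_pairing \<mu> (V d))" using V by (intro sum_mono) auto
    moreover have "\<dots> = measure_pairing \<mu> v" unfolding v_def using V by (intro measure_pairing_sum[symmetric]) auto
    ultimately show ?thesis using s(2) by (simp add: outer_norm_def)
  qed
  ultimately show ?thesis using s(1) \<open>v \<in> C0\<close> by (intro bexI[of _ v]) auto
qed

end

section \<open>Norms on coordinate tuples\<close>

definition unit_tuple :: "nat \<Rightarrow> nat \<Rightarrow> real" where
  "unit_tuple n = (\<lambda>i. if i = n then 1 else 0)"

lemma subspace_coord_space: "subspace (coord_space N)"
  by (auto simp: subspace_def coord_space_def scaleR_fun_def)

lemma unit_tuple_coord: "n < N \<Longrightarrow> unit_tuple n \<in> coord_space N"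
  by (auto simp: unit_tuple_def coord_space_def)

lemma sum_fun_apply: "(\<Sum>i\<in>S. f i) x = (\<Sum>i\<in>S. f i x)"
  by (induction S rule: infinite_finite_induct) auto

lemma coord_space_expand:
  assumes "a \<in> coord_space N"
  shows "a = (\<Sum>n<N. a n *\<^sub>R unit_tuple n)"
proof
  fix i
  have "(\<Sum>n<N. a n *\<^sub>R unit_tuple n) i = (\<Sum>n<N. if n = i then a i else 0)"
    unfolding sum_fun_apply by (intro sum.cong) (auto simp: scaleR_fun_def unit_tuple_def)
  also have "\<dots> = a i" using assms by (auto simp: coord_space_def)
  finally show "a i = (\<Sum>n<N. a n *\<^sub>R unit_tuple n) i" by simp
qed

locale tuple_norm =
  fixes N :: nat and Y :: "(nat \<Rightarrow> real) \<Rightarrow> real"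
  assumes Y: "norm_on (coord_space N) Y"
begin

lemma tuple_zero: "Y 0 = 0"
  using norm_onD(2)[OF Y subspace_0[OF subspace_coord_space]] by simp

lemma tuple_norm_le:
  assumes "a \<in> coord_space N"
  shows "Y a \<le> (\<Sum>n<N. \<bar>a n\<bar> * Y (unit_tuple n))"
proof -
  have "Y a = Y (\<Sum>n<N. a n *\<^sub>R unit_tuple n)" using coord_space_expand[OF assms] by simp
  also have "\<dots> \<le> (\<Sum>n<N. Y (a n *\<^sub>R unit_tuple n))"
    by (intro norm_on_sum_le[OF Y subspace_coord_space] subspace_scale[OF subspace_coord_space] unit_tuple_coord) simp
  also have "\<dots> = (\<Sum>n<N. \<bar>a n\<bar> * Y (unit_tuple n))"
    by (intro sum.cong refl norm_onD(3)[OF Y] unit_tuple_coord) simp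
  finally show ?thesis .
qed

lemma tuple_norm_diff_le:
  assumes "a \<in> coord_space N" "b \<in> coord_space N"
  shows "\<bar>Y a - Y b\<bar> \<le> (\<Sum>n<N. \<bar>a n - b n\<bar> * Y (unit_tuple n))"
proof -
  have ab: "a - b \<in> coord_space N" "b - a \<in> coord_space N"
    using assms subspace_diff[OF subspace_coord_space] by blast+
  have "Y a \<le> Y (a - b) + Y b" using norm_onD(4)[OF Y ab(1) assms(2)] by simp
  moreover have "Y b \<le> Y (b - a) + Y a" using norm_onD(4)[OF Y ab(2) assms(1)] by simp
  moreover have "Y (b - a) = Y (a - b)" using norm_on_minus[OF Y ab(1)] by simp
  ultimately show ?thesis using tuple_norm_le[OF ab(1)] by simp
qed

lemma continuous_tuple_norm: "continuous_on (coord_space N) Y"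
  unfolding continuous_on_def
proof
  fix a assume a: "a \<in> coord_space N"
  let ?F = "at a within coord_space N"
  have "((\<lambda>b. \<Sum>n<N. \<bar>b n - a n\<bar> * Y (unit_tuple n)) \<longlongrightarrow> (\<Sum>n<N. \<bar>a n - a n\<bar> * Y (unit_tuple n))) ?F"
  proof (intro tendsto_intros)
    fix n
    have "continuous_on (coord_space N) (\<lambda>b. b n)"
      by (rule continuous_on_subset[OF continuous_on_product_coordinates]) simp
    then show "((\<lambda>b. b n) \<longlongrightarrow> a n) ?F" using a by (simp add: continuous_on_def)
  qed
  then have "((\<lambda>b. \<Sum>n<N. \<bar>b n - a n\<bar> * Y (unit_tuple n)) \<longlongrightarrow> 0) ?F" by simp
  moreover have "\<forall>\<^sub>F b in ?F. norm (Y b - Y a) \<le> (\<Sum>n<N. \<bar>b n - a n\<bar> * Y (unit_tuple n))"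
    unfolding eventually_at_filter using tuple_norm_diff_le[OF _ a] by (auto intro!: always_eventually)
  ultimately have "((\<lambda>b. Y b - Y a) \<longlongrightarrow> 0) ?F" by (rule Lim_null_comparison[rotated])
  then show "(Y \<longlongrightarrow> Y a) ?F" by (rule LIM_zero_cancel)
qed

text \<open>Compactness in the product topology: for each \<open>n\<close>, the norm has a positive minimum \<open>m n\<close> on the tuples
with entries in \<open>{- 1..1}\<close> whose \<open>n\<close>-th entry has absolute value one, and every nonzero tuple can be
scaled into such a set by its largest entry.\<close>

lemma coordinate_le_tuple_norm:
  obtains c where "0 < c" "\<And>a n. a \<in> coord_space N \<Longrightarrow> n < N \<Longrightarrow> \<bar>a n\<bar> \<le> c * Y a"
proof -
  define B where "B = PiE UNIV (\<lambda>n. if n < N then {- 1..1 :: real} else {0})"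
  have "compactin (product_topology (\<lambda>_. euclidean) UNIV) B"
    unfolding B_def by (subst compactin_PiE) (auto simp: compactin_euclidean_iff)
  then have compB: "compact B" by (simp add: euclidean_product_topology compactin_euclidean_iff)
  have BN: "B \<subseteq> coord_space N"
  proof
    fix a assume "a \<in> B"
    have "a n = 0" if "N \<le> n" for n
    proof -
      have "a n \<in> (if n < N then {- 1..1} else {0})" using \<open>a \<in> B\<close> unfolding B_def by (rule PiE_mem) simp
      then show ?thesis using that by simp
    qed
    then show "a \<in> coord_space N" by (simp add: coord_space_def)
  qed
  have "\<forall>n. \<exists>m. n < N \<longrightarrow> 0 < m \<and> (\<forall>a\<in>B. \<bar>a n\<bar> = 1 \<longrightarrow> m \<le> Y a)"
  proof
    fix n
    show "\<exists>m. n < N \<longrightarrow> 0 < m \<and> (\<forall>a\<in>B. \<bar>a n\<bar> = 1 \<longrightarrow> m \<le> Y a)"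
    proof (cases "n < N")
      case n: True
      let ?S = "B \<inter> {a. \<bar>a n\<bar> = 1}"
      have "closed {a :: nat \<Rightarrow> real. \<bar>a n\<bar> = 1}"
        by (intro closed_Collect_eq continuous_intros continuous_on_product_coordinates)
      then have "compact ?S" using compB by (rule compact_Int_closed[rotated])
      moreover have "unit_tuple n \<in> ?S" using n by (auto simp: B_def unit_tuple_def PiE_iff)
      then have "?S \<noteq> {}" by blast
      moreover have "continuous_on ?S Y"
        by (rule continuous_on_subset[OF continuous_tuple_norm]) (use BN in auto)
      ultimately obtain a where a: "a \<in> ?S" "\<And>b. b \<in> ?S \<Longrightarrow> Y a \<le> Y b"
        using continuous_attains_inf by metis
      have "a \<in> coord_space N" "a \<noteq> 0" using a(1) BN by auto
      then have "0 < Y a" using norm_onD(1,2)[OF Y, of a] by auto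
      then show ?thesis using a(2) by (intro exI[of _ "Y a"]) auto
    qed simp
  qed
  from choice[OF this] obtain m where m: "\<forall>n. n < N \<longrightarrow> 0 < m n \<and> (\<forall>a\<in>B. \<bar>a n\<bar> = 1 \<longrightarrow> m n \<le> Y a)"
    by (rule exE)
  define c where "c = (\<Sum>n<N. 1 / m n) + 1"
  have pos: "0 \<le> 1 / m n" if "n < N" for n using m that by (simp add: less_imp_le)
  have c: "0 < c" unfolding c_def by (intro add_nonneg_pos sum_nonneg) (use pos in auto)
  have "\<bar>a n\<bar> \<le> c * Y a" if a: "a \<in> coord_space N" and n: "n < N" for a n
  proof -
    let ?A = "(\<lambda>i. \<bar>a i\<bar>) ` {..<N}"
    have A: "finite ?A" "?A \<noteq> {}" using n by auto
    then obtain k where k': "k < N" "\<bar>a k\<bar> = Max ?A" using Max_in[of ?A] by fastforce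
    then have k: "k < N" "\<And>i. i < N \<Longrightarrow> \<bar>a i\<bar> \<le> \<bar>a k\<bar>" using Max_ge[OF A(1)] by auto
    show ?thesis
    proof (cases "a k = 0")
      case True
      then show ?thesis using k(2)[OF n] c norm_onD(1)[OF Y a] by simp
    next
      case False
      let ?b = "(1 / \<bar>a k\<bar>) *\<^sub>R a"
      have "?b \<in> B"
        unfolding B_def
      proof (rule PiE_I)
        fix i :: nat
        show "?b i \<in> (if i < N then {- 1..1} else {0})"
        proof (cases "i < N")
          case True
          have "\<bar>a i / \<bar>a k\<bar>\<bar> \<le> 1" using k(2)[OF True] False by simp
          then have "- 1 \<le> a i / \<bar>a k\<bar>" "a i / \<bar>a k\<bar> \<le> 1" by linarith+
          then show ?thesis using True by (simp add: scaleR_fun_def)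
        qed (use a in \<open>simp add: scaleR_fun_def coord_space_def\<close>)
      qed simp
      moreover have "\<bar>?b k\<bar> = 1" using False by (simp add: scaleR_fun_def)
      ultimately have "m k \<le> Y ?b" using m k(1) by blast
      also have "Y ?b = Y a / \<bar>a k\<bar>" using norm_onD(3)[OF Y a, of "1 / \<bar>a k\<bar>"] by simp
      finally have "\<bar>a k\<bar> \<le> (1 / m k) * Y a"
        using False m k(1) by (simp add: field_simps)
      also have "\<dots> \<le> c * Y a"
      proof (rule mult_right_mono)
        have "1 / m k \<le> (\<Sum>n<N. 1 / m n)"
          by (rule member_le_sum) (use k(1) pos in auto)
        then show "1 / m k \<le> c" by (simp add: c_def)
      qed (rule norm_onD(1)[OF Y a])
      finally show ?thesis using k(2)[OF n] by linarith
    qed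
  qed
  with c show thesis by (rule that)
qed

lemma coord_dual_bdd: "bdd_above ((\<lambda>a. \<Sum>n<N. b n * a n) ` {a \<in> coord_space N. Y a \<le> 1})"
proof -
  obtain c where c: "0 < c" "\<And>a n. a \<in> coord_space N \<Longrightarrow> n < N \<Longrightarrow> \<bar>a n\<bar> \<le> c * Y a"
    by (rule coordinate_le_tuple_norm) (rule that)
  show ?thesis
  proof (rule bdd_aboveI2)
    fix a assume a: "a \<in> {a \<in> coord_space N. Y a \<le> 1}"
    show "(\<Sum>n<N. b n * a n) \<le> (\<Sum>n<N. \<bar>b n\<bar> * c)"
    proof (rule sum_mono)
      fix n assume "n \<in> {..<N}"
      then have "\<bar>a n\<bar> \<le> c * Y a" using a c(2) by simp
      also have "\<dots> \<le> c * 1" using a c(1) by (intro mult_left_mono) auto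
      finally have "\<bar>b n\<bar> * \<bar>a n\<bar> \<le> \<bar>b n\<bar> * c" by (intro mult_left_mono) auto
      then show "b n * a n \<le> \<bar>b n\<bar> * c" by (metis abs_ge_self abs_mult order_trans)
    qed
  qed
qed

lemma coord_dual_ge: "a \<in> coord_space N \<Longrightarrow> Y a \<le> 1 \<Longrightarrow> (\<Sum>n<N. b n * a n) \<le> coord_dual_norm N Y b"
  unfolding coord_dual_norm_def by (rule cSUP_upper[OF _ coord_dual_bdd]) simp

lemma coord_dual_approx:
  assumes "0 < e"
  shows "\<exists>a\<in>coord_space N. Y a \<le> 1 \<and> coord_dual_norm N Y b - e \<le> (\<Sum>n<N. b n * a n)"
proof -
  have "0 \<in> {a \<in> coord_space N. Y a \<le> 1}" using tuple_zero subspace_0[OF subspace_coord_space] by simp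
  then have ne: "{a \<in> coord_space N. Y a \<le> 1} \<noteq> {}" by blast
  have "coord_dual_norm N Y b - e < (SUP a\<in>{a \<in> coord_space N. Y a \<le> 1}. \<Sum>n<N. b n * a n)"
    using assms by (simp add: coord_dual_norm_def)
  then show ?thesis using less_cSUP_iff[OF ne coord_dual_bdd] by force
qed

end

section \<open>Two norms on \<open>C0\<close>\<close>

lemma cSUP_mult_left:
  fixes f :: "'a \<Rightarrow> real"
  assumes r: "0 \<le> r" and b: "bdd_above (range f)"
  shows "(SUP x. r * f x) = r * (SUP x. f x)"
proof (cases "r = 0")
  case False
  then have r: "0 < r" using r by simp
  have up: "r * f x \<le> r * (SUP x. f x)" for x
    using r cSUP_upper[OF UNIV_I b, of x] by simp
  have b': "bdd_above (range (\<lambda>x. r * f x))" by (rule bdd_aboveI2) (rule up)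
  have "(SUP x. f x) \<le> (SUP x. r * f x) / r"
  proof (rule cSUP_least)
    fix x
    have "r * f x \<le> (SUP x. r * f x)" by (rule cSUP_upper[OF UNIV_I b'])
    then show "f x \<le> (SUP x. r * f x) / r" using r by (simp add: field_simps)
  qed simp
  then have "r * (SUP x. f x) \<le> (SUP x. r * f x)" using r by (simp add: field_simps)
  moreover have "(SUP x. r * f x) \<le> r * (SUP x. f x)" by (rule cSUP_least) (auto intro: up)
  ultimately show ?thesis by simp
qed simp

text \<open>What the two choices of the norm on \<open>C0\<close> have in common: they are equivalent to the uniform
  norm, and \<open>nM\<close> is the dual norm on measures.\<close>

locale C0_norm =
  fixes nC :: "(real \<Rightarrow> real ^ 'd) \<Rightarrow> real" and nM :: "signed_measure ^ 'd \<Rightarrow> real" and c C :: real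
  assumes nC: "norm_on C0 nC"
    and c: "0 < c" and lower: "v \<in> C0 \<Longrightarrow> norm (v x) \<le> c * nC v"
    and C: "0 < C" and upper: "v \<in> C0 \<Longrightarrow> (\<And>x. norm (v x) \<le> r) \<Longrightarrow> nC v \<le> C * r"
    and dual_le: "v \<in> C0 \<Longrightarrow> nC v \<le> 1 \<Longrightarrow> measure_pairing \<mu> v \<le> nM \<mu>"
    and dual_approx: "0 < e \<Longrightarrow> \<exists>v\<in>C0. nC v \<le> 1 \<and> nM \<mu> - e \<le> measure_pairing \<mu> v"

context vector_norm
begin

lemma bdd_Z_C0: "v \<in> C0 \<Longrightarrow> bdd_above (range (\<lambda>x. Z (v x)))"
proof -
  assume "v \<in> C0"
  then obtain b where b: "\<And>x. norm (v x) \<le> b" using C0_bounded by (auto simp: bounded_iff)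
  obtain c C where C: "0 < C" "\<And>x. Z x \<le> C * norm x" using norm_equivalent_euclidean[OF Z] by metis
  show ?thesis
    using order_trans[OF C(2) mult_left_mono[OF b less_imp_le[OF C(1)]]] by (rule bdd_aboveI2)
qed

lemma le_sup_of_norm: "v \<in> C0 \<Longrightarrow> Z (v x) \<le> sup_of_norm Z v"
  unfolding sup_of_norm_def by (rule cSUP_upper[OF UNIV_I bdd_Z_C0])

lemma C0_norm_sup_of_norm: "\<exists>c C. C0_norm (sup_of_norm Z) (inner_norm (dual_norm Z)) c C"
proof -
  obtain c C where cC: "0 < c" "0 < C" "\<And>x. norm x \<le> c * Z x" "\<And>x. Z x \<le> C * norm x"
    using norm_equivalent_euclidean[OF Z] by metis
  have lower: "norm (v x) \<le> c * sup_of_norm Z v" if "v \<in> C0" for v x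
    using cC(3)[of "v x"] mult_left_mono[OF le_sup_of_norm[OF that, of x] less_imp_le[OF cC(1)]] by linarith
  have nn: "0 \<le> sup_of_norm Z v" if "v \<in> C0" for v
    using le_sup_of_norm[OF that, of 0] nonneg[of "v 0"] by linarith
  have "C0_norm (sup_of_norm Z) (inner_norm (dual_norm Z)) c C"
  proof
    show "norm_on C0 (sup_of_norm Z)"
      unfolding norm_on_def
    proof (intro conjI ballI allI)
      show "0 \<le> sup_of_norm Z v" if "v \<in> C0" for v using nn[OF that] .
      show "sup_of_norm Z v = 0 \<longleftrightarrow> v = 0" if v: "v \<in> C0" for v
      proof
        assume "sup_of_norm Z v = 0"
        then show "v = 0" using lower[OF v] by (auto simp: fun_eq_iff)
      qed (simp add: sup_of_norm_def zero)
      show "sup_of_norm Z (r *\<^sub>R v) = \<bar>r\<bar> * sup_of_norm Z v" if v: "v \<in> C0" for r v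
        using cSUP_mult_left[OF _ bdd_Z_C0[OF v], of "\<bar>r\<bar>"]
        by (simp add: sup_of_norm_def scaleR_fun_def norm_onD(3)[OF Z])
      show "sup_of_norm Z (v + w) \<le> sup_of_norm Z v + sup_of_norm Z w" if "v \<in> C0" "w \<in> C0" for v w
        unfolding sup_of_norm_def[of Z "v + w"]
      proof (rule cSUP_least)
        fix x
        have "Z (v x + w x) \<le> Z (v x) + Z (w x)" by (intro norm_onD(4)[OF Z]) auto
        then show "Z ((v + w) x) \<le> sup_of_norm Z v + sup_of_norm Z w"
          using le_sup_of_norm[OF that(1), of x] le_sup_of_norm[OF that(2), of x] by simp
      qed simp
    qed
    show "sup_of_norm Z v \<le> C * r" if "v \<in> C0" "\<And>x. norm (v x) \<le> r" for v r
      unfolding sup_of_norm_def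
    proof (rule cSUP_least)
      fix x
      show "Z (v x) \<le> C * r"
        using cC(4)[of "v x"] mult_left_mono[OF that(2)[of x] less_imp_le[OF cC(2)]] by linarith
    qed simp
    show "measure_pairing \<mu> v \<le> inner_norm (dual_norm Z) \<mu>" if "v \<in> C0" "sup_of_norm Z v \<le> 1" for \<mu> v
      by (intro measure_pairing_le_inner_norm that order_trans[OF le_sup_of_norm])
    show "\<exists>v\<in>C0. sup_of_norm Z v \<le> 1 \<and> inner_norm (dual_norm Z) \<mu> - e \<le> measure_pairing \<mu> v"
      if e: "0 < e" for e \<mu>
    proof -
      obtain v where v: "v \<in> C0" "\<And>x. Z (v x) \<le> 1" "inner_norm (dual_norm Z) \<mu> - e \<le> measure_pairing \<mu> v"
        using inner_norm_approx[OF e] by blast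
      have "sup_of_norm Z v \<le> 1" unfolding sup_of_norm_def by (rule cSUP_least) (auto simp: v(2))
      then show ?thesis using v by blast
    qed
  qed (use cC lower in auto)
  then show ?thesis by blast
qed

lemma C0_norm_norm_of_sup:
  assumes mono: "monotone_norm Z"
  shows "\<exists>c C. C0_norm (norm_of_sup Z) (outer_norm (dual_norm Z)) c C"
proof -
  obtain c C where cC: "0 < c" "0 < C" "\<And>x. norm x \<le> c * Z x" "\<And>x. Z x \<le> C * norm x"
    using norm_equivalent_euclidean[OF Z] by metis
  define S :: "(real \<Rightarrow> real ^ 'd) \<Rightarrow> real ^ 'd" where "S v = (\<chi> d. SUP x. \<bar>v x $ d\<bar>)" for v
  have nZ: "norm_of_sup Z v = Z (S v)" for v by (simp add: norm_of_sup_def S_def)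
  have bdd: "bdd_above (range (\<lambda>x. \<bar>v x $ d\<bar>))" if "v \<in> C0" for v :: "real \<Rightarrow> real ^ 'd" and d
    using C0_scalar_bounded[OF C0_component[OF that, of d]] by (auto simp: bounded_iff bdd_above_def)
  have S_ge: "\<bar>v x $ d\<bar> \<le> S v $ d" if "v \<in> C0" for v x d
    using C0_sup_upper[OF that] by (simp add: S_def)
  have S_nn: "0 \<le> S v $ d" if "v \<in> C0" for v d
    using S_ge[OF that, of 0 d] by linarith
  have S_le: "S v $ d \<le> r" if "\<And>x. \<bar>v x $ d\<bar> \<le> r" for v d r
    unfolding S_def by (simp, rule cSUP_least) (auto simp: that)
  have lower: "norm (v x) \<le> c * norm_of_sup Z v" if v: "v \<in> C0" for v x
  proof -
    have "norm (v x) \<le> norm (S v)"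
      by (rule norm_le_componentwise_cart) (use S_ge[OF v] S_nn[OF v] in simp)
    then show ?thesis using cC(3)[of "S v"] by (simp add: nZ)
  qed
  have "C0_norm (norm_of_sup Z) (outer_norm (dual_norm Z)) c (C * CARD('d))"
  proof
    show "norm_on C0 (norm_of_sup Z)"
      unfolding norm_on_def
    proof (intro conjI ballI allI)
      show "0 \<le> norm_of_sup Z v" for v by (simp add: nZ nonneg)
      show "norm_of_sup Z v = 0 \<longleftrightarrow> v = 0" if v: "v \<in> C0" for v
      proof
        assume "norm_of_sup Z v = 0"
        then show "v = 0" using lower[OF v] by (auto simp: fun_eq_iff)
      next
        assume "v = 0"
        then have "S v = 0" by (simp add: S_def vec_eq_iff)
        then show "norm_of_sup Z v = 0" by (simp add: nZ zero)
      qed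
      show "norm_of_sup Z (r *\<^sub>R v) = \<bar>r\<bar> * norm_of_sup Z v" if v: "v \<in> C0" for r v
      proof -
        have "S (r *\<^sub>R v) = \<bar>r\<bar> *\<^sub>R S v"
          using cSUP_mult_left[OF _ bdd[OF v], of "\<bar>r\<bar>"]
          by (simp add: S_def vec_eq_iff scaleR_fun_def abs_mult)
        then show ?thesis by (simp add: nZ norm_onD(3)[OF Z])
      qed
      show "norm_of_sup Z (v + w) \<le> norm_of_sup Z v + norm_of_sup Z w" if vw: "v \<in> C0" "w \<in> C0" for v w
      proof -
        have "S (v + w) $ d \<le> (S v + S w) $ d" for d
        proof (rule S_le)
          fix x
          show "\<bar>(v + w) x $ d\<bar> \<le> (S v + S w) $ d"
            using S_ge[OF vw(1), of x d] S_ge[OF vw(2), of x d] by simp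
        qed
        moreover have "0 \<le> S (v + w) $ d" for d
          by (rule S_nn) (use vw subspace_add[OF subspace_C0] in blast)
        ultimately have "\<bar>S (v + w) $ d\<bar> \<le> \<bar>(S v + S w) $ d\<bar>" for d
          by (smt (verit))
        then have "Z (S (v + w)) \<le> Z (S v + S w)" using mono by (simp add: monotone_norm_def)
        also have "\<dots> \<le> Z (S v) + Z (S w)" by (intro norm_onD(4)[OF Z]) auto
        finally show ?thesis by (simp add: nZ)
      qed
    qed
    show "norm_of_sup Z v \<le> C * CARD('d) * r" if v: "v \<in> C0" "\<And>x. norm (v x) \<le> r" for v r
    proof -
      have "norm (S v) \<le> (\<Sum>d\<in>UNIV. \<bar>S v $ d\<bar>)" by (rule norm_le_l1_cart)
      also have "\<dots> \<le> (\<Sum>d\<in>(UNIV :: 'd set). r)"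
      proof (rule sum_mono)
        fix d
        have "S v $ d \<le> r" by (rule S_le) (rule order_trans[OF component_le_norm_cart v(2)])
        then show "\<bar>S v $ d\<bar> \<le> r" using S_nn[OF v(1), of d] by simp
      qed
      finally have "C * norm (S v) \<le> C * (CARD('d) * r)" using cC(2) by (intro mult_left_mono) auto
      then show ?thesis using cC(4)[of "S v"] by (simp add: nZ mult.assoc)
    qed
    show "0 < C * CARD('d)" using cC(2) by simp
  qed (use cC lower measure_pairing_le_outer_norm outer_norm_approx[OF mono] in auto)
  then show ?thesis by blast
qed

end

section \<open>Riesz representation for vector-valued functions\<close>

lemma linear_map_on_sum:
  assumes u: "linear_map_on V u" and V: "subspace V" and f: "\<And>i. i \<in> S \<Longrightarrow> f i \<in> V"
  shows "u (\<Sum>i\<in>S. f i) = (\<Sum>i\<in>S. u (f i))"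
  using f
proof (induction S rule: infinite_finite_induct)
  case (insert x S)
  have "u (f x + sum f S) = u (f x) + u (sum f S)"
    using u insert.prems subspace_sum[OF V, of S f] by (auto simp: linear_map_on_def)
  then show ?case using insert by simp
next
  case empty
  have "u (0 *\<^sub>R 0) = 0 *\<^sub>R u 0" using u subspace_0[OF V] unfolding linear_map_on_def by blast
  then show ?case by simp
next
  case (infinite A)
  have "u (0 *\<^sub>R 0) = 0 *\<^sub>R u 0" using u subspace_0[OF V] unfolding linear_map_on_def by blast
  then show ?case using infinite by simp
qed

lemma C0_axis: "f \<in> C0_scalar \<Longrightarrow> (\<lambda>x. f x *\<^sub>R axis d 1 :: real ^ 'd) \<in> C0"
proof (rule C0_if_components)
  fix e assume "f \<in> C0_scalar"
  then show "(\<lambda>x. (f x *\<^sub>R axis d 1 :: real ^ 'd) $ e) \<in> C0_scalar"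
    by (cases "e = d") (auto simp: axis_def C0_scalar_def)
qed

lemma vector_riesz_representation:
  fixes u :: "(real \<Rightarrow> real ^ 'd) \<Rightarrow> real"
  assumes u: "linear_map_on C0 u" and bound: "\<And>v r. v \<in> C0 \<Longrightarrow> (\<And>x. norm (v x) \<le> r) \<Longrightarrow> \<bar>u v\<bar> \<le> B * r"
  shows "\<exists>\<mu>. \<forall>v\<in>C0. u v = measure_pairing \<mu> v"
proof -
  have "\<forall>d. \<exists>\<mu>. \<forall>f\<in>C0_scalar. u (\<lambda>x. f x *\<^sub>R axis d 1) = signed_integral \<mu> f"
  proof
    fix d :: 'd
    interpret C0_functional "\<lambda>f. u (\<lambda>x. f x *\<^sub>R axis d 1)" B
    proof
      fix f g :: "real \<Rightarrow> real" and r s :: real assume f: "f \<in> C0_scalar"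
      show "\<bar>u (\<lambda>x. f x *\<^sub>R axis d 1)\<bar> \<le> B * r" if "\<And>t. \<bar>f t\<bar> \<le> r"
        by (rule bound[OF C0_axis[OF f]]) (simp add: that norm_axis_1)
      have "(\<lambda>x. (s * f x) *\<^sub>R axis d 1) = s *\<^sub>R (\<lambda>x. f x *\<^sub>R axis d (1::real))"
        by (simp add: scaleR_fun_def fun_eq_iff)
      then show "u (\<lambda>x. (s * f x) *\<^sub>R axis d 1) = s * u (\<lambda>x. f x *\<^sub>R axis d 1)"
        using u C0_axis[OF f, of d] by (simp add: linear_map_on_def)
      assume g: "g \<in> C0_scalar"
      have "(\<lambda>x. (f x + g x) *\<^sub>R axis d 1) = (\<lambda>x. f x *\<^sub>R axis d (1::real)) + (\<lambda>x. g x *\<^sub>R axis d 1)"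
        by (simp add: plus_fun_def fun_eq_iff scaleR_add_left)
      then show "u (\<lambda>x. (f x + g x) *\<^sub>R axis d 1) = u (\<lambda>x. f x *\<^sub>R axis d 1) + u (\<lambda>x. g x *\<^sub>R axis d 1)"
        using u C0_axis[OF f, of d] C0_axis[OF g, of d] by (simp only: linear_map_on_def)
    qed
    obtain \<mu> where "\<And>f. f \<in> C0_scalar \<Longrightarrow> u (\<lambda>x. f x *\<^sub>R axis d 1) = signed_integral \<mu> f"
      by (rule riesz_representation) (rule that)
    then show "\<exists>\<mu>. \<forall>f\<in>C0_scalar. u (\<lambda>x. f x *\<^sub>R axis d 1) = signed_integral \<mu> f" by blast
  qed
  from choice[OF this] obtain \<nu> where \<nu>: "\<forall>d. \<forall>f\<in>C0_scalar. u (\<lambda>x. f x *\<^sub>R axis d 1) = signed_integral (\<nu> d) f"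
    by (rule exE)
  have "u v = measure_pairing (\<chi> d. \<nu> d) v" if v: "v \<in> C0" for v
  proof -
    have "v = (\<Sum>d\<in>UNIV. (\<lambda>x. v x $ d *\<^sub>R axis d 1))"
      by (simp add: fun_eq_iff sum_fun_apply vec_eq_iff axis_def if_distrib cong: if_cong)
    then have "u v = u (\<Sum>d\<in>UNIV. (\<lambda>x. v x $ d *\<^sub>R axis d 1))" by simp
    also have "\<dots> = (\<Sum>d\<in>UNIV. u (\<lambda>x. v x $ d *\<^sub>R axis d 1))"
      by (intro linear_map_on_sum[OF u subspace_C0] C0_axis C0_component v)
    also have "\<dots> = measure_pairing (\<chi> d. \<nu> d) v"
      unfolding measure_pairing_def using \<nu> C0_component[OF v] by simp
    finally show ?thesis .
  qed
  then show ?thesis by blast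
qed

text \<open>Point evaluation is a bounded functional on \<open>C0\<close>, so the Riesz theorem provides the Dirac measures.\<close>

lemma dirac_pairing:
  fixes x :: real and d :: "'d::finite"
  shows "\<exists>\<mu> :: signed_measure ^ 'd. \<forall>v\<in>C0. v x $ d = measure_pairing \<mu> v"
proof (rule vector_riesz_representation[where u = "\<lambda>v. v x $ d" and B = 1])
  show "linear_map_on C0 (\<lambda>v :: real \<Rightarrow> real ^ 'd. v x $ d)"
    by (simp add: linear_map_on_def scaleR_fun_def)
  fix v :: "real \<Rightarrow> real ^ 'd" and r assume "\<And>x. norm (v x) \<le> r"
  then show "\<bar>v x $ d\<bar> \<le> 1 * r" using component_le_norm_cart[of "v x" d] by (simp add: order_trans)
qed

text \<open>A measure that annihilates \<open>C0\<close> annihilates the test functions, so it vanishes as a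
  distribution.\<close>

lemma vmeasure_0_if_pairing_0:
  fixes \<mu> :: "signed_measure ^ 'd"
  assumes "\<And>v. v \<in> C0 \<Longrightarrow> measure_pairing \<mu> v = 0"
  shows "\<mu> = 0"
proof -
  have "signed_integral (\<mu> $ d) (test_apply \<psi>) = 0" for d \<psi>
  proof -
    obtain a b where "\<And>x. x \<notin> {a<..<b} \<Longrightarrow> test_apply \<psi> x = 0" using test_apply_support by blast
    then have "test_apply \<psi> \<in> C0_scalar"
      by (intro C0_scalarI_support[of _ a b] continuous_test_apply) auto
    then have "measure_pairing \<mu> (\<lambda>x. test_apply \<psi> x *\<^sub>R axis d 1) = 0"
      by (intro assms C0_axis)
    moreover have "signed_integral (\<mu> $ e) (\<lambda>x. (test_apply \<psi> x *\<^sub>R axis d 1 :: real ^ 'd) $ e) =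
        (if e = d then signed_integral (\<mu> $ d) (test_apply \<psi>) else 0)" for e
      using signed_integral_integrand_scale[of "\<mu> $ e" 0 "\<lambda>_. 0"] by (simp add: axis_def)
    ultimately show ?thesis by (simp add: measure_pairing_def)
  qed
  then have "dist_of_vmeasure \<mu> = dist_of_vmeasure 0"
    using linear_0[OF linear_dist_of_vmeasure]
    by (simp add: dist_of_vmeasure_def vec_eq_iff dist_apply_inject[symmetric] dist_of_measure.rep_eq
        zero_distribution.rep_eq linear_0[OF linear_dist_of_measure] fun_eq_iff)
  then show ?thesis by (rule injD[OF inj_dist_of_vmeasure])
qed

section \<open>The predual\<close>

lemma C0_closed [simp]:
  "0 \<in> C0" "v \<in> C0 \<Longrightarrow> w \<in> C0 \<Longrightarrow> v + w \<in> C0" "v \<in> C0 \<Longrightarrow> r *\<^sub>R v \<in> C0"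
  "v \<in> C0 \<Longrightarrow> w \<in> C0 \<Longrightarrow> v - w \<in> C0" "v \<in> C0 \<Longrightarrow> - v \<in> C0"
  by (fact subspace_0[OF subspace_C0] subspace_add[OF subspace_C0] subspace_scale[OF subspace_C0]
      subspace_diff[OF subspace_C0] subspace_neg[OF subspace_C0])+

lemma coord_space_closed [simp]:
  "0 \<in> coord_space N" "a \<in> coord_space N \<Longrightarrow> b \<in> coord_space N \<Longrightarrow> a + b \<in> coord_space N"
  "a \<in> coord_space N \<Longrightarrow> r *\<^sub>R a \<in> coord_space N"
  "a \<in> coord_space N \<Longrightarrow> b \<in> coord_space N \<Longrightarrow> a - b \<in> coord_space N"
  "a \<in> coord_space N \<Longrightarrow> - a \<in> coord_space N"
  by (fact subspace_0[OF subspace_coord_space] subspace_add[OF subspace_coord_space]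
      subspace_scale[OF subspace_coord_space] subspace_diff[OF subspace_coord_space]
      subspace_neg[OF subspace_coord_space])+

lemma linear_pairing: "linear (\<lambda>f. pairing f \<psi>)"
  by (rule linearI)
     (simp_all add: pairing_def plus_distribution.rep_eq scaleR_distribution.rep_eq sum.distrib sum_distrib_left)

locale native_setting =
  fixes L :: "'d::finite mdo" and N :: nat and p :: "nat \<Rightarrow> distribution ^ 'd" and \<phi> :: "nat \<Rightarrow> test_fun ^ 'd"
  assumes det: "det L \<noteq> 0" and adm: "admissible_system L N p \<phi>"
begin

abbreviation density_of :: "distribution ^ 'd \<Rightarrow> signed_measure ^ 'd" where
  "density_of f \<equiv> inv dist_of_vmeasure (mdo_apply L f)"

lemma dist_of_density: "f \<in> native_space L \<Longrightarrow> dist_of_vmeasure (density_of f) = mdo_apply L f"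
  by (auto simp: native_space_def)

lemma subspace_native_space: "subspace (native_space L)"
proof -
  have "subspace (range (dist_of_vmeasure :: signed_measure ^ 'd \<Rightarrow> _))"
    by (rule linear_subspace_image[OF linear_dist_of_vmeasure subspace_UNIV])
  from linear_subspace_vimage[OF linear_mdo_apply this]
  show ?thesis by (simp add: native_space_def vimage_def)
qed

lemma density_add:
  assumes "f \<in> native_space L" "g \<in> native_space L"
  shows "density_of (f + g) = density_of f + density_of g"
proof -
  have "dist_of_vmeasure (density_of f + density_of g) = mdo_apply L (f + g)"
    using assms by (simp add: linear_add[OF linear_dist_of_vmeasure] linear_add[OF linear_mdo_apply] dist_of_density)
  then show ?thesis by (metis inv_dist_of_vmeasure)
qed

lemma density_scaleR:
  assumes "f \<in> native_space L"
  shows "density_of (r *\<^sub>R f) = r *\<^sub>R density_of f"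
proof -
  have "dist_of_vmeasure (r *\<^sub>R density_of f) = mdo_apply L (r *\<^sub>R f)"
    using assms by (simp add: linear_scale[OF linear_dist_of_vmeasure] linear_scale[OF linear_mdo_apply] dist_of_density)
  then show ?thesis by (metis inv_dist_of_vmeasure)
qed

lemma biorthogonal: "n < N \<Longrightarrow> m < N \<Longrightarrow> pairing (p n) (\<phi> m) = (if m = n then 1 else 0)"
  using adm by (auto simp: admissible_system_def)

lemma p_null: "n < N \<Longrightarrow> mdo_apply L (p n) = 0"
proof -
  assume "n < N"
  then have "p n \<in> span (p ` {..<N})" by (intro span_base) simp
  then show ?thesis using adm by (simp add: admissible_system_def null_space_def)
qed

lemma pairing_combination:
  assumes "m < N"
  shows "pairing (\<Sum>n<N. c n *\<^sub>R p n) (\<phi> m) = c m"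
proof -
  have "pairing (\<Sum>n<N. c n *\<^sub>R p n) (\<phi> m) = (\<Sum>n<N. c n * pairing (p n) (\<phi> m))"
    by (simp add: linear_sum[OF linear_pairing] linear_scale[OF linear_pairing])
  also have "\<dots> = (\<Sum>n<N. if n = m then c m else 0)"
    using biorthogonal assms by (intro sum.cong) auto
  finally show ?thesis using assms by simp
qed

lemma native_eq_0:
  assumes "mdo_apply L f = 0" "\<And>n. n < N \<Longrightarrow> pairing f (\<phi> n) = 0"
  shows "f = 0"
proof -
  have "f \<in> span (p ` {..<N})"
    using assms(1) adm by (simp add: admissible_system_def null_space_def)
  then obtain c where "f = (\<Sum>q\<in>p ` {..<N}. c q *\<^sub>R q)" by (auto simp: span_finite)
  also have "\<dots> = (\<Sum>n<N. c (p n) *\<^sub>R p n)"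
    using adm by (subst sum.reindex) (auto simp: admissible_system_def)
  finally have f: "f = (\<Sum>n<N. c (p n) *\<^sub>R p n)" .
  have "c (p n) = 0" if "n < N" for n
    using assms(2)[OF that] pairing_combination[OF that, of "\<lambda>n. c (p n)"] f by simp
  then show ?thesis using f by simp
qed

text \<open>A solution of \<open>L{f} = \<mu>\<close> can be changed by the \<open>p\<^sub>n\<close>, which are biorthogonal to the \<open>\<phi>\<^sub>n\<close>, to give
  its pairings any values. Together with the previous lemma: the measure \<open>L{f}\<close> and the numbers
  \<open>\<langle>f, \<phi>\<^sub>n\<rangle>\<close> are independent coordinates on the native space.\<close>

lemma native_element:
  obtains f where "f \<in> native_space L" "density_of f = \<mu>" "\<And>n. n < N \<Longrightarrow> pairing f (\<phi> n) = b n"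
proof -
  obtain f0 where f0: "mdo_apply L f0 = dist_of_vmeasure \<mu>"
    using mdo_apply_onto_measures[OF det] by blast
  define f where "f = f0 + (\<Sum>n<N. (b n - pairing f0 (\<phi> n)) *\<^sub>R p n)"
  have Lf: "mdo_apply L f = dist_of_vmeasure \<mu>"
    by (simp add: f_def linear_add[OF linear_mdo_apply] linear_sum[OF linear_mdo_apply]
        linear_scale[OF linear_mdo_apply] p_null f0)
  show thesis
  proof (rule that[of f])
    show "f \<in> native_space L" by (simp add: native_space_def Lf)
    show "density_of f = \<mu>" by (simp add: Lf)
    show "pairing f (\<phi> n) = b n" if "n < N" for n
      using pairing_combination[OF that] by (simp add: f_def linear_add[OF linear_pairing])
  qed
qed

text \<open>The elements of the predual in the coordinates of the native space; all that follows rests on this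
formula.\<close>

lemma C_elem_apply:
  "C_elem L N \<phi> (v, a) f = (if f \<in> native_space L
     then measure_pairing (density_of f) v + (\<Sum>n<N. a n * pairing f (\<phi> n)) else 0)"
  by (simp add: C_elem_def weak_action_def test_action_def mdo_adj_adj sum_fun_apply scaleR_fun_def)

lemma C_elem_add:
  assumes "v \<in> C0" "w \<in> C0"
  shows "C_elem L N \<phi> (v + w, a + b) = C_elem L N \<phi> (v, a) + C_elem L N \<phi> (w, b)"
  using assms by (simp add: fun_eq_iff C_elem_apply measure_pairing_add distrib_right sum.distrib)

lemma C_elem_scaleR: "C_elem L N \<phi> (r *\<^sub>R v, r *\<^sub>R a) = r *\<^sub>R C_elem L N \<phi> (v, a)"
proof
  fix f
  have "(\<Sum>n<N. (r *\<^sub>R a) n * pairing f (\<phi> n)) = r * (\<Sum>n<N. a n * pairing f (\<phi> n))"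
    by (simp add: scaleR_fun_def sum_distrib_left mult.assoc)
  moreover have "(r *\<^sub>R C_elem L N \<phi> (v, a)) f = r * C_elem L N \<phi> (v, a) f" by (simp add: scaleR_fun_def)
  ultimately show "C_elem L N \<phi> (r *\<^sub>R v, r *\<^sub>R a) f = (r *\<^sub>R C_elem L N \<phi> (v, a)) f"
    by (simp add: C_elem_apply measure_pairing_scale distrib_left)
qed

lemma C_elem_diff:
  assumes "v \<in> C0" "w \<in> C0"
  shows "C_elem L N \<phi> (v - w, a - b) = C_elem L N \<phi> (v, a) - C_elem L N \<phi> (w, b)"
proof -
  have "- 1 *\<^sub>R w \<in> C0" using assms(2) by (rule C0_closed(3))
  from C_elem_add[OF assms(1) this, of a "- 1 *\<^sub>R b"]
  show ?thesis unfolding C_elem_scaleR by simp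
qed

lemma C_elem_0: "C_elem L N \<phi> (0, 0) = 0"
  using C_elem_scaleR[of 0 0 0] by simp

text \<open>Both terms can be switched off independently, since \<open>\<mu>\<close> and \<open>b\<close> can be prescribed.\<close>

lemma C_elem_eq_0:
  assumes v: "v \<in> C0" and a: "a \<in> coord_space N" and z: "C_elem L N \<phi> (v, a) = 0"
  shows "v = 0" "a = 0"
proof -
  have *: "measure_pairing \<mu> v + (\<Sum>n<N. a n * b n) = 0" for \<mu> b
  proof -
    obtain f where f: "f \<in> native_space L" "density_of f = \<mu>" "\<And>n. n < N \<Longrightarrow> pairing f (\<phi> n) = b n"
      by (rule native_element) (rule that)
    have "C_elem L N \<phi> (v, a) f = 0" using z by simp
    then show ?thesis using f by (simp add: C_elem_apply)
  qed
  have mp0: "measure_pairing \<mu> v = 0" for \<mu> using *[of \<mu> "\<lambda>_. 0"] by simp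
  have "v x $ d = 0" for x d
    using dirac_pairing[of x d] v mp0 by auto
  then show "v = 0" by (simp add: fun_eq_iff vec_eq_iff)
  have "a n = 0" for n
  proof (cases "n < N")
    case True
    have "(\<Sum>i<N. a i * unit_tuple n i) = (\<Sum>i<N. if i = n then a n else 0)"
      by (intro sum.cong) (auto simp: unit_tuple_def)
    then show ?thesis using *[of 0 "unit_tuple n"] mp0 True by simp
  qed (use a in \<open>simp add: coord_space_def\<close>)
  then show "a = 0" by (simp add: fun_eq_iff)
qed

lemma inj_C_elem: "inj_on (C_elem L N \<phi>) (C0 \<times> coord_space N)"
proof (rule inj_onI)
  fix x y assume x: "x \<in> C0 \<times> coord_space N" and y: "y \<in> C0 \<times> coord_space N"
    and eq: "C_elem L N \<phi> x = C_elem L N \<phi> y"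
  obtain v a w b where xy: "x = (v, a)" "y = (w, b)" by (metis surj_pair)
  have "C_elem L N \<phi> (v - w, a - b) = 0"
    using C_elem_diff[of v w a b] x y eq by (simp add: xy)
  moreover have "v - w \<in> C0" "a - b \<in> coord_space N"
    using x y by (auto simp: xy)
  ultimately have "v - w = 0" "a - b = 0" using C_elem_eq_0 by blast+
  then show "x = y" by (simp add: xy)
qed

lemma C_norm_elem:
  assumes "v \<in> C0" "a \<in> coord_space N"
  shows "C_norm nC Y L N \<phi> (C_elem L N \<phi> (v, a)) = max (nC v) (Y a)"
  using inv_into_f_f[OF inj_C_elem, of "(v, a)"] assms by (simp add: C_norm_def)

lemma C_space_cases:
  assumes "g \<in> C_space L N \<phi>"
  obtains v a where "v \<in> C0" "a \<in> coord_space N" "g = C_elem L N \<phi> (v, a)"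
  using assms by (auto simp: C_space_def)

lemma C_elem_in: "v \<in> C0 \<Longrightarrow> a \<in> coord_space N \<Longrightarrow> C_elem L N \<phi> (v, a) \<in> C_space L N \<phi>"
  by (auto simp: C_space_def)

lemma subspace_C_space: "subspace (C_space L N \<phi>)"
  unfolding subspace_def
proof (intro conjI ballI allI)
  show "0 \<in> C_space L N \<phi>"
    using C_elem_in[OF subspace_0[OF subspace_C0] subspace_0[OF subspace_coord_space]] by (simp add: C_elem_0)
  show "g + h \<in> C_space L N \<phi>" if gh: "g \<in> C_space L N \<phi>" "h \<in> C_space L N \<phi>" for g h
  proof -
    obtain v a where 1: "v \<in> C0" "a \<in> coord_space N" "g = C_elem L N \<phi> (v, a)" using gh(1) by (rule C_space_cases)
    obtain w b where 2: "w \<in> C0" "b \<in> coord_space N" "h = C_elem L N \<phi> (w, b)" using gh(2) by (rule C_space_cases)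
    have "g + h = C_elem L N \<phi> (v + w, a + b)" using 1 2 by (simp add: C_elem_add)
    then show ?thesis
      using 1 2 by (simp add: C_elem_in)
  qed
  show "r *\<^sub>R g \<in> C_space L N \<phi>" if g: "g \<in> C_space L N \<phi>" for r g
  proof -
    obtain v a where 1: "v \<in> C0" "a \<in> coord_space N" "g = C_elem L N \<phi> (v, a)" using g by (rule C_space_cases)
    then have "r *\<^sub>R g = C_elem L N \<phi> (r *\<^sub>R v, r *\<^sub>R a)" by (simp add: C_elem_scaleR)
    then show ?thesis
      using 1 by (simp add: C_elem_in)
  qed
qed

lemma C_elem_on_test_functions:
  assumes v: "v \<in> C0"
  shows "C_elem L N \<phi> (v, a) (dist_of_test \<psi>) =
    pairing (mdo_apply (mdo_adj L) (dist_of_vfun v) + (\<Sum>n<N. a n *\<^sub>R dist_of_test (\<phi> n))) \<psi>"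
proof -
  have "continuous_on UNIV v" using v by (simp add: C0_def)
  then have "measure_pairing (density_of (dist_of_test \<psi>)) v = pairing (mdo_apply (mdo_adj L) (dist_of_vfun v)) \<psi>"
    by (rule dist_of_test_native_space(2)) (rule C0_bounded[OF v])
  then show ?thesis
    by (simp add: C_elem_apply dist_of_test_native_space(1) linear_add[OF linear_pairing]
        linear_sum[OF linear_pairing] linear_scale[OF linear_pairing]
        pairing_dist_of_test_commute[of \<psi>])
qed

lemma direct_sum_C_space:
  "is_direct_sum (C_space L N \<phi>) (weak_action (mdo_adj L) ` C0) (span ((\<lambda>n. test_action L (\<phi> n)) ` {..<N}))"
proof -
  let ?W = "weak_action (mdo_adj L)" and ?t = "\<lambda>n. test_action L (\<phi> n)"
  have W: "?W v = C_elem L N \<phi> (v, 0)" for v by (simp add: C_elem_def)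
  have zero: "0 \<in> coord_space N" "0 \<in> C0" using subspace_0[OF subspace_coord_space] subspace_0[OF subspace_C0] by auto
  have W0: "?W 0 = 0" by (simp add: W C_elem_0)
  have T: "C_elem L N \<phi> (0, a) = (\<Sum>n<N. a n *\<^sub>R ?t n)" for a by (simp add: C_elem_def W0)
  have span_eq: "span (?t ` {..<N}) = (\<lambda>a. C_elem L N \<phi> (0, a)) ` coord_space N"
  proof
    show "span (?t ` {..<N}) \<subseteq> (\<lambda>a. C_elem L N \<phi> (0, a)) ` coord_space N"
    proof (rule span_minimal)
      show "?t ` {..<N} \<subseteq> (\<lambda>a. C_elem L N \<phi> (0, a)) ` coord_space N"
      proof (rule image_subsetI)
        fix n assume "n \<in> {..<N}"
        then have n: "n < N" by simp
        have "C_elem L N \<phi> (0, unit_tuple n) = (\<Sum>i<N. if i = n then ?t n else 0)"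
          unfolding T by (intro sum.cong) (auto simp: unit_tuple_def)
        then have "?t n = C_elem L N \<phi> (0, unit_tuple n)" using n by simp
        then show "?t n \<in> (\<lambda>a. C_elem L N \<phi> (0, a)) ` coord_space N"
          using unit_tuple_coord[OF n] by (rule image_eqI)
      qed
      show "subspace ((\<lambda>a. C_elem L N \<phi> (0, a)) ` coord_space N)"
      proof (rule linear_subspace_image[OF _ subspace_coord_space])
        show "linear (\<lambda>a. C_elem L N \<phi> (0, a))"
        proof (rule linearI)
          show "C_elem L N \<phi> (0, a + b) = C_elem L N \<phi> (0, a) + C_elem L N \<phi> (0, b)" for a b
            using C_elem_add[OF zero(2) zero(2), of a b] by simp
          show "C_elem L N \<phi> (0, r *\<^sub>R a) = r *\<^sub>R C_elem L N \<phi> (0, a)" for r a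
            using C_elem_scaleR[of r 0 a] by simp
        qed
      qed
    qed
    show "(\<lambda>a. C_elem L N \<phi> (0, a)) ` coord_space N \<subseteq> span (?t ` {..<N})"
    proof (rule image_subsetI)
      fix a
      show "C_elem L N \<phi> (0, a) \<in> span (?t ` {..<N})"
        unfolding T by (intro span_sum span_scale span_base) auto
    qed
  qed
  show ?thesis
    unfolding is_direct_sum_def
  proof (intro conjI)
    show "subspace (?W ` C0)"
      unfolding subspace_def
    proof (intro conjI ballI allI)
      show "0 \<in> ?W ` C0" using W0 zero(2) by (metis image_eqI)
      show "x + y \<in> ?W ` C0" if xy: "x \<in> ?W ` C0" "y \<in> ?W ` C0" for x y
      proof -
        obtain v w where vw: "v \<in> C0" "w \<in> C0" "x = ?W v" "y = ?W w" using xy by blast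
        then have "x + y = ?W (v + w)" using C_elem_add[OF vw(1,2), of 0 0] by (simp add: W)
        then show ?thesis using subspace_add[OF subspace_C0 vw(1,2)] by (rule image_eqI)
      qed
      show "r *\<^sub>R x \<in> ?W ` C0" if x: "x \<in> ?W ` C0" for r x
      proof -
        obtain v where v: "v \<in> C0" "x = ?W v" using x by blast
        then have "r *\<^sub>R x = ?W (r *\<^sub>R v)" using C_elem_scaleR[of r v 0] by (simp add: W)
        then show ?thesis using subspace_scale[OF subspace_C0 v(1)] by (rule image_eqI)
      qed
    qed
    show "?W ` C0 \<inter> span (?t ` {..<N}) = {0}"
    proof
      show "?W ` C0 \<inter> span (?t ` {..<N}) \<subseteq> {0}"
      proof
        fix g assume g: "g \<in> ?W ` C0 \<inter> span (?t ` {..<N})"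
        obtain v where v: "v \<in> C0" "g = C_elem L N \<phi> (v, 0)" using g W by blast
        obtain a where a: "a \<in> coord_space N" "g = C_elem L N \<phi> (0, a)" using g span_eq by blast
        have "(v, 0) = (0, a)"
          using inj_onD[OF inj_C_elem, of "(v, 0)" "(0, a)"] v a zero by simp
        then show "g \<in> {0}" using v by (simp add: C_elem_0)
      qed
      show "{0} \<subseteq> ?W ` C0 \<inter> span (?t ` {..<N})"
      proof -
        have "0 \<in> ?W ` C0" using W0[symmetric] zero(2) by (rule image_eqI)
        then show ?thesis using span_zero by simp
      qed
    qed
    have split: "C_elem L N \<phi> (v, a) = ?W v + C_elem L N \<phi> (0, a)" for v a
      unfolding T by (simp add: C_elem_def)
    define A B where "A = ?W ` C0" and "B = span (?t ` {..<N})"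
    have "C_space L N \<phi> = {u + v |u v. u \<in> A \<and> v \<in> B}"
    proof (intro equalityI subsetI)
      fix g assume "g \<in> C_space L N \<phi>"
      then obtain v a where va: "v \<in> C0" "a \<in> coord_space N" "g = C_elem L N \<phi> (v, a)" by (rule C_space_cases)
      have "?W v \<in> A" unfolding A_def using va(1) by (rule imageI)
      moreover have "C_elem L N \<phi> (0, a) \<in> B" unfolding B_def span_eq using va(2) by (rule imageI)
      moreover have "g = ?W v + C_elem L N \<phi> (0, a)" unfolding va(3) by (rule split)
      ultimately show "g \<in> {u + v |u v. u \<in> A \<and> v \<in> B}" by blast
    next
      fix g assume "g \<in> {u + v |u v. u \<in> A \<and> v \<in> B}"
      then obtain x y where xy: "g = x + y" "x \<in> A" "y \<in> B" by blast
      obtain v where v: "v \<in> C0" "x = ?W v" using xy(2) unfolding A_def by (rule imageE)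
      obtain a where a: "a \<in> coord_space N" "y = C_elem L N \<phi> (0, a)"
        using xy(3) unfolding B_def span_eq by (rule imageE)
      show "g \<in> C_space L N \<phi>" unfolding xy(1) v(2) a(2) split[symmetric] by (rule C_elem_in[OF v(1) a(1)])
    qed
    then show "C_space L N \<phi> = {u + v |u v. u \<in> ?W ` C0 \<and> v \<in> span (?t ` {..<N})}"
      unfolding A_def B_def .
  qed (rule subspace_span)
qed

end

locale predual_setting = native_setting L N p \<phi> + C0_norm nC nM c C + tuple_norm N Y
  for L :: "'d::finite mdo" and N p \<phi> and nC :: "(real \<Rightarrow> real ^ 'd) \<Rightarrow> real" and nM c C Y
begin

abbreviation (input) "CL \<equiv> C_space L N \<phi>"
abbreviation (input) "elem \<equiv> C_elem L N \<phi>"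
abbreviation (input) "nrm \<equiv> C_norm nC Y L N \<phi>"

lemma nC_nonneg: "v \<in> C0 \<Longrightarrow> 0 \<le> nC v"
  by (rule norm_onD(1)[OF nC])

lemma Y_nonneg: "a \<in> coord_space N \<Longrightarrow> 0 \<le> Y a"
  by (rule norm_onD(1)[OF Y])

lemma norm_C_space: "norm_on CL nrm"
  unfolding norm_on_def
proof (intro conjI ballI allI)
  fix g assume "g \<in> CL"
  then obtain v a where g: "v \<in> C0" "a \<in> coord_space N" "g = elem (v, a)" by (rule C_space_cases)
  have n: "nrm g = max (nC v) (Y a)" using g by (simp add: C_norm_elem)
  show "0 \<le> nrm g" using n nC_nonneg[OF g(1)] by simp
  show "nrm g = 0 \<longleftrightarrow> g = 0"
  proof
    assume "nrm g = 0"
    then have "nC v = 0" "Y a = 0" using n nC_nonneg[OF g(1)] Y_nonneg[OF g(2)] by (auto simp: max_def split: if_splits)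
    then have "v = 0" "a = 0" using norm_onD(2)[OF nC g(1)] norm_onD(2)[OF Y g(2)] by auto
    then show "g = 0" by (simp add: g(3) C_elem_0)
  next
    assume "g = 0"
    then have "v = 0" "a = 0" using C_elem_eq_0[OF g(1,2)] g(3) by auto
    then show "nrm g = 0" using n norm_onD(2)[OF nC g(1)] norm_onD(2)[OF Y g(2)] by simp
  qed
  show "nrm (r *\<^sub>R g) = \<bar>r\<bar> * nrm g" for r
  proof -
    have "r *\<^sub>R g = elem (r *\<^sub>R v, r *\<^sub>R a)" by (simp add: g(3) C_elem_scaleR)
    then have "nrm (r *\<^sub>R g) = max (nC (r *\<^sub>R v)) (Y (r *\<^sub>R a))"
      using g by (simp add: C_norm_elem)
    then show ?thesis
      using n norm_onD(3)[OF nC g(1)] norm_onD(3)[OF Y g(2)] by (simp add: max_mult_distrib_left)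
  qed
  fix h assume "h \<in> CL"
  then obtain w b where h: "w \<in> C0" "b \<in> coord_space N" "h = elem (w, b)" by (rule C_space_cases)
  have "g + h = elem (v + w, a + b)" using g h by (simp add: C_elem_add)
  then have "nrm (g + h) = max (nC (v + w)) (Y (a + b))"
    using g h by (simp add: C_norm_elem)
  also have "\<dots> \<le> max (nC v) (Y a) + max (nC w) (Y b)"
    using norm_onD(4)[OF nC g(1) h(1)] norm_onD(4)[OF Y g(2) h(2)] by (smt (verit))
  also have "\<dots> = nrm g + nrm h" using g h by (simp add: C_norm_elem)
  finally show "nrm (g + h) \<le> nrm g + nrm h" .
qed

lemma complete_C0:
  assumes V: "\<And>k. V k \<in> C0" and cauchy: "\<forall>e>0. \<exists>K. \<forall>k\<ge>K. \<forall>l\<ge>K. nC (V k - V l) < e"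
  shows "\<exists>v\<in>C0. (\<lambda>k. nC (V k - v)) \<longlonglongrightarrow> 0"
proof -
  have VV: "V k - V l \<in> C0" for k l by (intro subspace_diff[OF subspace_C0] V)
  have unif: "\<exists>K. \<forall>k\<ge>K. \<forall>l\<ge>K. \<forall>x. norm (V k x - V l x) \<le> e" if e: "0 < e" for e
  proof -
    have "0 < e / c" using e c by simp
    then obtain K where K: "\<And>k l. K \<le> k \<Longrightarrow> K \<le> l \<Longrightarrow> nC (V k - V l) < e / c" using cauchy by blast
    have "norm (V k x - V l x) \<le> e" if "K \<le> k" "K \<le> l" for k l x
    proof -
      have "norm (V k x - V l x) \<le> c * nC (V k - V l)" using lower[OF VV, of k l x] by simp
      also have "\<dots> \<le> c * (e / c)" using K[OF that] c by (intro mult_left_mono) auto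
      finally show ?thesis using c by simp
    qed
    then show ?thesis by blast
  qed
  have "Cauchy (\<lambda>k. V k x)" for x
  proof (rule metric_CauchyI)
    fix e :: real assume "0 < e"
    then obtain K where "\<forall>k\<ge>K. \<forall>l\<ge>K. \<forall>x. norm (V k x - V l x) \<le> e / 2" using unif[of "e / 2"] by auto
    then have "dist (V k x) (V l x) \<le> e / 2" if "K \<le> k" "K \<le> l" for k l
      using that by (simp add: dist_norm)
    then have "dist (V k x) (V l x) < e" if "K \<le> k" "K \<le> l" for k l
      using that \<open>0 < e\<close> by (smt (verit) field_sum_of_halves)
    then show "\<exists>K. \<forall>k\<ge>K. \<forall>l\<ge>K. dist (V k x) (V l x) < e" by blast
  qed
  then have "\<exists>y. (\<lambda>k. V k x) \<longlonglongrightarrow> y" for x by (metis Cauchy_convergent convergent_def)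
  then obtain v where v: "\<And>x. (\<lambda>k. V k x) \<longlonglongrightarrow> v x" by metis
  have near: "\<exists>K. \<forall>k\<ge>K. \<forall>x. norm (V k x - v x) \<le> e" if e: "0 < e" for e
  proof -
    obtain K where K: "\<forall>k\<ge>K. \<forall>l\<ge>K. \<forall>x. norm (V k x - V l x) \<le> e" using unif[OF e] by blast
    have "norm (V k x - v x) \<le> e" if "K \<le> k" for k x
    proof (rule tendsto_upperbound)
      show "(\<lambda>l. norm (V k x - V l x)) \<longlonglongrightarrow> norm (V k x - v x)" by (intro tendsto_intros v)
      show "\<forall>\<^sub>F l in sequentially. norm (V k x - V l x) \<le> e"
        using K that by (auto simp: eventually_sequentially)
    qed simp
    then show ?thesis by blast
  qed
  have ul: "uniform_limit UNIV V v sequentially"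
  proof (rule uniform_limitI)
    fix e :: real assume "0 < e"
    then obtain K where "\<forall>k\<ge>K. \<forall>x. norm (V k x - v x) \<le> e / 2" using near[of "e / 2"] by auto
    then have "dist (V k x) (v x) \<le> e / 2" if "K \<le> k" for k x
      using that by (simp add: dist_norm)
    then have "dist (V k x) (v x) < e" if "K \<le> k" for k x
      using that \<open>0 < e\<close> by (smt (verit) field_sum_of_halves)
    then show "\<forall>\<^sub>F k in sequentially. \<forall>x\<in>UNIV. dist (V k x) (v x) < e"
      by (auto simp: eventually_sequentially)
  qed
  have "continuous_on UNIV v"
    by (rule uniform_limit_theorem[OF _ ul]) (use V in \<open>auto simp: C0_def\<close>)
  moreover have "(v \<longlongrightarrow> 0) at_infinity"
  proof (rule tendstoI)
    fix e :: real assume e: "0 < e"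
    then obtain K where K: "\<forall>k\<ge>K. \<forall>x. norm (V k x - v x) \<le> e / 2" using near[of "e / 2"] by auto
    have "\<forall>\<^sub>F x in at_infinity. dist (V K x) 0 < e / 2"
    proof (rule tendstoD)
      show "(V K \<longlongrightarrow> 0) at_infinity" using V[of K] by (simp add: C0_def)
    qed (use e in simp)
    then show "\<forall>\<^sub>F x in at_infinity. dist (v x) 0 < e"
    proof eventually_elim
      case (elim x)
      have "norm (v x) \<le> norm (V K x) + norm (V K x - v x)"
        by (metis add_diff_cancel_left' diff_add_cancel norm_minus_commute norm_triangle_ineq add.commute)
      then show ?case using elim K by (smt (verit) dist_0_norm dist_commute field_sum_of_halves order_refl)
    qed
  qed
  ultimately have vC: "v \<in> C0" by (simp add: C0_def)
  have "(\<lambda>k. nC (V k - v)) \<longlonglongrightarrow> 0"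
  proof (rule tendstoI)
    fix e :: real assume e: "0 < e"
    then have "0 < e / (2 * C)" using C by simp
    then obtain K where K: "\<forall>k\<ge>K. \<forall>x. norm (V k x - v x) \<le> e / (2 * C)" using near by blast
    have "nC (V k - v) < e \<and> 0 \<le> nC (V k - v)" if "K \<le> k" for k
    proof -
      have d: "V k - v \<in> C0" by (intro subspace_diff[OF subspace_C0] V vC)
      have "nC (V k - v) \<le> C * (e / (2 * C))" by (rule upper[OF d]) (use K that in simp)
      then show ?thesis using e C nC_nonneg[OF d] by simp
    qed
    then have "dist (nC (V k - v)) 0 < e" if "K \<le> k" for k using that by simp
    then show "\<forall>\<^sub>F k in sequentially. dist (nC (V k - v)) 0 < e"
      unfolding eventually_sequentially by blast
  qed
  then show ?thesis using vC by (rule bexI)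
qed

lemma complete_coord_space:
  assumes A: "\<And>k. A k \<in> coord_space N" and cauchy: "\<forall>e>0. \<exists>K. \<forall>k\<ge>K. \<forall>l\<ge>K. Y (A k - A l) < e"
  shows "\<exists>a\<in>coord_space N. (\<lambda>k. Y (A k - a)) \<longlonglongrightarrow> 0"
proof -
  obtain q where q: "0 < q" "\<And>a n. a \<in> coord_space N \<Longrightarrow> n < N \<Longrightarrow> \<bar>a n\<bar> \<le> q * Y a"
    by (rule coordinate_le_tuple_norm) (rule that)
  have AA: "A k - A l \<in> coord_space N" for k l by (intro subspace_diff[OF subspace_coord_space] A)
  have "\<exists>y. (\<lambda>k. A k n) \<longlonglongrightarrow> y \<and> (N \<le> n \<longrightarrow> y = 0)" for n
  proof (cases "n < N")
    case True
    have "Cauchy (\<lambda>k. A k n)"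
    proof (rule metric_CauchyI)
      fix e :: real assume "0 < e"
      then have "0 < e / q" using q by simp
      then obtain K where K: "\<And>k l. K \<le> k \<Longrightarrow> K \<le> l \<Longrightarrow> Y (A k - A l) < e / q" using cauchy by blast
      have "dist (A k n) (A l n) < e" if "K \<le> k" "K \<le> l" for k l
      proof -
        have "\<bar>A k n - A l n\<bar> \<le> q * Y (A k - A l)" using q(2)[OF AA True, of k l] by simp
        also have "\<dots> < q * (e / q)" using K[OF that] q(1) by (intro mult_strict_left_mono) auto
        finally show ?thesis using q(1) by (simp add: dist_real_def)
      qed
      then show "\<exists>K. \<forall>k\<ge>K. \<forall>l\<ge>K. dist (A k n) (A l n) < e" by blast
    qed
    then show ?thesis using True by (auto simp: Cauchy_convergent_iff convergent_def)
  next
    case False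
    then have "(\<lambda>k. A k n) = (\<lambda>k. 0)" using A by (auto simp: coord_space_def)
    then show ?thesis by (intro exI[of _ 0]) simp
  qed
  then obtain a where a: "\<And>n. (\<lambda>k. A k n) \<longlonglongrightarrow> a n" "\<And>n. N \<le> n \<Longrightarrow> a n = 0" by metis
  have aN: "a \<in> coord_space N" using a(2) by (simp add: coord_space_def)
  have Aa: "A k - a \<in> coord_space N" for k by (intro subspace_diff[OF subspace_coord_space] A aN)
  have "(\<lambda>k. \<Sum>n<N. \<bar>A k n - a n\<bar> * Y (unit_tuple n)) \<longlonglongrightarrow> (\<Sum>n<N. \<bar>a n - a n\<bar> * Y (unit_tuple n))"
    by (intro tendsto_intros a(1))
  then have "(\<lambda>k. \<Sum>n<N. \<bar>A k n - a n\<bar> * Y (unit_tuple n)) \<longlonglongrightarrow> 0" by simp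
  moreover have "\<forall>\<^sub>F k in sequentially. norm (Y (A k - a)) \<le> (\<Sum>n<N. \<bar>A k n - a n\<bar> * Y (unit_tuple n))"
    using tuple_norm_le[OF Aa] Y_nonneg[OF Aa] by (intro always_eventually) simp
  ultimately have "(\<lambda>k. Y (A k - a)) \<longlonglongrightarrow> 0" by (rule Lim_null_comparison[rotated])
  then show ?thesis using aN by (rule bexI)
qed

lemma banach_C_space: "banach_on CL nrm"
  unfolding banach_on_def
proof (intro conjI subspace_C_space norm_C_space allI impI)
  fix s :: "nat \<Rightarrow> distribution ^ 'd \<Rightarrow> real"
  assume s: "\<forall>k. s k \<in> CL" and cauchy: "\<forall>e>0. \<exists>K. \<forall>k\<ge>K. \<forall>l\<ge>K. nrm (s k - s l) < e"
  have "\<forall>k. \<exists>va. fst va \<in> C0 \<and> snd va \<in> coord_space N \<and> s k = elem (fst va, snd va)"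
  proof
    fix k
    obtain v a where "v \<in> C0" "a \<in> coord_space N" "s k = elem (v, a)" using s by (rule_tac C_space_cases) auto
    then show "\<exists>va. fst va \<in> C0 \<and> snd va \<in> coord_space N \<and> s k = elem (fst va, snd va)"
      by (intro exI[of _ "(v, a)"]) simp
  qed
  from choice[OF this] obtain VA where
    VA: "\<forall>k. fst (VA k) \<in> C0 \<and> snd (VA k) \<in> coord_space N \<and> s k = elem (fst (VA k), snd (VA k))" by (rule exE)
  define V A where "V = (\<lambda>k. fst (VA k))" and "A = (\<lambda>k. snd (VA k))"
  have V: "V k \<in> C0" and A: "A k \<in> coord_space N" and sk: "s k = elem (V k, A k)" for k
    using VA by (auto simp: V_def A_def)
  have nd: "nrm (elem (v, a) - elem (w, b)) = max (nC (v - w)) (Y (a - b))"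
    if "v \<in> C0" "w \<in> C0" "a \<in> coord_space N" "b \<in> coord_space N" for v w a b
    using that by (simp add: C_elem_diff[symmetric] C_norm_elem)
  have nsk: "nrm (s k - s l) = max (nC (V k - V l)) (Y (A k - A l))" for k l
    unfolding sk by (rule nd[OF V V A A])
  have both: "\<forall>e>0. \<exists>K. \<forall>k\<ge>K. \<forall>l\<ge>K. nC (V k - V l) < e \<and> Y (A k - A l) < e"
    using cauchy unfolding nsk by simp
  then have "\<forall>e>0. \<exists>K. \<forall>k\<ge>K. \<forall>l\<ge>K. nC (V k - V l) < e" by meson
  moreover have "\<forall>e>0. \<exists>K. \<forall>k\<ge>K. \<forall>l\<ge>K. Y (A k - A l) < e" using both by meson
  ultimately obtain v a where v: "v \<in> C0" "(\<lambda>k. nC (V k - v)) \<longlonglongrightarrow> 0"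
    and a: "a \<in> coord_space N" "(\<lambda>k. Y (A k - a)) \<longlonglongrightarrow> 0"
    using complete_C0[of V, OF V] complete_coord_space[of A, OF A] by blast
  have "(\<lambda>k. nrm (s k - elem (v, a))) = (\<lambda>k. max (nC (V k - v)) (Y (A k - a)))"
    unfolding sk by (rule ext) (rule nd[OF V v(1) A a(1)])
  moreover have "(\<lambda>k. max (nC (V k - v)) (Y (A k - a))) \<longlonglongrightarrow> max 0 0"
    by (intro tendsto_max v(2) a(2))
  ultimately have "(\<lambda>k. nrm (s k - elem (v, a))) \<longlonglongrightarrow> 0" by simp
  then show "\<exists>x\<in>CL. (\<lambda>k. nrm (s k - x)) \<longlonglongrightarrow> 0" using C_elem_in[OF v(1) a(1)] by blast
qed

text \<open>The map \<open>J\<close> from the definition of a predual.\<close>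

definition evaluation :: "distribution ^ 'd \<Rightarrow> (distribution ^ 'd \<Rightarrow> real) \<Rightarrow> real" where
  "evaluation f g = (if g \<in> CL then g f else 0)"

lemma evaluation_elem:
  "f \<in> native_space L \<Longrightarrow> v \<in> C0 \<Longrightarrow> a \<in> coord_space N \<Longrightarrow>
    evaluation f (elem (v, a)) = measure_pairing (density_of f) v + (\<Sum>n<N. a n * pairing f (\<phi> n))"
  by (simp add: evaluation_def C_elem_in C_elem_apply)

abbreviation (input) "native_nrm \<equiv> native_norm nM (coord_dual_norm N Y) L \<phi>"

text \<open>On the product of the two unit balls both terms are bounded by the dual norms, and changing the sign
of \<open>v\<close> or \<open>a\<close> stays in the balls.\<close>

lemma evaluation_le:
  assumes f: "f \<in> native_space L" and g: "g \<in> CL" "nrm g \<le> 1"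
  shows "\<bar>evaluation f g\<bar> \<le> native_nrm f"
proof -
  obtain v a where va: "v \<in> C0" "a \<in> coord_space N" "g = elem (v, a)" using g(1) by (rule C_space_cases)
  have le1: "nC v \<le> 1" "Y a \<le> 1" using g(2) va by (simp_all add: C_norm_elem)
  have neg: "- v \<in> C0" "- a \<in> coord_space N" "nC (- v) \<le> 1" "Y (- a) \<le> 1"
    using subspace_neg[OF subspace_C0 va(1)] subspace_neg[OF subspace_coord_space va(2)]
      norm_on_minus[OF nC va(1)] norm_on_minus[OF Y va(2)] le1 by auto
  have "measure_pairing (density_of f) v \<le> nM (density_of f)" by (rule dual_le[OF va(1) le1(1)])
  moreover have "- measure_pairing (density_of f) v \<le> nM (density_of f)"
    using dual_le[OF neg(1,3), of "density_of f"] measure_pairing_scale[of "density_of f" "- 1" v] by simp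
  moreover have "(\<Sum>n<N. pairing f (\<phi> n) * a n) \<le> coord_dual_norm N Y (\<lambda>n. pairing f (\<phi> n))"
    by (rule coord_dual_ge[OF va(2) le1(2)])
  moreover have "- (\<Sum>n<N. pairing f (\<phi> n) * a n) \<le> coord_dual_norm N Y (\<lambda>n. pairing f (\<phi> n))"
    using coord_dual_ge[OF neg(2,4), of "\<lambda>n. pairing f (\<phi> n)"] by (simp add: sum_negf)
  ultimately show ?thesis
    unfolding va(3) evaluation_elem[OF f va(1,2)] native_norm_def by (simp add: mult.commute abs_le_iff)
qed

text \<open>Since the unit ball is a product of unit balls, \<open>v\<close> and \<open>a\<close> can be optimised separately, and the dual
norm is the sum of the dual norms.\<close>

lemma dual_norm_evaluation:
  assumes f: "f \<in> native_space L"
  shows "dual_norm_on CL nrm (evaluation f) = native_nrm f"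
proof (rule antisym)
  let ?B = "{g \<in> CL. nrm g \<le> 1}"
  have "nrm 0 = 0" using norm_onD(2)[OF norm_C_space subspace_0[OF subspace_C_space]] by simp
  then have "0 \<in> ?B" using subspace_0[OF subspace_C_space] by simp
  then have ne: "?B \<noteq> {}" by blast
  show "dual_norm_on CL nrm (evaluation f) \<le> native_nrm f"
    unfolding dual_norm_on_def by (rule cSUP_least[OF ne]) (use evaluation_le[OF f] in auto)
  have bdd: "bdd_above ((\<lambda>g. \<bar>evaluation f g\<bar>) ` ?B)"
    by (rule bdd_aboveI2) (use evaluation_le[OF f] in auto)
  show "native_nrm f \<le> dual_norm_on CL nrm (evaluation f)"
  proof (rule field_le_epsilon)
    fix e :: real assume "0 < e"
    then have e: "0 < e / 2" by simp
    obtain v where v: "v \<in> C0" "nC v \<le> 1" "nM (density_of f) - e / 2 \<le> measure_pairing (density_of f) v"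
      using dual_approx[OF e] by blast
    obtain a where a: "a \<in> coord_space N" "Y a \<le> 1"
      "coord_dual_norm N Y (\<lambda>n. pairing f (\<phi> n)) - e / 2 \<le> (\<Sum>n<N. pairing f (\<phi> n) * a n)"
      using coord_dual_approx[OF e] by blast
    have "native_nrm f \<le> evaluation f (elem (v, a)) + e"
      using v(3) a(3) unfolding evaluation_elem[OF f v(1) a(1)] native_norm_def by (simp add: mult.commute)
    also have "evaluation f (elem (v, a)) \<le> \<bar>evaluation f (elem (v, a))\<bar>" by simp
    also have "\<dots> \<le> dual_norm_on CL nrm (evaluation f)"
      unfolding dual_norm_on_def
      by (rule cSUP_upper[OF _ bdd]) (use v a in \<open>simp add: C_elem_in C_norm_elem\<close>)
    finally show "native_nrm f \<le> dual_norm_on CL nrm (evaluation f) + e" by simp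
  qed
qed

lemma linear_evaluation: "linear_map_on (native_space L) evaluation"
  unfolding linear_map_on_def
proof (intro conjI ballI allI)
  fix f assume f: "f \<in> native_space L"
  show "evaluation (r *\<^sub>R f) = r *\<^sub>R evaluation f" for r
  proof
    fix g show "evaluation (r *\<^sub>R f) g = (r *\<^sub>R evaluation f) g"
    proof (cases "g \<in> CL")
      case True
      then obtain v a where va: "v \<in> C0" "a \<in> coord_space N" "g = elem (v, a)" by (rule C_space_cases)
      have "r *\<^sub>R f \<in> native_space L" by (rule subspace_scale[OF subspace_native_space f])
      then show ?thesis
        using f va by (simp add: evaluation_elem scaleR_fun_def density_scaleR measure_pairing_scale_measure
            linear_scale[OF linear_pairing] distrib_left sum_distrib_left mult.left_commute)
    qed (simp add: evaluation_def scaleR_fun_def)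
  qed
  fix f' assume f': "f' \<in> native_space L"
  show "evaluation (f + f') = evaluation f + evaluation f'"
  proof
    fix g show "evaluation (f + f') g = (evaluation f + evaluation f') g"
    proof (cases "g \<in> CL")
      case True
      then obtain v a where va: "v \<in> C0" "a \<in> coord_space N" "g = elem (v, a)" by (rule C_space_cases)
      have "f + f' \<in> native_space L" by (rule subspace_add[OF subspace_native_space f f'])
      then show ?thesis
        using f f' va by (simp add: evaluation_elem density_add measure_pairing_add_measure
            linear_add[OF linear_pairing] distrib_left sum.distrib)
    qed (simp add: evaluation_def)
  qed
qed

lemma evaluation_in_dual:
  assumes f: "f \<in> native_space L"
  shows "evaluation f \<in> topological_dual CL nrm"
  unfolding topological_dual_def
proof (intro CollectI conjI)
  show "\<forall>g. g \<notin> CL \<longrightarrow> evaluation f g = 0" by (simp add: evaluation_def)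
  show "linear_map_on CL (evaluation f)"
    using subspace_add[OF subspace_C_space] subspace_scale[OF subspace_C_space]
    by (simp add: linear_map_on_def evaluation_def scaleR_fun_def)
  show "\<exists>K. \<forall>g\<in>CL. \<bar>evaluation f g\<bar> \<le> K * nrm g"
  proof (intro exI ballI)
    fix g assume g: "g \<in> CL"
    show "\<bar>evaluation f g\<bar> \<le> native_nrm f * nrm g"
    proof (cases "g = 0")
      case True
      then show ?thesis using norm_onD(2)[OF norm_C_space g] by (simp add: evaluation_def)
    next
      case False
      then have pos: "0 < nrm g" using norm_onD(1,2)[OF norm_C_space g] by force
      let ?h = "(1 / nrm g) *\<^sub>R g"
      have h: "?h \<in> CL" by (rule subspace_scale[OF subspace_C_space g])
      have "nrm ?h \<le> 1" using norm_onD(3)[OF norm_C_space g, of "1 / nrm g"] pos by simp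
      from evaluation_le[OF f h this] have "\<bar>evaluation f ?h\<bar> \<le> native_nrm f" .
      moreover have "evaluation f ?h = evaluation f g / nrm g"
        using g h by (simp add: evaluation_def scaleR_fun_def)
      ultimately show ?thesis using pos by (simp add: field_simps)
    qed
  qed
qed

lemma inj_evaluation: "inj_on evaluation (native_space L)"
proof (rule inj_onI)
  fix f f' assume f: "f \<in> native_space L" and f': "f' \<in> native_space L" and eq: "evaluation f = evaluation f'"
  have z: "0 \<in> C0" "0 \<in> coord_space N" using subspace_0[OF subspace_C0] subspace_0[OF subspace_coord_space] by auto
  have p0: "measure_pairing \<mu> 0 = 0" for \<mu> :: "signed_measure ^ 'd" using measure_pairing_scale[of \<mu> 0 0] by simp
  have "measure_pairing (density_of f - density_of f') v = 0" if v: "v \<in> C0" for v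
  proof -
    have "measure_pairing (density_of f) v = measure_pairing (density_of f') v"
      using evaluation_elem[OF f v z(2)] evaluation_elem[OF f' v z(2)] eq by simp
    then show ?thesis
      using measure_pairing_add_measure[OF v, of "density_of f" "- 1 *\<^sub>R density_of f'"]
        measure_pairing_scale_measure[OF v, of "- 1" "density_of f'"] by simp
  qed
  then have "density_of f - density_of f' = 0" by (rule vmeasure_0_if_pairing_0)
  then have "density_of f = density_of f'" by (rule eq_iff_diff_eq_0[THEN iffD2])
  then have "dist_of_vmeasure (density_of f) = dist_of_vmeasure (density_of f')" by (rule arg_cong)
  then have "mdo_apply L f = mdo_apply L f'" unfolding dist_of_density[OF f] dist_of_density[OF f'] .
  then have "mdo_apply L (f - f') = 0" by (simp add: linear_diff[OF linear_mdo_apply])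
  moreover have "pairing (f - f') (\<phi> n) = 0" if n: "n < N" for n
  proof -
    have s: "(\<Sum>i<N. unit_tuple n i * pairing f (\<phi> i)) = pairing f (\<phi> n)" for f
    proof -
      have "(\<Sum>i<N. unit_tuple n i * pairing f (\<phi> i)) = (\<Sum>i<N. if i = n then pairing f (\<phi> n) else 0)"
        by (intro sum.cong) (auto simp: unit_tuple_def)
      then show ?thesis using n by simp
    qed
    have "pairing f (\<phi> n) = pairing f' (\<phi> n)"
      using evaluation_elem[OF f z(1) unit_tuple_coord[OF n]] evaluation_elem[OF f' z(1) unit_tuple_coord[OF n]] eq
      by (simp add: p0 s)
    then show ?thesis by (simp add: linear_diff[OF linear_pairing])
  qed
  ultimately have "f - f' = 0" by (rule native_eq_0)
  then show "f = f'" by simp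
qed

text \<open>The restriction of a functional to the first factor is integration against a measure, by the Riesz
theorem; its values on the unit tuples are the remaining coordinates of the element of the native
space that represents it.\<close>

lemma evaluation_onto_dual:
  assumes U: "U \<in> topological_dual CL nrm"
  shows "\<exists>f\<in>native_space L. U = evaluation f"
proof -
  have out: "\<And>g. g \<notin> CL \<Longrightarrow> U g = 0" and lin: "linear_map_on CL U"
    using U by (auto simp: topological_dual_def)
  obtain K where K: "\<And>g. g \<in> CL \<Longrightarrow> \<bar>U g\<bar> \<le> K * nrm g"
    using U by (auto simp: topological_dual_def)
  have z: "0 \<in> C0" "0 \<in> coord_space N" using subspace_0[OF subspace_C0] subspace_0[OF subspace_coord_space] by auto
  have addU: "U (g + h) = U g + U h" if "g \<in> CL" "h \<in> CL" for g h
    using lin that by (simp add: linear_map_on_def)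
  have scaleU: "U (r *\<^sub>R g) = r * U g" if "g \<in> CL" for r g
    using lin that by (simp add: linear_map_on_def)
  have "\<exists>\<mu>. \<forall>v\<in>C0. U (elem (v, 0)) = measure_pairing \<mu> v"
  proof (rule vector_riesz_representation[where u = "\<lambda>v. U (elem (v, 0))" and B = "\<bar>K\<bar> * C"])
    show "linear_map_on C0 (\<lambda>v. U (elem (v, 0)))"
      unfolding linear_map_on_def
    proof (intro conjI ballI allI)
      fix v :: "real \<Rightarrow> real ^ 'd" assume v: "v \<in> C0"
      show "U (elem (r *\<^sub>R v, 0)) = r *\<^sub>R U (elem (v, 0))" for r
        using scaleU[OF C_elem_in[OF v z(2)], of r] C_elem_scaleR[of r v 0] by simp
      fix w :: "real \<Rightarrow> real ^ 'd" assume w: "w \<in> C0"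
      show "U (elem (v + w, 0)) = U (elem (v, 0)) + U (elem (w, 0))"
        using addU[OF C_elem_in[OF v z(2)] C_elem_in[OF w z(2)]] C_elem_add[OF v w, of 0 0] by simp
    qed
    fix v :: "real \<Rightarrow> real ^ 'd" and r assume v: "v \<in> C0" and r: "\<And>x. norm (v x) \<le> r"
    have "nrm (elem (v, 0)) = nC v"
      using v z(2) nC_nonneg[OF v] by (simp add: C_norm_elem tuple_zero)
    then have "\<bar>U (elem (v, 0))\<bar> \<le> K * nC v" using K[OF C_elem_in[OF v z(2)]] by simp
    also have "\<dots> \<le> \<bar>K\<bar> * nC v" using nC_nonneg[OF v] by (intro mult_right_mono) auto
    also have "\<dots> \<le> \<bar>K\<bar> * (C * r)" using upper[OF v r] by (intro mult_left_mono) auto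
    finally show "\<bar>U (elem (v, 0))\<bar> \<le> \<bar>K\<bar> * C * r" by (simp add: mult.assoc)
  qed
  then obtain \<mu> where \<mu>: "\<And>v. v \<in> C0 \<Longrightarrow> U (elem (v, 0)) = measure_pairing \<mu> v" by blast
  obtain f where f: "f \<in> native_space L" "density_of f = \<mu>"
    "\<And>n. n < N \<Longrightarrow> pairing f (\<phi> n) = U (elem (0, unit_tuple n))"
    by (rule native_element) (rule that)
  have "U g = evaluation f g" for g
  proof (cases "g \<in> CL")
    case True
    then obtain v a where va: "v \<in> C0" "a \<in> coord_space N" "g = elem (v, a)" by (rule C_space_cases)
    have e: "elem (0, unit_tuple n) \<in> CL" if "n < N" for n
      by (rule C_elem_in[OF z(1) unit_tuple_coord[OF that]])
    have split: "elem (v, a) = elem (v, 0) + elem (0, a)"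
      using C_elem_add[OF va(1) z(1), of 0 a] by simp
    have lin0: "linear (\<lambda>a. elem (0, a))"
    proof (rule linearI)
      show "elem (0, a + b) = elem (0, a) + elem (0, b)" for a b
        using C_elem_add[OF z(1) z(1), of a b] by simp
      show "elem (0, r *\<^sub>R a) = r *\<^sub>R elem (0, a)" for r a
        using C_elem_scaleR[of r 0 a] by simp
    qed
    have "elem (0, \<Sum>n<N. a n *\<^sub>R unit_tuple n) = (\<Sum>n<N. a n *\<^sub>R elem (0, unit_tuple n))"
      using linear_sum[OF lin0, of "\<lambda>n. a n *\<^sub>R unit_tuple n" "{..<N}"] by (simp only: linear_scale[OF lin0])
    then have "elem (0, a) = (\<Sum>n<N. a n *\<^sub>R elem (0, unit_tuple n))"
      using coord_space_expand[OF va(2)] by simp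
    then have "U (elem (0, a)) = (\<Sum>n<N. U (a n *\<^sub>R elem (0, unit_tuple n)))"
      using linear_map_on_sum[OF lin subspace_C_space, of "{..<N}" "\<lambda>n. a n *\<^sub>R elem (0, unit_tuple n)"]
        subspace_scale[OF subspace_C_space e] by simp
    also have "\<dots> = (\<Sum>n<N. a n * pairing f (\<phi> n))"
      by (intro sum.cong) (use e f(3) in \<open>auto simp: scaleU\<close>)
    finally have "U g = measure_pairing \<mu> v + (\<Sum>n<N. a n * pairing f (\<phi> n))"
      unfolding va(3) split using addU[OF C_elem_in[OF va(1) z(2)] C_elem_in[OF z(1) va(2)]] \<mu>[OF va(1)] by simp
    then show ?thesis unfolding va(3) evaluation_elem[OF f(1) va(1,2)] f(2) .
  qed (simp add: out evaluation_def)
  then show ?thesis using f(1) by blast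
qed

lemma predual_C_space: "is_predual CL nrm (native_space L) native_nrm"
proof -
  have "bij_betw evaluation (native_space L) (topological_dual CL nrm)"
    unfolding bij_betw_def
    using inj_evaluation evaluation_in_dual evaluation_onto_dual by blast
  moreover have "(\<lambda>f g. if g \<in> CL then g f else 0) = evaluation"
    by (simp add: fun_eq_iff evaluation_def)
  ultimately show ?thesis
    using subspace_native_space linear_evaluation dual_norm_evaluation by (simp add: is_predual_def)
qed

end

lemma equivalent_C_norms:
  assumes "predual_setting L N p \<phi> nC nM c C Y" "predual_setting L N p \<phi> nC' nM' c' C' Y"
  shows "equivalent_norms_on (C_space L N \<phi>) (C_norm nC Y L N \<phi>) (C_norm nC' Y L N \<phi>)"
proof -
  interpret A: predual_setting L N p \<phi> nC nM c C Y by fact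
  interpret B: predual_setting L N p \<phi> nC' nM' c' C' Y by fact
  define k k' where "k = max 1 (C' * c)" and "k' = max 1 (C * c')"
  have k: "1 \<le> k" "C' * c \<le> k" "1 \<le> k'" "C * c' \<le> k'" by (auto simp: k_def k'_def)
  have le: "C_norm nC' Y L N \<phi> g \<le> k * C_norm nC Y L N \<phi> g" "C_norm nC Y L N \<phi> g \<le> k' * C_norm nC' Y L N \<phi> g"
    if g: "g \<in> C_space L N \<phi>" for g
  proof -
    obtain v a where va: "v \<in> C0" "a \<in> coord_space N" "g = C_elem L N \<phi> (v, a)" using g by (rule A.C_space_cases)
    have n: "0 \<le> nC v" "0 \<le> nC' v" "0 \<le> Y a"
      using A.nC_nonneg B.nC_nonneg A.Y_nonneg va by blast+
    have "nC' v \<le> C' * (c * nC v)" by (rule B.upper[OF va(1) A.lower[OF va(1)]])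
    also have "\<dots> \<le> k * nC v" using mult_right_mono[OF k(2) n(1)] by (simp add: mult.assoc)
    finally have 1: "nC' v \<le> k * nC v" .
    have "nC v \<le> C * (c' * nC' v)" by (rule A.upper[OF va(1) B.lower[OF va(1)]])
    also have "\<dots> \<le> k' * nC' v" using mult_right_mono[OF k(4) n(2)] by (simp add: mult.assoc)
    finally have 2: "nC v \<le> k' * nC' v" .
    have 3: "Y a \<le> k * Y a" "Y a \<le> k' * Y a" using mult_right_mono[OF k(1) n(3)] mult_right_mono[OF k(3) n(3)] by auto
    have "max (nC' v) (Y a) \<le> max (k * nC v) (k * Y a)" "max (nC v) (Y a) \<le> max (k' * nC' v) (k' * Y a)"
      using 1 2 3 by auto
    moreover have "max (k * nC v) (k * Y a) = k * max (nC v) (Y a)" "max (k' * nC' v) (k' * Y a) = k' * max (nC' v) (Y a)"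
      using k by (simp_all add: max_mult_distrib_left)
    ultimately show "C_norm nC' Y L N \<phi> g \<le> k * C_norm nC Y L N \<phi> g" "C_norm nC Y L N \<phi> g \<le> k' * C_norm nC' Y L N \<phi> g"
      using va by (simp_all add: A.C_norm_elem)
  qed
  have "0 < 1 / k'" "0 < k" using k by auto
  moreover have "\<forall>g\<in>C_space L N \<phi>. 1 / k' * C_norm nC Y L N \<phi> g \<le> C_norm nC' Y L N \<phi> g \<and>
      C_norm nC' Y L N \<phi> g \<le> k * C_norm nC Y L N \<phi> g"
    using le k by (auto simp: field_simps)
  ultimately show ?thesis unfolding equivalent_norms_on_def by blast
qed

theorem theorem3:
  fixes L :: "'d::finite mdo"
    and Z :: "real ^ 'd \<Rightarrow> real"
    and Y :: "(nat \<Rightarrow> real) \<Rightarrow> real"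
    and N :: nat
    and p :: "nat \<Rightarrow> distribution ^ 'd"
    and \<phi> :: "nat \<Rightarrow> test_fun ^ 'd"
  assumes "det L \<noteq> 0"
    and "norm_on UNIV Z" and "monotone_norm Z"
    and "N = dim (null_space L)"
    and "norm_on (coord_space N) Y"
    and "admissible_system L N p \<phi>"
  shows
    \<comment> \<open>on test functions, the elements of the space are the distributions
        \<open>L\<^sup>\<star>{v} + (\<Sum>n. a\<^sub>n \<phi>\<^sub>n)\<close>\<close>
    "(\<forall>v\<in>C0. \<forall>a\<in>coord_space N. \<forall>\<psi>.
        C_elem L N \<phi> (v, a) (dist_of_test \<psi>) =
        pairing (mdo_apply (mdo_adj L) (dist_of_vfun v) + (\<Sum>n<N. a n *\<^sub>R dist_of_test (\<phi> n))) \<psi>) \<and>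
     \<comment> \<open>uniqueness of the representation\<close>
     inj_on (C_elem L N \<phi>) (C0 \<times> coord_space N) \<and>
     is_direct_sum (C_space L N \<phi>)
       (weak_action (mdo_adj L) ` C0) (span ((\<lambda>n. test_action L (\<phi> n)) ` {..<N})) \<and>
     (banach_on (C_space L N \<phi>) (C_norm (sup_of_norm Z) Y L N \<phi>) \<and>
      is_predual (C_space L N \<phi>) (C_norm (sup_of_norm Z) Y L N \<phi>)
        (native_space L) (native_norm (inner_norm (dual_norm Z)) (coord_dual_norm N Y) L \<phi>)) \<and>
     (banach_on (C_space L N \<phi>) (C_norm (norm_of_sup Z) Y L N \<phi>) \<and>
      equivalent_norms_on (C_space L N \<phi>)
        (C_norm (sup_of_norm Z) Y L N \<phi>) (C_norm (norm_of_sup Z) Y L N \<phi>) \<and>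
      is_predual (C_space L N \<phi>) (C_norm (norm_of_sup Z) Y L N \<phi>)
        (native_space L) (native_norm (outer_norm (dual_norm Z)) (coord_dual_norm N Y) L \<phi>))"
proof -
  interpret vector_norm Z by (rule vector_norm.intro) fact
  have ns: "native_setting L N p \<phi>" by (rule native_setting.intro) fact+
  interpret native_setting L N p \<phi> by (rule ns)
  have tn: "tuple_norm N Y" by (rule tuple_norm.intro) fact
  obtain c C where "C0_norm (sup_of_norm Z) (inner_norm (dual_norm Z)) c C" using C0_norm_sup_of_norm by blast
  then have sup: "predual_setting L N p \<phi> (sup_of_norm Z) (inner_norm (dual_norm Z)) c C Y"
    using ns tn by (intro predual_setting.intro)
  obtain c' C' where "C0_norm (norm_of_sup Z) (outer_norm (dual_norm Z)) c' C'"
    using C0_norm_norm_of_sup[OF \<open>monotone_norm Z\<close>] by blast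
  then have out: "predual_setting L N p \<phi> (norm_of_sup Z) (outer_norm (dual_norm Z)) c' C' Y"
    using ns tn by (intro predual_setting.intro)
  show ?thesis
    using C_elem_on_test_functions inj_C_elem direct_sum_C_space
      predual_setting.banach_C_space[OF sup] predual_setting.predual_C_space[OF sup]
      predual_setting.banach_C_space[OF out] predual_setting.predual_C_space[OF out]
      equivalent_C_norms[OF sup out]
    by simp
qed

end
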